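(* There is no $\gamma$ with $0<\gamma<1$, independent of $h$ and $H$, satisfying $$|\tilde a(v_I+v_\Delta, v_c)|\le \gamma\,\big(\tilde a(v_I+v_\Delta,v_I+v_\Delta)\big)^{1/2}\big(\tilde a(v_c,v_c)\big)^{1/2}$$ for all discrete $\tilde a$-harmonic functions $v=v_I+v_\Delta+v_c=\mathcal H^c(v_\Delta)\in X_h^c$. Precisely: it is not the case that for every admissible domain $\Omega$ and every admissible family of subdomain partitions and meshes there is a constant $\gamma\in(0,1)$, which may depend on $\Omega$ and the regularity constants of the family but not on $h$ or $H$, such that the inequality holds for all members of the family and all $v_\Delta$.
   Context: Setting. $\Omega\subset\mathbb R^d$ ($d=2,3$) is a bounded polygonal (polyhedral) domain, decomposed into nonoverlapping polygonal (polyhedral) Lipschitz subdomains $\Omega_1,\dots,\Omega_{N_s}$ of diameter comparable to $H$. Each $\Omega_j$ is a union of a uniformly bounded number of elements of a conforming, shape-regular, quasi-uniform coarse mesh $\mathcal T_H$ of $\Omega$ of mesh size $H$. The vertices of the subdomains (also called corners) are the vertices of $\mathcal T_H$. Each $\Omega_j$ carries a shape-regular quasi-uniform triangulation of mesh size $h$, and the triangulations match across the interface $\Gamma$, the union of the common boundaries of the subdomains. An admissible family is a collection of such partitions and meshes of a fixed $\Omega$, with varying $H$ and $h$, with uniform regularity constants. Spaces. $X_h^j$ is the conforming $\mathbb P_1$ finite element space on $\Omega_j$. $X_h^c$ is the space of functions $v$ on $\Omega$ with $v|_{\Omega_j}\in X_h^j$ for all $j$ that vanish on $\partial\Omega$ and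 are continuous at the subdomain vertices; at the other interface nodes they may be discontinuous across $\Gamma$. The bilinear form is $\tilde a(u,v)=\sum_{j=1}^{N_s}\int_{\Omega_j}\nabla u\cdot\nabla v\,dx$. Decomposition. Every $v\in X_h^c$ is written uniquely as $v=v_I+v_\Delta+v_c$, where, in terms of the nodal basis, $v_I$ is the part associated with nodes interior to the subdomains, $v_\Delta$ the part associated with the nodes on $\Gamma$ (not on $\partial\Omega$) other than subdomain vertices (with separate values from each adjacent subdomain), and $v_c$ the part associated with the subdomain vertices not on $\partial\Omega$ (one value per vertex). Discrete harmonic extension. Given $v_\Delta$, $\mathcal H^c(v_\Delta)\in X_h^c$ is the unique function $v=v_I+v_\Delta+v_c$ with the given $\Delta$-part such that $\tilde a(v,z)=0$ for all $z\in X_h^c$ with $z_\Delta=0$. Thus $v_I$ and $v_c$ are determined by $v_\Delta$. *)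

theory Defs
  imports "HOL-Analysis.Analysis"
begin

definition polyhedral_domain :: "'a::euclidean_space set \<Rightarrow> bool" where
  "polyhedral_domain \<Omega> \<longleftrightarrow>
     open \<Omega> \<and> connected \<Omega> \<and> bounded \<Omega> \<and> \<Omega> \<noteq> {} \<and> interior (closure \<Omega>) = \<Omega> \<and>
     (\<exists>\<P>. finite \<P> \<and> (\<forall>P\<in>\<P>. polytope P) \<and> closure \<Omega> = \<Union>\<P>)"

text \<open>Within distance \<open>r\<close> of each boundary point, \<open>D\<close> is the part lying strictly above the graph of
  an \<open>L\<close>-Lipschitz function; \<open>e\<close> is the upward direction, and the function depends on the
  coordinates orthogonal to \<open>e\<close> only.\<close>

definition lipschitz_domain :: "real \<Rightarrow> real \<Rightarrow> 'a::euclidean_space set \<Rightarrow> bool" where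
  "lipschitz_domain L r D \<longleftrightarrow>
     open D \<and> connected D \<and> bounded D \<and> D \<noteq> {} \<and> 0 < r \<and>
     (\<forall>x\<in>frontier D. \<exists>e \<phi>. norm e = 1 \<and> L-lipschitz_on UNIV \<phi> \<and>
        (\<forall>y\<in>ball x r. y \<in> D \<longleftrightarrow> \<phi> (y - (y \<bullet> e) *\<^sub>R e) < y \<bullet> e))"

text \<open>A point of a (possibly nonconvex) closed polyhedral set \<open>P\<close> is a vertex iff \<open>P\<close> is not
  locally invariant under translation along any line direction: interior points and points in the
  relative interior of a facet or of an edge have such a direction.\<close>

definition polyhedral_vertex :: "'a::euclidean_space set \<Rightarrow> 'a \<Rightarrow> bool" where
  "polyhedral_vertex P x \<longleftrightarrow> x \<in> P \<and>
     \<not> (\<exists>e r. e \<noteq> 0 \<and> 0 < r \<and>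
          (\<forall>y\<in>ball x r. \<forall>t. y + t *\<^sub>R e \<in> ball x r \<longrightarrow> (y \<in> P \<longleftrightarrow> y + t *\<^sub>R e \<in> P)))"

definition conforming_mesh :: "'a::euclidean_space set \<Rightarrow> 'a set set \<Rightarrow> bool" where
  "conforming_mesh D \<T> \<longleftrightarrow>
     triangulation \<T> \<and> (\<forall>T\<in>\<T>. int DIM('a) simplex T) \<and> \<Union>\<T> = closure D"

definition shape_regular :: "real \<Rightarrow> 'a::euclidean_space set set \<Rightarrow> bool" where
  "shape_regular \<sigma> \<T> \<longleftrightarrow> (\<forall>T\<in>\<T>. \<exists>x \<rho>. 0 < \<rho> \<and> cball x \<rho> \<subseteq> T \<and> diameter T \<le> \<sigma> * \<rho>)"

definition quasi_uniform :: "real \<Rightarrow> real \<Rightarrow> 'a::euclidean_space set set \<Rightarrow> bool" where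
  "quasi_uniform \<sigma> h \<T> \<longleftrightarrow> (\<forall>T\<in>\<T>. diameter T \<le> h \<and> h \<le> \<sigma> * diameter T)"

definition mesh_nodes :: "'a::euclidean_space set set \<Rightarrow> 'a set" where
  "mesh_nodes \<T> = (\<Union>T\<in>\<T>. {p. p extreme_point_of T})"

text \<open>\<open>fine_mesh M S\<close> is the triangulation carried by the subdomain \<open>S\<close>. The subdomains are open sets and
  serve as their own indices.\<close>

record 'a partition =
  subdomains :: "'a set set"
  coarse_mesh :: "'a set set"
  fine_mesh :: "'a set \<Rightarrow> 'a set set"
  sizeH :: real
  sizeh :: real

definition interface :: "'a::euclidean_space partition \<Rightarrow> 'a set" where
  "interface M = (\<Union>S\<in>subdomains M. \<Union>S'\<in>subdomains M - {S}. frontier S \<inter> frontier S')"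

definition corners :: "'a::euclidean_space partition \<Rightarrow> 'a set" where
  "corners M = (\<Union>S\<in>subdomains M. {p. polyhedral_vertex (closure S) p})"

text \<open>All regularity constants are collected in \<open>\<sigma>\<close>, except for the bound \<open>N\<close> on the number of
  coarse elements per subdomain. The Lipschitz condition is imposed at scale \<open>H\<close>.
  That the union of all the fine meshes is a triangulation is the matching condition across
  the interface.\<close>

definition admissible_partition ::
    "real \<Rightarrow> nat \<Rightarrow> 'a::euclidean_space set \<Rightarrow> 'a partition \<Rightarrow> bool" where
  "admissible_partition \<sigma> N \<Omega> M \<longleftrightarrow>
     0 < sizeH M \<and> 0 < sizeh M \<and>
     conforming_mesh \<Omega> (coarse_mesh M) \<and> shape_regular \<sigma> (coarse_mesh M) \<and>
     quasi_uniform \<sigma> (sizeH M) (coarse_mesh M) \<and>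
     finite (subdomains M) \<and> disjoint (subdomains M) \<and>
     (\<Union>S\<in>subdomains M. closure S) = closure \<Omega> \<and>
     (\<forall>S\<in>subdomains M.
        lipschitz_domain \<sigma> (sizeH M / \<sigma>) S \<and>
        sizeH M \<le> \<sigma> * diameter S \<and> diameter S \<le> \<sigma> * sizeH M \<and>
        (\<exists>\<K>\<subseteq>coarse_mesh M. card \<K> \<le> N \<and> closure S = \<Union>\<K>)) \<and>
     corners M = mesh_nodes (coarse_mesh M) \<and>
     (\<forall>S\<in>subdomains M.
        conforming_mesh S (fine_mesh M S) \<and> shape_regular \<sigma> (fine_mesh M S) \<and>
        quasi_uniform \<sigma> (sizeh M) (fine_mesh M S)) \<and>
     triangulation (\<Union>S\<in>subdomains M. fine_mesh M S)"

definition admissible_family :: "'a::euclidean_space set \<Rightarrow> 'a partition set \<Rightarrow> bool" where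
  "admissible_family \<Omega> \<F> \<longleftrightarrow>
     (\<exists>\<sigma> N. 0 < \<sigma> \<and> (\<forall>M\<in>\<F>. admissible_partition \<sigma> N \<Omega> M))"

definition P1_space :: "'a::euclidean_space partition \<Rightarrow> 'a set \<Rightarrow> ('a \<Rightarrow> real) set" where
  "P1_space M S = {f. continuous_on (closure S) f \<and>
     (\<forall>T\<in>fine_mesh M S. \<exists>a b. \<forall>x\<in>T. f x = a \<bullet> x + b) \<and>
     (\<forall>x. x \<notin> closure S \<longrightarrow> f x = 0)}"

text \<open>A function that may jump across the interface is a family \<open>v\<close>, where \<open>v S\<close> is the restriction
  to the subdomain \<open>S\<close>, extended continuously to \<open>closure S\<close>. Values at irrelevant arguments
  are normalised to \<open>0\<close>, so that equality of functions is equality in HOL.\<close>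

type_synonym 'a broken = "'a set \<Rightarrow> 'a \<Rightarrow> real"

definition Xc :: "'a::euclidean_space set \<Rightarrow> 'a partition \<Rightarrow> 'a broken set" where
  "Xc \<Omega> M = {v.
     (\<forall>S\<in>subdomains M. v S \<in> P1_space M S) \<and>
     (\<forall>S. S \<notin> subdomains M \<longrightarrow> v S = (\<lambda>x. 0)) \<and>
     (\<forall>S\<in>subdomains M. \<forall>x\<in>closure S \<inter> frontier \<Omega>. v S x = 0) \<and>
     (\<forall>p\<in>corners M. \<forall>S\<in>subdomains M. \<forall>S'\<in>subdomains M.
        p \<in> closure S \<inter> closure S' \<longrightarrow> v S p = v S' p)}"

definition grad :: "('a::euclidean_space \<Rightarrow> real) \<Rightarrow> 'a \<Rightarrow> 'a" where
  "grad f x = (\<Sum>b\<in>Basis. frechet_derivative f (at x) b *\<^sub>R b)"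

text \<open>The gradients exist off the (negligible) boundaries of the fine elements.\<close>

definition a_form :: "'a::euclidean_space partition \<Rightarrow> 'a broken \<Rightarrow> 'a broken \<Rightarrow> real" where
  "a_form M u v = (\<Sum>S\<in>subdomains M. integral S (\<lambda>x. grad (u S) x \<bullet> grad (v S) x))"

definition nodal_basis :: "'a::euclidean_space partition \<Rightarrow> 'a set \<Rightarrow> 'a \<Rightarrow> 'a \<Rightarrow> real" where
  "nodal_basis M S p = (THE f. f \<in> P1_space M S \<and>
     (\<forall>q\<in>mesh_nodes (fine_mesh M S). f q = (if q = p then 1 else 0)))"

text \<open>The part of \<open>v\<close> associated with the nodes \<open>p\<close> of each \<open>fine_mesh M S\<close> such that \<open>p \<in> A S\<close>.\<close>

definition nodal_part :: "'a::euclidean_space partition \<Rightarrow> ('a set \<Rightarrow> 'a set) \<Rightarrow> 'a broken \<Rightarrow> 'a broken" where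
  "nodal_part M A v = (\<lambda>S x. if S \<in> subdomains M
     then \<Sum>p\<in>mesh_nodes (fine_mesh M S) \<inter> A S. v S p * nodal_basis M S p x else 0)"

definition I_part :: "'a::euclidean_space partition \<Rightarrow> 'a broken \<Rightarrow> 'a broken" where
  "I_part M = nodal_part M (\<lambda>S. S)"

definition Delta_part :: "'a::euclidean_space set \<Rightarrow> 'a partition \<Rightarrow> 'a broken \<Rightarrow> 'a broken" where
  "Delta_part \<Omega> M = nodal_part M (\<lambda>S. interface M - frontier \<Omega> - corners M)"

definition c_part :: "'a::euclidean_space set \<Rightarrow> 'a partition \<Rightarrow> 'a broken \<Rightarrow> 'a broken" where
  "c_part \<Omega> M = nodal_part M (\<lambda>S. corners M - frontier \<Omega>)"

definition XDelta :: "'a::euclidean_space set \<Rightarrow> 'a partition \<Rightarrow> 'a broken set" where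
  "XDelta \<Omega> M = Delta_part \<Omega> M ` Xc \<Omega> M"

definition Hc :: "'a::euclidean_space set \<Rightarrow> 'a partition \<Rightarrow> 'a broken \<Rightarrow> 'a broken" where
  "Hc \<Omega> M w = (THE v. v \<in> Xc \<Omega> M \<and> Delta_part \<Omega> M v = w \<and>
     (\<forall>z\<in>Xc \<Omega> M. Delta_part \<Omega> M z = (\<lambda>S x. 0) \<longrightarrow> a_form M v z = 0))"

end

theory Submission
  imports Defs
begin

text \<open>Since \<open>v\<close> is discrete harmonic and \<open>v\<^sub>c\<close> has zero \<open>\<Delta>\<close>-part, \<open>v\<close> and \<open>v\<^sub>c\<close> are orthogonal
for the energy form. Writing \<open>A\<close> for the energy of \<open>v\<close> and \<open>C\<close> for that of \<open>v\<^sub>c\<close>, this turns the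
two factors into the energies \<open>A + C\<close> and \<open>C\<close> and the left-hand side into \<open>C\<close>, so that the inequality
says exactly that \<open>(1 - \<gamma>\<^sup>2) C \<le> \<gamma>\<^sup>2 A\<close>. It fails for every \<open>\<gamma> < 1\<close> as soon as there are harmonic functions
with \<open>A / C\<close> arbitrarily small.

The natural candidate is the constant function \<open>1\<close>, made admissible by setting it to \<open>0\<close> on the
boundary: \<open>v\<close> is the nodal function with value \<open>1\<close> at all nodes inside \<open>\<Omega>\<close> and \<open>0\<close> at the nodes on
the boundary. It varies only in a layer of width \<open>h\<close> along the boundary, with slope of order \<open>1/h\<close>,
so \<open>A\<close> is at most of order \<open>h * (1/h)\<^sup>2 = 1/h\<close>. On the other hand, \<open>v\<^sub>c\<close> is the sum of the nodal functions of all inner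
corners, and it has slope \<open>1/h\<close> next to each of them; if \<open>H/h\<close> stays bounded, these neighbourhoods
fill a fixed fraction of \<open>\<Omega>\<close>, so \<open>C\<close> is at least of order \<open>1/h\<^sup>2\<close>. Hence the family only has
to let \<open>H\<close> tend to zero with \<open>H = 2h\<close>.

The domain is the unit cube, the coarse mesh is its Kuhn (Freudenthal) triangulation with mesh
width \<open>1/m\<close>, each coarse simplex is a subdomain, and the fine mesh is the Kuhn triangulation of width
\<open>1/(2m)\<close>. This works uniformly in every dimension \<open>n \<ge> 2\<close>. Halving the mesh width creates only
nodes at edge midpoints, so there are no nodes inside subdomains, and no fine simplex
meets both an inner corner and the boundary. The second fact makes \<open>v\<close> harmonic
(\<open>bump_harmonic\<close>): a test function without \<open>\<Delta>\<close>-part lives on the fine simplices at inner corners, and there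
\<open>v\<close> is constant. The first fact, together with the observation that no fine simplex has two corners, makes the
harmonic extension unique (\<open>Hc_bump\<close>).

The Kuhn simplices are handled as the cells of the arrangement of all hyperplanes \<open>N x\<^sub>i = k\<close> and
\<open>N (x\<^sub>i - x\<^sub>j) = k\<close> with integer \<open>k\<close>, each cell being named by a point \<open>g\<close> that it contains. In this form
conformity (\<open>cell_Int_face\<close>), the refinement property (\<open>cell_refine\<close>) and the hat functions
(\<open>hat_affine_on_cell\<close>) follow from the fact that such a hyperplane does not separate two points of a
cell; that the cells are simplices (\<open>cell_eq_hull\<close>) comes from sorting fractional parts.
The energies are reduced to finite sums of volumes and slopes by \<open>a_form_eq_sum\<close>, and they are
estimated in \<open>bump_energy_bound\<close> and \<open>corner_bump_energy_bound\<close>.\<close>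

section \<open>Bounded convex domains are Lipschitz domains\<close>

text \<open>Near a boundary point \<open>x\<close>, a convex set that contains the ball \<open>B\<close> of radius \<open>\<rho>\<close> around \<open>c\<close> contains, together with a
  point \<open>s\<close>, the convex hull of \<open>s\<close> and \<open>B\<close>, hence the short part of a cone with apex \<open>s\<close> around the
  direction \<open>e\<close> from \<open>x\<close> to \<open>c\<close>. So close to \<open>x\<close> the set is a union of translates of one cone, and
  the lower boundary of such a union is the infimum of the graphs of Lipschitz functions.
  The hypotheses on \<open>r\<close> and \<open>L\<close> make the cone narrow and short enough for its translates to aim at \<open>B\<close>.\<close>

lemma lipschitz_domain_if_convex:
  fixes S :: "'a::euclidean_space set"
  assumes S: "open S" "convex S" "bounded S"
    and ball: "ball c \<rho> \<subseteq> S" and D: "\<And>x. x \<in> closure S \<Longrightarrow> dist x c \<le> D"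
    and "0 < r" "0 < L" "3 * r \<le> \<rho>" "2 * r + D / L < \<rho>"
  shows "lipschitz_domain L r S"
proof -
  have "0 < \<rho>" using assms by linarith
  then have "S \<noteq> {}" using ball by force
  moreover have "\<exists>e \<phi>. norm e = 1 \<and> L-lipschitz_on UNIV \<phi> \<and>
        (\<forall>y\<in>ball x r. y \<in> S \<longleftrightarrow> \<phi> (y - (y \<bullet> e) *\<^sub>R e) < y \<bullet> e)" if x: "x \<in> frontier S" for x
  proof -
    have "x \<notin> S" using x S(1) by (simp add: frontier_def interior_open)
    then have cx: "norm (c - x) \<ge> \<rho>" using ball by (auto simp: dist_norm subset_eq not_less)
    have cxD: "norm (c - x) \<le> D"
      using D[of x] x by (simp add: frontier_def dist_norm norm_minus_commute)
    define e where "e = (c - x) /\<^sub>R norm (c - x)"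
    have nz: "norm (c - x) \<noteq> 0" using cx \<open>0 < \<rho>\<close> by linarith
    then have e1: "norm e = 1" by (simp add: e_def)
    then have ee: "e \<bullet> e = 1" by (simp add: norm_eq_1)
    have cxe: "c - x = norm (c - x) *\<^sub>R e" using nz by (simp add: e_def)
    define P where "P y = y - (y \<bullet> e) *\<^sub>R e" for y
    have Pdiff: "P y - P z = P (y - z)" for y z by (simp add: P_def inner_diff_left algebra_simps)
    have PP: "P (P y) = P y" for y by (simp add: P_def inner_diff_left ee)
    have Pnorm: "norm (P y) \<le> norm y" for y
    proof -
      have "y \<bullet> y = P y \<bullet> P y + (y \<bullet> e)\<^sup>2"
        by (simp add: P_def inner_diff_left inner_diff_right ee power2_eq_square inner_commute)
      then show ?thesis by (simp add: norm_le)
    qed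
    define U where "U = S \<inter> ball x (2 * r)"
    have "U \<noteq> {}"
      using x \<open>0 < r\<close> unfolding U_def frontier_def
      by (metis DiffD1 Int_emptyI centre_in_ball closure_iff_nhds_not_empty inf_commute mult_pos_pos open_ball zero_less_numeral subset_refl)
    obtain B where B: "\<And>s. s \<in> U \<Longrightarrow> norm s \<le> B"
      using S(3) unfolding U_def bounded_iff by auto
    define f where "f z s = s \<bullet> e + L * norm (P z - P s)" for z s
    have bdd: "bdd_below (f z ` U)" for z
    proof (rule bdd_belowI2)
      fix s assume "s \<in> U"
      then have "\<bar>s \<bullet> e\<bar> \<le> B" using B[of s] Cauchy_Schwarz_ineq2[of s e] e1 by simp
      moreover have "0 \<le> L * norm (P z - P s)" using \<open>0 < L\<close> by simp
      ultimately show "- B \<le> f z s" unfolding f_def by linarith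
    qed
    \<comment> \<open>The graph of \<open>f z s\<close> as a function of \<open>z\<close> is the boundary of the cone with apex \<open>s\<close>.\<close>
    define \<phi> where "\<phi> z = (INF s\<in>U. f z s)" for z
    have step: "\<phi> z \<le> \<phi> z' + L * norm (z - z')" for z z'
    proof -
      have "\<phi> z - L * norm (z - z') \<le> f z' s" if "s \<in> U" for s
      proof -
        have "\<phi> z \<le> f z s" unfolding \<phi>_def by (rule cINF_lower[OF bdd that])
        moreover have "norm (P z - P s) \<le> norm (P z' - P s) + norm (z - z')"
          using norm_triangle_ineq[of "P z' - P s" "P z - P z'"] Pnorm[of "z - z'"]
          unfolding Pdiff[of z z', symmetric] by simp
        then have "f z s \<le> f z' s + L * norm (z - z')"
          using \<open>0 < L\<close> unfolding f_def by (smt (verit) distrib_left mult_left_mono)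
        ultimately show ?thesis by linarith
      qed
      then have "\<phi> z - L * norm (z - z') \<le> \<phi> z'"
        unfolding \<phi>_def[of z'] by (intro cINF_greatest \<open>U \<noteq> {}\<close>)
      then show ?thesis by linarith
    qed
    have "L-lipschitz_on UNIV \<phi>"
    proof (rule lipschitz_onI)
      fix z z'
      show "dist (\<phi> z) (\<phi> z') \<le> L * dist z z'"
        using step[of z z'] step[of z' z]
        by (auto simp: dist_norm norm_minus_commute abs_le_iff)
    qed (use \<open>0 < L\<close> in simp)
    moreover have "y \<in> S \<longleftrightarrow> \<phi> (P y) < y \<bullet> e" if y: "y \<in> ball x r" for y
    proof
      assume "y \<in> S"
      have "open (S \<inter> ball x r)" using S(1) by auto
      then obtain \<epsilon> where \<epsilon>: "0 < \<epsilon>" "cball y \<epsilon> \<subseteq> S \<inter> ball x r"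
        using \<open>y \<in> S\<close> y by (meson IntI open_contains_cball)
      have "y - \<epsilon> *\<^sub>R e \<in> cball y \<epsilon>" using \<epsilon>(1) e1 by (simp add: dist_norm)
      then have "y - \<epsilon> *\<^sub>R e \<in> S \<inter> ball x r" using \<epsilon>(2) by blast
      then have "y - \<epsilon> *\<^sub>R e \<in> U" using \<open>0 < r\<close> unfolding U_def by auto
      then have "\<phi> (P y) \<le> f (P y) (y - \<epsilon> *\<^sub>R e)" unfolding \<phi>_def by (rule cINF_lower[OF bdd])
      also have "\<dots> = y \<bullet> e - \<epsilon>"
      proof -
        have "P (y - \<epsilon> *\<^sub>R e) = P y" by (simp add: P_def inner_diff_left ee algebra_simps)
        then show ?thesis by (simp add: f_def PP inner_diff_left ee)
      qed
      finally show "\<phi> (P y) < y \<bullet> e" using \<open>0 < \<epsilon>\<close> by linarith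
    next
      assume "\<phi> (P y) < y \<bullet> e"
      then obtain s where s: "s \<in> U" and fs: "f (P y) s < y \<bullet> e"
        unfolding \<phi>_def using cINF_less_iff[OF \<open>U \<noteq> {}\<close> bdd] by blast
      define a where "a = (y - s) \<bullet> e"
      define b where "b = P (y - s)"
      have yab: "y = s + a *\<^sub>R e + b" by (simp add: a_def b_def P_def)
      have ba: "L * norm b < a"
        using fs by (simp add: f_def a_def b_def PP Pdiff inner_diff_left)
      then have "0 < a" using \<open>0 < L\<close> by (smt (verit) mult_nonneg_nonneg norm_ge_zero)
      have "dist x s < 2 * r" using s by (auto simp: U_def)
      moreover have "dist x y < r" using y by simp
      ultimately have "norm (y - s) \<le> 3 * r"
        using dist_triangle3[of y s x] by (simp add: dist_norm)
      then have "a \<le> 3 * r"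
        using Cauchy_Schwarz_ineq2[of "y - s" e] e1 by (simp add: a_def)
      \<comment> \<open>The point \<open>q\<close> lies on the ray from \<open>s\<close> through \<open>y\<close>, so far up that \<open>q - s\<close> has the same \<open>e\<close>-component as \<open>c - x\<close>.\<close>
      define t where "t = a / norm (c - x)"
      have "0 < norm (c - x)" "a \<le> norm (c - x)" using \<open>a \<le> 3 * r\<close> assms(8) cx \<open>0 < \<rho>\<close> by linarith+
      then have t: "0 < t" "t \<le> 1" using \<open>0 < a\<close> by (auto simp: t_def divide_le_eq)
      define q where "q = s + (c - x) + b /\<^sub>R t"
      have "norm (b /\<^sub>R t) = norm b * norm (c - x) / a" using nz \<open>0 < a\<close> by (simp add: t_def)
      also have "\<dots> \<le> norm (c - x) / L"
        using ba \<open>0 < a\<close> \<open>0 < L\<close> mult_right_mono[of "L * norm b" a "norm (c - x)"]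
        by (simp add: divide_simps mult_ac)
      also have "\<dots> \<le> D / L" using cxD \<open>0 < L\<close> by (simp add: divide_right_mono)
      finally have "norm (b /\<^sub>R t) \<le> D / L" .
      moreover have "norm (s - x) < 2 * r" using \<open>dist x s < 2 * r\<close> by (simp add: dist_norm norm_minus_commute)
      moreover have "q - c = (s - x) + b /\<^sub>R t" by (simp add: q_def)
      ultimately have "norm (q - c) < \<rho>"
        using norm_triangle_ineq[of "s - x" "b /\<^sub>R t"] assms(9) by simp
      then have "q \<in> S" using ball by (auto simp: dist_norm norm_minus_commute subset_eq)
      moreover have "s \<in> S" using s by (simp add: U_def)
      ultimately have "(1 - t) *\<^sub>R s + t *\<^sub>R q \<in> S"
        using S(2) t by (simp add: convex_alt)
      moreover have "a *\<^sub>R e = t *\<^sub>R (c - x)"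
        using nz by (subst cxe) (simp add: t_def)
      then have "(1 - t) *\<^sub>R s + t *\<^sub>R q = y"
        using t by (simp add: yab q_def algebra_simps)
      ultimately show "y \<in> S" by simp
    qed
    ultimately show ?thesis using e1 unfolding P_def by blast
  qed
  ultimately show ?thesis
    using S \<open>0 < r\<close> by (auto simp: lipschitz_domain_def convex_connected)
qed

section \<open>Piecewise affine functions and their energy\<close>

text \<open>This is how statements about nodal values propagate to whole elements: the set \<open>C\<close> will be a halfspace, a
  hyperplane or the preimage of an interval.\<close>

lemma convex_contains_simplex:
  fixes T :: "'a::euclidean_space set"
  assumes "n simplex T" "convex C" "\<And>p. p extreme_point_of T \<Longrightarrow> p \<in> C"
  shows "T \<subseteq> C"
proof -
  have "T = convex hull {p. p extreme_point_of T}"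
    using assms(1) by (intro Krein_Milman_Minkowski compact_simplex convex_simplex)
  also have "\<dots> \<subseteq> C" using assms(2,3) by (intro hull_minimal) auto
  finally show ?thesis .
qed

lemma interior_full_simplex:
  fixes T :: "'a::euclidean_space set"
  assumes "int DIM('a) simplex T"
  shows "interior T \<noteq> {}"
proof -
  have "aff_dim T = int DIM('a)" using assms by (rule aff_dim_simplex)
  moreover from this have "T \<noteq> {}" by auto
  ultimately show ?thesis
    using convex_simplex[OF assms] rel_interior_eq_empty interior_rel_interior_gen by metis
qed

text \<open>The intersection is a face of both simplices, and proper in at least one of them, hence of lower dimension.\<close>

lemma negligible_Int_full_simplices:
  fixes T :: "'a::euclidean_space set"
  assumes "triangulation \<T>" "T \<in> \<T>" "T' \<in> \<T>" "T \<noteq> T'"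
    and "int DIM('a) simplex T" "int DIM('a) simplex T'"
  shows "negligible (T \<inter> T')"
proof -
  have faces: "(T \<inter> T') face_of T" "(T \<inter> T') face_of T'"
    using assms(1-3) unfolding triangulation_def by (blast, metis Int_commute)
  have "convex T" "convex T'" using assms convex_simplex by auto
  have "aff_dim (T \<inter> T') < int DIM('a)"
  proof (cases "T \<inter> T' = T")
    case True
    then have "T \<inter> T' \<noteq> T'" using \<open>T \<noteq> T'\<close> by auto
    then have "aff_dim (T \<inter> T') < aff_dim T'"
      using face_of_aff_dim_lt[OF \<open>convex T'\<close> faces(2)] by simp
    then show ?thesis using aff_dim_simplex assms(6) by metis
  next
    case False
    then have "aff_dim (T \<inter> T') < aff_dim T"
      using face_of_aff_dim_lt[OF \<open>convex T\<close> faces(1)] by simp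
    then show ?thesis using aff_dim_simplex assms(5) by metis
  qed
  then have "interior (T \<inter> T') = {}" using aff_dim_nonempty_interior[of "T \<inter> T'"] by auto
  then show ?thesis
    using \<open>convex T\<close> \<open>convex T'\<close> by (simp add: negligible_convex_interior convex_Int)
qed

text \<open>The gradient of \<open>f\<close> on \<open>T\<close>, where \<open>f\<close> is assumed to be affine. It is unique if \<open>T\<close> has inner points.\<close>

definition slope :: "('a::euclidean_space \<Rightarrow> real) \<Rightarrow> 'a set \<Rightarrow> 'a" where
  "slope f T = (SOME a. \<exists>b. \<forall>x\<in>T. f x = a \<bullet> x + b)"

lemma slope_eq:
  fixes T :: "'a::euclidean_space set"
  assumes T: "interior T \<noteq> {}" and f: "\<And>x. x \<in> T \<Longrightarrow> f x = a \<bullet> x + b"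
  shows "slope f T = a"
proof -
  have "a' = a" if a': "\<forall>x\<in>T. f x = a' \<bullet> x + b'" for a' b'
  proof (rule ccontr)
    assume "a' \<noteq> a"
    define d where "d = a' - a"
    have "d \<noteq> 0" using \<open>a' \<noteq> a\<close> by (simp add: d_def)
    have const: "d \<bullet> x = b - b'" if "x \<in> T" for x
      using f[OF that] a' that by (auto simp: d_def inner_diff_left)
    obtain x e where e: "0 < e" "cball x e \<subseteq> T"
      using T by (meson ex_in_conv mem_interior_cball)
    define y where "y = x + (e / norm d) *\<^sub>R d"
    have "y \<in> cball x e" using \<open>d \<noteq> 0\<close> e(1) by (simp add: y_def dist_norm)
    then have "d \<bullet> y = d \<bullet> x" using const e by (metis centre_in_cball less_imp_le subsetD)
    then have "(e / norm d) * (d \<bullet> d) = 0" by (simp add: y_def inner_add_right)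
    then show False using e(1) \<open>d \<noteq> 0\<close> by simp
  qed
  moreover have "\<exists>a b. \<forall>x\<in>T. f x = a \<bullet> x + b" using f by blast
  then have "\<exists>b. \<forall>x\<in>T. f x = slope f T \<bullet> x + b" unfolding slope_def by (rule someI_ex)
  ultimately show ?thesis by blast
qed

lemma slope_const: "interior T \<noteq> {} \<Longrightarrow> (\<And>x. x \<in> T \<Longrightarrow> f x = c) \<Longrightarrow> slope f T = 0"
  by (rule slope_eq[where b = c]) auto

lemma grad_interior_eq:
  fixes T :: "'a::euclidean_space set"
  assumes "x \<in> interior T" and f: "\<And>x. x \<in> T \<Longrightarrow> f x = a \<bullet> x + b"
  shows "grad f x = a"
proof -
  have "((\<lambda>x. a \<bullet> x + b) has_derivative (\<lambda>h. a \<bullet> h)) (at x)"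
    by (auto intro!: derivative_eq_intros)
  moreover have "a \<bullet> y + b = f y" if "y \<in> interior T" for y
    using f[of y] that interior_subset by (metis subsetD)
  ultimately have "(f has_derivative (\<lambda>h. a \<bullet> h)) (at x)"
    using has_derivative_transform_within_open[OF _ open_interior assms(1)] by blast
  then have "frechet_derivative f (at x) = (\<lambda>h. a \<bullet> h)"
    by (metis frechet_derivative_at)
  then show ?thesis by (simp add: grad_def euclidean_representation)
qed

lemma has_integral_const_lmeasurable:
  assumes "S \<in> lmeasurable"
  shows "((\<lambda>x. c::real) has_integral measure lebesgue S * c) S"
proof -
  have "((\<lambda>x. 1::real) has_integral measure lebesgue S) S"
    unfolding lmeasure_integral[OF assms]
    using assms by (intro integrable_integral) (simp add: lmeasurable_iff_integrable_on)
  from has_integral_mult_left[OF this, of c] show ?thesis by simp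
qed

text \<open>Existence of the nodal basis is among the assumptions, so that nothing here depends on how the hat functions are
  constructed; its uniqueness is \<open>P1_eqI\<close>.\<close>

locale P1_partition =
  fixes M :: "'a::euclidean_space partition"
  assumes mesh: "\<And>S. S \<in> subdomains M \<Longrightarrow> conforming_mesh S (fine_mesh M S)"
    and open_subdomain: "\<And>S. S \<in> subdomains M \<Longrightarrow> open S"
    and convex_subdomain: "\<And>S. S \<in> subdomains M \<Longrightarrow> convex S"
    and Lagrange_basis: "\<And>S p. S \<in> subdomains M \<Longrightarrow> p \<in> mesh_nodes (fine_mesh M S) \<Longrightarrow>
        \<exists>f\<in>P1_space M S. \<forall>q\<in>mesh_nodes (fine_mesh M S). f q = (if q = p then 1 else 0)"
begin

abbreviation nodes :: "'a set \<Rightarrow> 'a set" where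
  "nodes S \<equiv> mesh_nodes (fine_mesh M S)"

lemma fine_mesh_simplex:
  assumes "S \<in> subdomains M" "T \<in> fine_mesh M S"
  shows "int DIM('a) simplex T"
  using mesh[OF assms(1)] assms(2) by (simp add: conforming_mesh_def)

lemma finite_fine_mesh: "S \<in> subdomains M \<Longrightarrow> finite (fine_mesh M S)"
  using mesh by (auto simp: conforming_mesh_def triangulation_def)

lemma Union_fine_mesh: "S \<in> subdomains M \<Longrightarrow> \<Union>(fine_mesh M S) = closure S"
  using mesh by (auto simp: conforming_mesh_def)

lemma fine_mesh_interior:
  assumes "S \<in> subdomains M" "T \<in> fine_mesh M S"
  shows "interior T \<noteq> {}"
  using fine_mesh_simplex[OF assms] by (rule interior_full_simplex)

lemma negligible_fine_mesh_overlap: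
  assumes "S \<in> subdomains M"
  shows "pairwise (\<lambda>T T'. negligible (T \<inter> T')) (fine_mesh M S)"
  unfolding pairwise_def
  using negligible_Int_full_simplices fine_mesh_simplex[OF assms] mesh[OF assms]
  by (auto simp: conforming_mesh_def)

lemma finite_nodes:
  assumes "S \<in> subdomains M"
  shows "finite (nodes S)"
proof -
  have "finite {p. p extreme_point_of T}" if "T \<in> fine_mesh M S" for T
    using fine_mesh_simplex[OF assms that] simplex_imp_polyhedron finite_polyhedron_extreme_points
    by metis
  then show ?thesis using finite_fine_mesh[OF assms] by (auto simp: mesh_nodes_def)
qed

lemma node_in_closure: "S \<in> subdomains M \<Longrightarrow> p \<in> nodes S \<Longrightarrow> p \<in> closure S"
  using Union_fine_mesh by (fastforce simp: mesh_nodes_def extreme_point_of_def)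

lemma P1_affine:
  assumes "f \<in> P1_space M S" "T \<in> fine_mesh M S"
  obtains a b where "\<And>x. x \<in> T \<Longrightarrow> f x = a \<bullet> x + b"
  using assms unfolding P1_space_def by blast

lemma P1_slope:
  assumes "S \<in> subdomains M" "f \<in> P1_space M S" "T \<in> fine_mesh M S"
  obtains b where "\<And>x. x \<in> T \<Longrightarrow> f x = slope f T \<bullet> x + b"
proof -
  obtain a b where f: "\<And>x. x \<in> T \<Longrightarrow> f x = a \<bullet> x + b" using P1_affine[OF assms(2,3)] by blast
  then have "slope f T = a" by (rule slope_eq[OF fine_mesh_interior[OF assms(1,3)]])
  then show ?thesis using that[of b] f by simp
qed

lemma P1_lincomb:
  assumes "f \<in> P1_space M S" "g \<in> P1_space M S"
  shows "(\<lambda>x. c * f x + d * g x) \<in> P1_space M S"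
proof -
  have "\<exists>a b. \<forall>x\<in>T. c * f x + d * g x = a \<bullet> x + b" if T: "T \<in> fine_mesh M S" for T
  proof -
    obtain a b where f: "\<And>x. x \<in> T \<Longrightarrow> f x = a \<bullet> x + b" using P1_affine[OF assms(1) T] by blast
    obtain a' b' where g: "\<And>x. x \<in> T \<Longrightarrow> g x = a' \<bullet> x + b'" using P1_affine[OF assms(2) T] by blast
    have "c * f x + d * g x = (c *\<^sub>R a + d *\<^sub>R a') \<bullet> x + (c * b + d * b')" if "x \<in> T" for x
      using f[OF that] g[OF that] by (simp add: inner_add_left algebra_simps)
    then show ?thesis by blast
  qed
  then show ?thesis using assms unfolding P1_space_def by (auto intro!: continuous_intros)
qed

lemma zero_P1: "(\<lambda>x. 0) \<in> P1_space M S"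
  unfolding P1_space_def by (auto intro!: exI[of _ 0])

lemma P1_sum:
  assumes "finite A" "\<And>p. p \<in> A \<Longrightarrow> f p \<in> P1_space M S"
  shows "(\<lambda>x. \<Sum>p\<in>A. c p * f p x) \<in> P1_space M S"
  using assms
proof (induction A)
  case empty
  then show ?case by (simp add: zero_P1)
next
  case (insert p A)
  then have "(\<lambda>x. c p * f p x + 1 * (\<Sum>p\<in>A. c p * f p x)) \<in> P1_space M S"
    by (intro P1_lincomb) auto
  then show ?case using insert by simp
qed

lemma P1_in_convex:
  assumes "S \<in> subdomains M" "f \<in> P1_space M S" "T \<in> fine_mesh M S" "convex C" "x \<in> T"
    and "\<And>p. p extreme_point_of T \<Longrightarrow> f p \<in> C"
  shows "f x \<in> C"
proof -
  obtain a b where f: "\<And>x. x \<in> T \<Longrightarrow> f x = a \<bullet> x + b" using P1_affine[OF assms(2,3)] by blast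
  have "convex ((\<lambda>x. a \<bullet> x) -` ((\<lambda>y. y - b) ` C))"
    by (intro convex_linear_vimage convex_translation_subtract assms bounded_linear.linear bounded_linear_inner_right)
  moreover have "p \<in> (\<lambda>x. a \<bullet> x) -` ((\<lambda>y. y - b) ` C)" if "p extreme_point_of T" for p
  proof -
    have "p \<in> T" using that by (simp add: extreme_point_of_def)
    then have "a \<bullet> p = f p - b" using f by simp
    then show ?thesis using assms(6)[OF that] by auto
  qed
  ultimately have "T \<subseteq> (\<lambda>x. a \<bullet> x) -` ((\<lambda>y. y - b) ` C)"
    using convex_contains_simplex[OF fine_mesh_simplex[OF assms(1,3)]] by blast
  then show ?thesis using f[OF assms(5)] assms(5) by auto
qed

lemma P1_eqI:
  assumes S: "S \<in> subdomains M" and f: "f \<in> P1_space M S" and g: "g \<in> P1_space M S"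
    and eq: "\<And>p. p \<in> nodes S \<Longrightarrow> f p = g p"
  shows "f = g"
proof
  fix x
  show "f x = g x"
  proof (cases "x \<in> closure S")
    case True
    then obtain T where T: "T \<in> fine_mesh M S" "x \<in> T" using Union_fine_mesh[OF S] by blast
    have "(\<lambda>x. 1 * f x + (-1) * g x) \<in> P1_space M S" using P1_lincomb[OF f g] .
    then have "1 * f x + (-1) * g x \<in> {0}"
      by (rule P1_in_convex[OF S _ T(1) convex_singleton T(2)])
         (use eq T in \<open>auto simp: mesh_nodes_def\<close>)
    then show ?thesis by simp
  next
    case False
    then show ?thesis using f g by (simp add: P1_space_def)
  qed
qed

lemma nodal_basis_props:
  assumes S: "S \<in> subdomains M" and p: "p \<in> nodes S"
  shows nodal_basis_P1: "nodal_basis M S p \<in> P1_space M S"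
    and nodal_basis_at: "\<And>q. q \<in> nodes S \<Longrightarrow> nodal_basis M S p q = (if q = p then 1 else 0)"
proof -
  let ?Q = "\<lambda>f. f \<in> P1_space M S \<and> (\<forall>q\<in>nodes S. f q = (if q = p then 1 else 0))"
  obtain f where f: "?Q f" using Lagrange_basis[OF S p] by blast
  have "?Q (nodal_basis M S p)"
    unfolding nodal_basis_def by (rule theI[of ?Q, OF f]) (use f P1_eqI[OF S] in auto)
  then show "nodal_basis M S p \<in> P1_space M S"
    "\<And>q. q \<in> nodes S \<Longrightarrow> nodal_basis M S p q = (if q = p then 1 else 0)" by auto
qed

lemma nodal_part_P1:
  assumes "S \<in> subdomains M"
  shows "nodal_part M A v S \<in> P1_space M S"
  unfolding nodal_part_def using assms
  by (auto intro!: P1_sum finite_nodes nodal_basis_P1)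

lemma nodal_part_at:
  assumes "S \<in> subdomains M" "q \<in> nodes S"
  shows "nodal_part M A v S q = (if q \<in> A S then v S q else 0)"
proof -
  have "nodal_part M A v S q = (\<Sum>p\<in>nodes S \<inter> A S. v S p * (if q = p then 1 else 0))"
    unfolding nodal_part_def using assms by (auto intro!: sum.cong simp: nodal_basis_at)
  also have "\<dots> = (\<Sum>p\<in>nodes S \<inter> A S. if q = p then v S p else 0)"
    by (intro sum.cong) auto
  also have "\<dots> = (if q \<in> A S then v S q else 0)"
    using assms finite_nodes by (simp add: sum.delta')
  finally show ?thesis .
qed

lemma nodal_part_outside: "S \<notin> subdomains M \<Longrightarrow> nodal_part M A v S = (\<lambda>x. 0)"
  by (simp add: nodal_part_def)

text \<open>The integrand is constant inside each element, and the overlaps and boundaries of elements have measure zero.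
  This replaces all further use of integrals by finite sums.\<close>

lemma a_form_eq_sum:
  assumes u: "\<And>S. S \<in> subdomains M \<Longrightarrow> u S \<in> P1_space M S"
    and v: "\<And>S. S \<in> subdomains M \<Longrightarrow> v S \<in> P1_space M S"
  shows "a_form M u v = (\<Sum>S\<in>subdomains M. \<Sum>T\<in>fine_mesh M S.
           measure lebesgue T * (slope (u S) T \<bullet> slope (v S) T))"
  unfolding a_form_def
proof (rule sum.cong[OF refl])
  fix S assume S: "S \<in> subdomains M"
  let ?g = "\<lambda>x. grad (u S) x \<bullet> grad (v S) x"
  have "(?g has_integral measure lebesgue T * (slope (u S) T \<bullet> slope (v S) T)) T"
    if T: "T \<in> fine_mesh M S" for T
  proof (rule has_integral_spike)
    have simp: "int DIM('a) simplex T" using fine_mesh_simplex[OF S T] .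
    then show "negligible (frontier T)" by (intro negligible_convex_frontier convex_simplex)
    show "((\<lambda>x. slope (u S) T \<bullet> slope (v S) T) has_integral
            measure lebesgue T * (slope (u S) T \<bullet> slope (v S) T)) T"
      using simp by (intro has_integral_const_lmeasurable lmeasurable_compact compact_simplex)
    fix x assume "x \<in> T - frontier T"
    then have x: "x \<in> interior T" using closure_subset by (auto simp: frontier_def)
    obtain b where b: "\<And>x. x \<in> T \<Longrightarrow> u S x = slope (u S) T \<bullet> x + b" using P1_slope[OF S u[OF S] T] by blast
    obtain b' where b': "\<And>x. x \<in> T \<Longrightarrow> v S x = slope (v S) T \<bullet> x + b'" using P1_slope[OF S v[OF S] T] by blast
    show "?g x = slope (u S) T \<bullet> slope (v S) T"
      by (simp only: grad_interior_eq[OF x b] grad_interior_eq[OF x b'])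
  qed
  then have "(?g has_integral (\<Sum>T\<in>fine_mesh M S. measure lebesgue T * (slope (u S) T \<bullet> slope (v S) T)))
      (\<Union>(fine_mesh M S))"
    by (intro has_integral_Union finite_fine_mesh negligible_fine_mesh_overlap S)
  then have closure_integral: "integral (closure S) ?g = (\<Sum>T\<in>fine_mesh M S. measure lebesgue T * (slope (u S) T \<bullet> slope (v S) T))"
    by (simp add: Union_fine_mesh[OF S] integral_unique)
  have "negligible (closure S - S)"
    using negligible_convex_frontier[OF convex_subdomain[OF S]] open_subdomain[OF S]
    by (simp add: frontier_def interior_open)
  then have "negligible {x \<in> closure S - S. ?g x \<noteq> 0}" by (rule negligible_subset) blast
  moreover have "{x \<in> S - closure S. ?g x \<noteq> 0} = {}" using closure_subset by blast
  then have "negligible {x \<in> S - closure S. ?g x \<noteq> 0}" by (simp only: negligible_empty)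
  ultimately have "integral S ?g = integral (closure S) ?g"
    by (intro integral_spike_set)
  then show "integral S ?g = (\<Sum>T\<in>fine_mesh M S. measure lebesgue T * (slope (u S) T \<bullet> slope (v S) T))"
    using closure_integral by simp
qed

lemma slope_diff:
  assumes "S \<in> subdomains M" "f \<in> P1_space M S" "g \<in> P1_space M S" "T \<in> fine_mesh M S"
  shows "slope (\<lambda>x. f x - g x) T = slope f T - slope g T"
proof -
  obtain b where f: "\<And>x. x \<in> T \<Longrightarrow> f x = slope f T \<bullet> x + b" using P1_slope[OF assms(1,2,4)] by blast
  obtain c where g: "\<And>x. x \<in> T \<Longrightarrow> g x = slope g T \<bullet> x + c" using P1_slope[OF assms(1,3,4)] by blast
  have "f x - g x = (slope f T - slope g T) \<bullet> x + (b - c)" if "x \<in> T" for x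
    using f[OF that] g[OF that] by (simp add: inner_diff_left)
  then show ?thesis by (rule slope_eq[OF fine_mesh_interior[OF assms(1,4)]])
qed

lemma a_form_commute: "a_form M u v = a_form M v u"
  by (simp add: a_form_def inner_commute)

lemma a_form_diff_left:
  assumes "\<And>S. S \<in> subdomains M \<Longrightarrow> u S \<in> P1_space M S"
    and "\<And>S. S \<in> subdomains M \<Longrightarrow> v S \<in> P1_space M S"
    and "\<And>S. S \<in> subdomains M \<Longrightarrow> w S \<in> P1_space M S"
  shows "a_form M (\<lambda>S x. u S x - v S x) w = a_form M u w - a_form M v w"
proof -
  have "(\<lambda>x. u S x - v S x) \<in> P1_space M S" if "S \<in> subdomains M" for S
    using P1_lincomb[OF assms(1)[OF that] assms(2)[OF that], of 1 "-1"] by simp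
  then have "a_form M (\<lambda>S x. u S x - v S x) w = (\<Sum>S\<in>subdomains M. \<Sum>T\<in>fine_mesh M S.
           measure lebesgue T * (slope (\<lambda>x. u S x - v S x) T \<bullet> slope (w S) T))"
    by (intro a_form_eq_sum assms(3))
  also have "\<dots> = a_form M u w - a_form M v w"
    by (simp add: a_form_eq_sum[OF assms(1,3)] a_form_eq_sum[OF assms(2,3)] slope_diff assms
        inner_diff_left right_diff_distrib sum_subtractf)
  finally show ?thesis .
qed

end

section \<open>Bump functions on a two-level partition\<close>

lemma lmeasurable_full_simplex:
  fixes T :: "'a::euclidean_space set"
  assumes "int DIM('a) simplex T"
  shows "T \<in> lmeasurable" "0 < measure lebesgue T"
proof -
  show T: "T \<in> lmeasurable" using assms by (intro lmeasurable_compact compact_simplex)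
  have "\<not> negligible T"
    using interior_full_simplex[OF assms] negligible_convex_interior convex_simplex[OF assms] by blast
  then have "measure lebesgue T \<noteq> 0" using T negligible_iff_measure0 by blast
  then show "0 < measure lebesgue T" by (simp add: zero_less_measure_iff)
qed

lemma norm_slope_le:
  fixes T :: "'a::euclidean_space set"
  assumes f: "\<And>x. x \<in> T \<Longrightarrow> f x = a \<bullet> x + b" and ball: "cball c \<rho> \<subseteq> T" "0 < \<rho>"
    and range: "\<And>x. x \<in> T \<Longrightarrow> f x \<in> {0..1}"
  shows "norm a \<le> 1 / \<rho>"
proof (cases "a = 0")
  case False
  define y where "y = c + (\<rho> / norm a) *\<^sub>R a"
  have "y \<in> T" "c \<in> T" using False ball by (auto simp: y_def dist_norm subset_eq)
  then have "f y - f c = \<rho> * norm a"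
    using f False by (simp add: y_def inner_add_right dot_square_norm power2_eq_square)
  moreover have "f y - f c \<le> 1" using range[OF \<open>y \<in> T\<close>] range[OF \<open>c \<in> T\<close>] by auto
  ultimately show ?thesis using ball(2) by (simp add: field_simps)
qed (use ball in simp)

text \<open>The combinatorial situation produced by halving the mesh width once: every fine node is a corner, a \<open>\<Delta>\<close>-node or
  lies on the boundary, an element has at most one corner, and an element at an inner corner stays away from the boundary.\<close>

locale two_level_partition = P1_partition M for M :: "'a::euclidean_space partition" +
  fixes \<Omega> :: "'a set"
  assumes open_domain: "open \<Omega>" and convex_domain: "convex \<Omega>"
    and finite_subdomains: "finite (subdomains M)"
    and subdomain_subset: "\<And>S. S \<in> subdomains M \<Longrightarrow> S \<subseteq> \<Omega>"
    and no_inner_nodes: "\<And>S. S \<in> subdomains M \<Longrightarrow> mesh_nodes (fine_mesh M S) \<inter> S = {}"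
    and node_on_interface: "\<And>S. S \<in> subdomains M \<Longrightarrow> mesh_nodes (fine_mesh M S) \<inter> \<Omega> \<subseteq> interface M"
    and corner_is_node: "\<And>S. S \<in> subdomains M \<Longrightarrow> corners M \<inter> closure S \<subseteq> mesh_nodes (fine_mesh M S)"
    and separated: "\<And>S T p q. \<lbrakk>S \<in> subdomains M; T \<in> fine_mesh M S; p extreme_point_of T;
          q extreme_point_of T; p \<in> corners M; p \<in> \<Omega>\<rbrakk> \<Longrightarrow> q \<notin> frontier \<Omega>"
    and only_corner: "\<And>S T p q. \<lbrakk>S \<in> subdomains M; T \<in> fine_mesh M S; p extreme_point_of T;
          q extreme_point_of T; p \<in> corners M; q \<in> corners M\<rbrakk> \<Longrightarrow> p = q"
begin

lemma fine_mesh_node: "T \<in> fine_mesh M S \<Longrightarrow> p extreme_point_of T \<Longrightarrow> p \<in> nodes S"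
  by (auto simp: mesh_nodes_def)

lemma closure_subdomain_subset: "S \<in> subdomains M \<Longrightarrow> closure S \<subseteq> closure \<Omega>"
  using subdomain_subset by (intro closure_mono) auto

lemma node_cases:
  assumes "S \<in> subdomains M" "p \<in> nodes S"
  shows "p \<in> frontier \<Omega> \<longleftrightarrow> p \<notin> \<Omega>"
  using node_in_closure[OF assms] closure_subdomain_subset[OF assms(1)] open_domain
  by (auto simp: frontier_def interior_open)

text \<open>Membership in \<open>Xc\<close> demands zero values at all boundary points, not only at nodes. A supporting
  hyperplane of the convex domain at the boundary point cuts a face out of the element; all vertices of this face
  are boundary nodes.\<close>

lemma vanishes_on_boundary:
  assumes S: "S \<in> subdomains M" and f: "f \<in> P1_space M S"
    and zero: "\<And>q. q \<in> nodes S \<Longrightarrow> q \<in> frontier \<Omega> \<Longrightarrow> f q = 0"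
    and x: "x \<in> closure S" "x \<in> frontier \<Omega>"
  shows "f x = 0"
proof -
  obtain T where T: "T \<in> fine_mesh M S" "x \<in> T" using x(1) Union_fine_mesh[OF S] by blast
  have simp: "int DIM('a) simplex T" using fine_mesh_simplex[OF S T(1)] .
  have T_sub: "T \<subseteq> closure \<Omega>"
    using T Union_fine_mesh[OF S] closure_subdomain_subset[OF S] by blast
  have "x \<in> closure \<Omega>" "x \<notin> \<Omega>" using x(2) open_domain by (auto simp: frontier_def interior_open)
  have nri: "x \<notin> rel_interior (closure \<Omega>)"
    using \<open>x \<notin> \<Omega>\<close> convex_rel_interior_closure[OF convex_domain] rel_interior_open[OF open_domain] by simp
  obtain a where a: "a \<noteq> 0" "\<And>y. y \<in> closure \<Omega> \<Longrightarrow> a \<bullet> x \<le> a \<bullet> y"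
    by (rule supporting_hyperplane_rel_boundary[OF convex_closure[OF convex_domain] \<open>x \<in> closure \<Omega>\<close> nri]) (rule that)
  define F where "F = T \<inter> {y. a \<bullet> y = a \<bullet> x}"
  have face: "F face_of T"
    unfolding F_def
    by (rule face_of_Int_supporting_hyperplane_ge[OF convex_simplex[OF simp]]) (rule a(2)[OF subsetD[OF T_sub]])
  have F: "F = convex hull {q. q extreme_point_of F}"
  proof (rule Krein_Milman_Minkowski)
    show "compact F" using face_of_imp_compact[OF convex_simplex[OF simp] compact_simplex[OF simp] face] .
    show "convex F" using face_of_imp_convex[OF face] .
  qed
  obtain A b where Ab: "\<And>x. x \<in> T \<Longrightarrow> f x = A \<bullet> x + b" using P1_affine[OF f T(1)] by blast
  have "A \<bullet> q = - b" if "q extreme_point_of F" for q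
  proof -
    have q: "q extreme_point_of T" "q \<in> F" using extreme_point_of_face[OF face] that by auto
    have "\<Omega> \<subseteq> interior {y. a \<bullet> x \<le> a \<bullet> y}"
      using a(2) closure_subset by (intro interior_maximal open_domain) blast
    then have "\<Omega> \<subseteq> {y. a \<bullet> x < a \<bullet> y}" using interior_halfspace_ge[OF a(1)] by simp
    then have "q \<notin> \<Omega>" using q(2) by (auto simp: F_def)
    moreover have "q \<in> nodes S" using fine_mesh_node[OF T(1) q(1)] .
    ultimately have "f q = 0" using zero node_cases[OF S] by blast
    moreover have "f q = A \<bullet> q + b" using Ab[of q] q(2) by (simp add: F_def)
    ultimately show ?thesis by linarith
  qed
  then have "F \<subseteq> {y. A \<bullet> y = - b}"
    using hull_minimal[of "{q. q extreme_point_of F}" "{y. A \<bullet> y = - b}" convex] convex_hyperplane F by auto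
  moreover have "x \<in> F" using T(2) by (simp add: F_def)
  ultimately show ?thesis using Ab[OF T(2)] by auto
qed

lemma nodal_indicator_at:
  "S \<in> subdomains M \<Longrightarrow> q \<in> nodes S \<Longrightarrow>
    nodal_part M (\<lambda>S. A) (\<lambda>S x. 1) S q = (if q \<in> A then 1 else 0)"
  by (rule nodal_part_at)

lemma nodal_indicator_in_Xc:
  assumes "A \<subseteq> \<Omega>"
  shows "nodal_part M (\<lambda>S. A) (\<lambda>S x. 1) \<in> Xc \<Omega> M"
proof -
  let ?v = "nodal_part M (\<lambda>S. A) (\<lambda>S x. 1)"
  have "?v S x = 0" if "S \<in> subdomains M" "x \<in> closure S" "x \<in> frontier \<Omega>" for S x
  proof (rule vanishes_on_boundary[OF that(1) nodal_part_P1[OF that(1)] _ that(2,3)])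
    fix q assume q: "q \<in> nodes S" "q \<in> frontier \<Omega>"
    then have "q \<notin> A" using assms node_cases[OF that(1) q(1)] by blast
    then show "?v S q = 0" by (simp add: nodal_indicator_at[OF that(1) q(1)])
  qed
  moreover have "?v S p = ?v S' p"
    if S: "S \<in> subdomains M" "S' \<in> subdomains M" and p: "p \<in> corners M" "p \<in> closure S \<inter> closure S'" for S S' p
  proof -
    have "p \<in> nodes S" "p \<in> nodes S'" using corner_is_node S p by blast+
    then show ?thesis by (simp add: nodal_indicator_at S)
  qed
  ultimately show ?thesis
    unfolding Xc_def using nodal_part_P1 nodal_part_outside by blast
qed

lemma Xc_P1: "v \<in> Xc \<Omega> M \<Longrightarrow> S \<in> subdomains M \<Longrightarrow> v S \<in> P1_space M S"
  by (simp add: Xc_def)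

text \<open>The harmonic function with small energy: constant, except next to the boundary.\<close>

definition bump :: "'a broken" where
  "bump = nodal_part M (\<lambda>S. \<Omega>) (\<lambda>S x. 1)"

text \<open>The corner part of \<open>bump\<close>, see \<open>c_part_bump\<close>.\<close>

definition corner_bump :: "'a broken" where
  "corner_bump = nodal_part M (\<lambda>S. corners M \<inter> \<Omega>) (\<lambda>S x. 1)"

lemma bump_in_Xc: "bump \<in> Xc \<Omega> M" and corner_bump_in_Xc: "corner_bump \<in> Xc \<Omega> M"
  unfolding bump_def corner_bump_def by (intro nodal_indicator_in_Xc; blast)+

lemma bump_at: "S \<in> subdomains M \<Longrightarrow> q \<in> nodes S \<Longrightarrow> bump S q = (if q \<in> \<Omega> then 1 else 0)"
  unfolding bump_def by (rule nodal_indicator_at)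

lemma corner_bump_at:
  "S \<in> subdomains M \<Longrightarrow> q \<in> nodes S \<Longrightarrow> corner_bump S q = (if q \<in> corners M \<inter> \<Omega> then 1 else 0)"
  unfolding corner_bump_def by (rule nodal_indicator_at)

lemma c_part_bump: "c_part \<Omega> M bump = corner_bump"
  unfolding c_part_def corner_bump_def nodal_part_def
proof (intro ext)
  fix S x
  have "nodes S \<inter> (corners M - frontier \<Omega>) = nodes S \<inter> (corners M \<inter> \<Omega>)" if "S \<in> subdomains M"
    using node_cases[OF that] by blast
  then show "(if S \<in> subdomains M then \<Sum>p\<in>nodes S \<inter> (corners M - frontier \<Omega>). bump S p * nodal_basis M S p x else 0) =
       (if S \<in> subdomains M then \<Sum>p\<in>nodes S \<inter> (corners M \<inter> \<Omega>). 1 * nodal_basis M S p x else 0)"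
    by (auto intro!: sum.cong simp: bump_at)
qed

lemma I_Delta_part_bump:
  "(\<lambda>S x. I_part M bump S x + Delta_part \<Omega> M bump S x) = (\<lambda>S x. bump S x - corner_bump S x)"
proof
  fix S
  let ?f = "\<lambda>x. I_part M bump S x + Delta_part \<Omega> M bump S x"
  let ?g = "\<lambda>x. bump S x - corner_bump S x"
  show "?f = ?g"
  proof (cases "S \<in> subdomains M")
    case S: True
    have P1: "I_part M bump S \<in> P1_space M S" "Delta_part \<Omega> M bump S \<in> P1_space M S"
      unfolding I_part_def Delta_part_def using nodal_part_P1[OF S] by blast+
    show ?thesis
    proof (rule P1_eqI[OF S])
      show "?f \<in> P1_space M S" using P1_lincomb[OF P1, of 1 1] by simp
      show "?g \<in> P1_space M S"
        using P1_lincomb[OF Xc_P1[OF bump_in_Xc S] Xc_P1[OF corner_bump_in_Xc S], of 1 "-1"] by simp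
      fix p assume p: "p \<in> nodes S"
      have "I_part M bump S p = 0"
        unfolding I_part_def nodal_part_at[OF S p] using no_inner_nodes[OF S] p by auto
      moreover have "Delta_part \<Omega> M bump S p = (if p \<in> corners M then 0 else bump S p)"
        unfolding Delta_part_def nodal_part_at[OF S p]
        using node_on_interface[OF S] p node_cases[OF S p] bump_at[OF S p] by auto
      ultimately show "?f p = ?g p"
        using bump_at[OF S p] corner_bump_at[OF S p] by simp
    qed
  next
    case False
    then show ?thesis
      by (simp add: I_part_def Delta_part_def bump_def corner_bump_def nodal_part_outside)
  qed
qed

text \<open>The functions with zero \<open>\<Delta>\<close>-part, which are the test functions for harmonicity, are spanned by the nodal functions of
  the inner corners.\<close>

lemma corner_function_at:
  assumes z: "z \<in> Xc \<Omega> M" "Delta_part \<Omega> M z = (\<lambda>S x. 0)"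
    and S: "S \<in> subdomains M" and q: "q \<in> nodes S" "q \<notin> corners M \<inter> \<Omega>"
  shows "z S q = 0"
proof (cases "q \<in> \<Omega>")
  case True
  then have "q \<in> interface M - frontier \<Omega> - corners M"
    using q node_on_interface[OF S] node_cases[OF S q(1)] by blast
  then have "z S q = Delta_part \<Omega> M z S q"
    unfolding Delta_part_def nodal_part_at[OF S q(1)] by simp
  then show ?thesis using z(2) by simp
next
  case False
  then show ?thesis using z(1) S q node_cases[OF S q(1)] node_in_closure[OF S q(1)] by (auto simp: Xc_def)
qed

lemma constant_slope:
  assumes S: "S \<in> subdomains M" and T: "T \<in> fine_mesh M S" and f: "f \<in> P1_space M S"
    and "\<And>p. p extreme_point_of T \<Longrightarrow> f p = c"
  shows "slope f T = 0"
proof -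
  have "f x \<in> {c}" if "x \<in> T" for x
    using P1_in_convex[OF S f T convex_singleton that] assms(4) by blast
  then show ?thesis by (intro slope_const[OF fine_mesh_interior[OF S T], where c = c]) auto
qed

text \<open>On an element at an inner corner, all nodes are inside the domain and \<open>bump\<close> is constant \<open>1\<close>; on every
  other element the test function vanishes.\<close>

lemma bump_harmonic:
  assumes z: "z \<in> Xc \<Omega> M" "Delta_part \<Omega> M z = (\<lambda>S x. 0)"
  shows "a_form M bump z = 0"
proof -
  have "slope (bump S) T \<bullet> slope (z S) T = 0" if S: "S \<in> subdomains M" and T: "T \<in> fine_mesh M S" for S T
  proof (cases "\<exists>p. p extreme_point_of T \<and> p \<in> corners M \<inter> \<Omega>")
    case True
    then have "bump S q = 1" if "q extreme_point_of T" for q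
      using separated[OF S T _ that] node_cases[OF S fine_mesh_node[OF T that]]
        bump_at[OF S fine_mesh_node[OF T that]] by auto
    then have "slope (bump S) T = 0" by (rule constant_slope[OF S T Xc_P1[OF bump_in_Xc S]])
    then show ?thesis by simp
  next
    case False
    then have "z S q = 0" if "q extreme_point_of T" for q
      using corner_function_at[OF z S fine_mesh_node[OF T that]] that by blast
    then have "slope (z S) T = 0" by (rule constant_slope[OF S T Xc_P1[OF z(1) S]])
    then show ?thesis by simp
  qed
  then show ?thesis
    using a_form_eq_sum[of bump z] Xc_P1[OF bump_in_Xc] Xc_P1[OF z(1)] by simp
qed

lemma noncorner_vertex:
  assumes "S \<in> subdomains M" "T \<in> fine_mesh M S"
  shows "\<exists>q. q extreme_point_of T \<and> q \<noteq> p"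
proof (rule ccontr)
  assume "\<not> ?thesis"
  then have "T \<subseteq> {p}" using fine_mesh_simplex[OF assms] by (intro convex_contains_simplex) auto
  then have "interior T = {}" using interior_mono[of T "{p}"] by simp
  then show False using fine_mesh_interior[OF assms] by simp
qed

text \<open>If the energy vanishes, the function is constant on each element. Each element has at least two vertices, of which
  at most one is a corner, so the constant is zero.\<close>

lemma corner_energy_definite:
  assumes z: "z \<in> Xc \<Omega> M" "Delta_part \<Omega> M z = (\<lambda>S x. 0)" and energy: "a_form M z z = 0"
  shows "z = (\<lambda>S x. 0)"
proof
  fix S
  show "z S = (\<lambda>x. 0)"
  proof (cases "S \<in> subdomains M")
    case S: True
    let ?e = "\<lambda>S. \<Sum>T\<in>fine_mesh M S. measure lebesgue T * (slope (z S) T \<bullet> slope (z S) T)"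
    have "(\<Sum>S\<in>subdomains M. ?e S) = 0"
      using a_form_eq_sum[OF Xc_P1[OF z(1)] Xc_P1[OF z(1)]] energy by simp
    then have "?e S = 0"
      using finite_subdomains S by (subst (asm) sum_nonneg_eq_0_iff) (auto intro!: sum_nonneg)
    then have slope0: "slope (z S) T = 0" if "T \<in> fine_mesh M S" for T
      using that lmeasurable_full_simplex[OF fine_mesh_simplex[OF S that]] finite_fine_mesh[OF S]
      by (subst (asm) sum_nonneg_eq_0_iff) auto
    have "z S p = 0" if "p \<in> nodes S" for p
    proof -
      obtain T where T: "T \<in> fine_mesh M S" and p: "p extreme_point_of T"
        using \<open>p \<in> nodes S\<close> by (auto simp: mesh_nodes_def)
      obtain b where b: "\<And>x. x \<in> T \<Longrightarrow> z S x = slope (z S) T \<bullet> x + b"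
        using P1_slope[OF S Xc_P1[OF z(1) S] T] by blast
      obtain q where q: "q extreme_point_of T" "q \<noteq> p" using noncorner_vertex[OF S T] by blast
      have "z S q = b" "z S p = b"
        using b slope0[OF T] p q by (simp_all add: extreme_point_of_def)
      moreover have "p \<notin> corners M \<or> q \<notin> corners M" using only_corner[OF S T p q(1)] q(2) by blast
      ultimately show ?thesis
        using corner_function_at[OF z S] fine_mesh_node[OF T] p q(1) by (metis IntD1)
    qed
    then show ?thesis by (intro P1_eqI[OF S Xc_P1[OF z(1) S] zero_P1])
  next
    case False
    then show ?thesis using z(1) by (simp add: Xc_def)
  qed
qed

lemma Xc_diff:
  assumes "u \<in> Xc \<Omega> M" "v \<in> Xc \<Omega> M"
  shows "(\<lambda>S x. u S x - v S x) \<in> Xc \<Omega> M"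
proof -
  have "(\<lambda>x. u S x - v S x) \<in> P1_space M S" if "S \<in> subdomains M" for S
    using P1_lincomb[OF assms[THEN Xc_P1, OF that], of 1 "-1"] by simp
  moreover have "(\<lambda>x. u S x - v S x) = (\<lambda>x. 0)" if "S \<notin> subdomains M" for S
    using assms that by (simp add: Xc_def)
  moreover have "u S x - v S x = 0" if "S \<in> subdomains M" "x \<in> closure S \<inter> frontier \<Omega>" for S x
  proof -
    have "u S x = 0" "v S x = 0" using assms that unfolding Xc_def by blast+
    then show ?thesis by simp
  qed
  moreover have "u S p - v S p = u S' p - v S' p"
    if "p \<in> corners M" "S \<in> subdomains M" "S' \<in> subdomains M" "p \<in> closure S \<inter> closure S'" for p S S'
  proof -
    have "u S p = u S' p" "v S p = v S' p" using assms that unfolding Xc_def by blast+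
    then show ?thesis by simp
  qed
  ultimately show ?thesis unfolding Xc_def by blast
qed

text \<open>The difference of two harmonic functions with the same \<open>\<Delta>\<close>-part is itself an admissible test function, so it is orthogonal to
  itself.\<close>

lemma Hc_bump: "Hc \<Omega> M (Delta_part \<Omega> M bump) = bump"
  unfolding Hc_def
proof (rule the_equality)
  fix v
  assume v: "v \<in> Xc \<Omega> M \<and> Delta_part \<Omega> M v = Delta_part \<Omega> M bump \<and>
     (\<forall>z\<in>Xc \<Omega> M. Delta_part \<Omega> M z = (\<lambda>S x. 0) \<longrightarrow> a_form M v z = 0)"
  define z where "z = (\<lambda>S x. v S x - bump S x)"
  have z: "z \<in> Xc \<Omega> M" unfolding z_def using v bump_in_Xc Xc_diff by blast
  have "Delta_part \<Omega> M z = (\<lambda>S x. Delta_part \<Omega> M v S x - Delta_part \<Omega> M bump S x)"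
    unfolding Delta_part_def nodal_part_def z_def
    by (intro ext) (simp add: left_diff_distrib sum_subtractf)
  then have Dz: "Delta_part \<Omega> M z = (\<lambda>S x. 0)" using v by simp
  have "a_form M z z = a_form M v z - a_form M bump z"
    using a_form_diff_left[of v bump z] v Xc_P1 bump_in_Xc z unfolding z_def[symmetric] by blast
  then have "a_form M z z = 0" using v z Dz bump_harmonic[OF z Dz] by simp
  then have "z = (\<lambda>S x. 0)" using corner_energy_definite[OF z Dz] by simp
  then have "v S x - bump S x = 0" for S x unfolding z_def by metis
  then show "v = bump" by (intro ext) simp
qed (use bump_in_Xc bump_harmonic in blast)

lemma Delta_part_corner_bump: "Delta_part \<Omega> M corner_bump = (\<lambda>S x. 0)"
proof
  fix S
  show "Delta_part \<Omega> M corner_bump S = (\<lambda>x. 0)"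
  proof (cases "S \<in> subdomains M")
    case S: True
    show ?thesis
    proof (rule P1_eqI[OF S _ zero_P1])
      show "Delta_part \<Omega> M corner_bump S \<in> P1_space M S"
        unfolding Delta_part_def by (rule nodal_part_P1[OF S])
      show "Delta_part \<Omega> M corner_bump S p = 0" if "p \<in> nodes S" for p
        unfolding Delta_part_def nodal_part_at[OF S that] using corner_bump_at[OF S that] by simp
    qed
  qed (simp add: Delta_part_def nodal_part_outside)
qed

text \<open>Harmonicity makes \<open>bump\<close> and \<open>corner_bump\<close> orthogonal. By Pythagoras the energy of their difference is \<open>A + C\<close>, where
  \<open>A\<close> and \<open>C\<close> are their energies, and the inner product of the difference with \<open>corner_bump\<close> is \<open>- C\<close>.\<close>

lemma strengthened_Cauchy_Schwarz_imp_energy_bound: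
  fixes \<gamma> :: real
  assumes "0 < \<gamma>"
    and ineq: "\<forall>w\<in>XDelta \<Omega> M.
                 let v = Hc \<Omega> M w;
                     v\<^sub>I\<^sub>\<Delta> = (\<lambda>S x. I_part M v S x + Delta_part \<Omega> M v S x);
                     v\<^sub>c = c_part \<Omega> M v
                 in \<bar>a_form M v\<^sub>I\<^sub>\<Delta> v\<^sub>c\<bar>
                      \<le> \<gamma> * sqrt (a_form M v\<^sub>I\<^sub>\<Delta> v\<^sub>I\<^sub>\<Delta>) * sqrt (a_form M v\<^sub>c v\<^sub>c)"
  shows "(1 - \<gamma>\<^sup>2) * a_form M corner_bump corner_bump \<le> \<gamma>\<^sup>2 * a_form M bump bump"
proof -
  define A where "A = a_form M bump bump"
  define C where "C = a_form M corner_bump corner_bump"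
  let ?d = "\<lambda>S x. bump S x - corner_bump S x"
  have nonneg: "0 \<le> a_form M v v" if "v \<in> Xc \<Omega> M" for v
    using a_form_eq_sum[OF Xc_P1[OF that] Xc_P1[OF that]] by (simp add: sum_nonneg)
  have "0 \<le> A" "0 \<le> C" unfolding A_def C_def using nonneg bump_in_Xc corner_bump_in_Xc by auto
  have orth: "a_form M bump corner_bump = 0"
    using bump_harmonic[OF corner_bump_in_Xc Delta_part_corner_bump] .
  note P1 = Xc_P1[OF bump_in_Xc] Xc_P1[OF corner_bump_in_Xc] Xc_P1[OF Xc_diff[OF bump_in_Xc corner_bump_in_Xc]]
  have dc: "a_form M ?d corner_bump = - C"
    using a_form_diff_left[OF P1(1,2,2)] orth by (simp add: C_def)
  have "a_form M ?d bump = A"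
    using a_form_diff_left[OF P1(1,2,1)] orth a_form_commute[of corner_bump bump] by (simp add: A_def)
  then have dd: "a_form M ?d ?d = A + C"
    using a_form_diff_left[OF P1(1,2,3)] dc a_form_commute[of bump ?d] a_form_commute[of corner_bump ?d] by simp
  have "Delta_part \<Omega> M bump \<in> XDelta \<Omega> M" using bump_in_Xc by (simp add: XDelta_def)
  from bspec[OF ineq this] have "C \<le> \<gamma> * sqrt (A + C) * sqrt C"
    unfolding Hc_bump c_part_bump Let_def I_Delta_part_bump dc dd C_def[symmetric]
    using \<open>0 \<le> C\<close> by simp
  then have "C\<^sup>2 \<le> (\<gamma> * sqrt (A + C) * sqrt C)\<^sup>2" using \<open>0 \<le> C\<close> by (rule power_mono)
  also have "\<dots> = \<gamma>\<^sup>2 * (A + C) * C" using \<open>0 \<le> A\<close> \<open>0 \<le> C\<close> by (simp add: power_mult_distrib)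
  finally have "C * C \<le> (\<gamma>\<^sup>2 * (A + C)) * C" by (simp add: power2_eq_square)
  then have "C \<le> \<gamma>\<^sup>2 * (A + C)"
  proof (cases "C = 0")
    case False
    then show ?thesis using \<open>C * C \<le> _\<close> \<open>0 \<le> C\<close> by (simp add: mult_le_cancel_right)
  qed (use \<open>0 \<le> A\<close> in simp)
  then show ?thesis unfolding A_def[symmetric] C_def[symmetric] by (simp add: algebra_simps)
qed

text \<open>Only elements that touch the boundary contribute. There the values range in the unit interval, so the inscribed
  ball bounds the slope by \<open>1/\<rho>\<close>.\<close>

lemma bump_energy_le:
  assumes "0 < \<rho>" and ball: "\<And>S T. S \<in> subdomains M \<Longrightarrow> T \<in> fine_mesh M S \<Longrightarrow> \<exists>c. cball c \<rho> \<subseteq> T"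
  shows "a_form M bump bump \<le> 1 / \<rho>\<^sup>2 * (\<Sum>S\<in>subdomains M.
      \<Sum>T\<in>{T\<in>fine_mesh M S. \<exists>q. q extreme_point_of T \<and> q \<in> frontier \<Omega>}. measure lebesgue T)"
proof -
  have "measure lebesgue T * (slope (bump S) T \<bullet> slope (bump S) T) \<le>
      (if \<exists>q. q extreme_point_of T \<and> q \<in> frontier \<Omega> then 1 / \<rho>\<^sup>2 * measure lebesgue T else 0)"
    if S: "S \<in> subdomains M" and T: "T \<in> fine_mesh M S" for S T
  proof (cases "\<exists>q. q extreme_point_of T \<and> q \<in> frontier \<Omega>")
    case True
    obtain c where c: "cball c \<rho> \<subseteq> T" using ball[OF S T] by blast
    have "bump S x \<in> {0..1}" if "x \<in> T" for x
      by (rule P1_in_convex[OF S Xc_P1[OF bump_in_Xc S] T convex_real_interval(5) that])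
        (use bump_at[OF S fine_mesh_node[OF T]] in auto)
    moreover obtain b where "\<And>x. x \<in> T \<Longrightarrow> bump S x = slope (bump S) T \<bullet> x + b"
      using P1_slope[OF S Xc_P1[OF bump_in_Xc S] T] by blast
    ultimately have "norm (slope (bump S) T) \<le> 1 / \<rho>"
      using norm_slope_le[OF _ c \<open>0 < \<rho>\<close>, of "bump S"] by blast
    then have "(norm (slope (bump S) T))\<^sup>2 \<le> (1 / \<rho>)\<^sup>2" by (intro power_mono) auto
    then have "slope (bump S) T \<bullet> slope (bump S) T \<le> 1 / \<rho>\<^sup>2"
      by (simp add: power2_norm_eq_inner power_divide)
    then have "measure lebesgue T * (slope (bump S) T \<bullet> slope (bump S) T) \<le> measure lebesgue T * (1 / \<rho>\<^sup>2)"
      by (intro mult_left_mono) auto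
    then show ?thesis using True by simp
  next
    case False
    then have "bump S q = 1" if "q extreme_point_of T" for q
      using that bump_at[OF S fine_mesh_node[OF T that]] node_cases[OF S fine_mesh_node[OF T that]] by auto
    then have "slope (bump S) T = 0" by (rule constant_slope[OF S T Xc_P1[OF bump_in_Xc S]])
    then show ?thesis using False by simp
  qed
  moreover have "a_form M bump bump = (\<Sum>S\<in>subdomains M. \<Sum>T\<in>fine_mesh M S.
      measure lebesgue T * (slope (bump S) T \<bullet> slope (bump S) T))"
    by (intro a_form_eq_sum Xc_P1[OF bump_in_Xc])
  ultimately have "a_form M bump bump \<le> (\<Sum>S\<in>subdomains M. \<Sum>T\<in>fine_mesh M S.
      (if \<exists>q. q extreme_point_of T \<and> q \<in> frontier \<Omega> then 1 / \<rho>\<^sup>2 * measure lebesgue T else 0))"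
    by (simp only:) (intro sum_mono)
  also have "\<dots> = (\<Sum>S\<in>subdomains M. 1 / \<rho>\<^sup>2 *
      (\<Sum>T\<in>{T\<in>fine_mesh M S. \<exists>q. q extreme_point_of T \<and> q \<in> frontier \<Omega>}. measure lebesgue T))"
    by (intro sum.cong refl) (auto simp: sum.inter_filter[OF finite_fine_mesh] sum_distrib_left intro!: sum.cong)
  finally show ?thesis by (simp add: sum_distrib_left)
qed

text \<open>In each subdomain with an inner corner, some element at this corner sees \<open>corner_bump\<close> drop from \<open>1\<close> to \<open>0\<close> over a
  distance of at most \<open>d\<close>.\<close>

lemma corner_bump_energy_ge:
  assumes "0 < d" "0 \<le> \<mu>" and diam: "\<And>S T. S \<in> subdomains M \<Longrightarrow> T \<in> fine_mesh M S \<Longrightarrow> diameter T \<le> d"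
    and vol: "\<And>S T. S \<in> subdomains M \<Longrightarrow> T \<in> fine_mesh M S \<Longrightarrow> \<mu> \<le> measure lebesgue T"
    and \<S>: "\<S> \<subseteq> subdomains M" "\<And>S. S \<in> \<S> \<Longrightarrow> corners M \<inter> closure S \<inter> \<Omega> \<noteq> {}"
  shows "real (card \<S>) * (\<mu> / d\<^sup>2) \<le> a_form M corner_bump corner_bump"
proof -
  let ?e = "\<lambda>S T. measure lebesgue T * (slope (corner_bump S) T \<bullet> slope (corner_bump S) T)"
  have "\<mu> / d\<^sup>2 \<le> (\<Sum>T\<in>fine_mesh M S. ?e S T)" if "S \<in> \<S>" for S
  proof -
    have S: "S \<in> subdomains M" using \<S>(1) that by blast
    obtain p where p: "p \<in> corners M" "p \<in> closure S" "p \<in> \<Omega>" using \<S>(2)[OF \<open>S \<in> \<S>\<close>] by blast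
    have "p \<in> nodes S" using corner_is_node[OF S] p by blast
    then obtain T where T: "T \<in> fine_mesh M S" and pT: "p extreme_point_of T"
      by (auto simp: mesh_nodes_def)
    obtain q where q: "q extreme_point_of T" "q \<noteq> p" using noncorner_vertex[OF S T] by blast
    have "q \<notin> corners M" using only_corner[OF S T pT q(1)] p q(2) by blast
    let ?a = "slope (corner_bump S) T"
    have "p \<in> T" "q \<in> T" using pT q by (auto simp: extreme_point_of_def)
    obtain b where b: "\<And>x. x \<in> T \<Longrightarrow> corner_bump S x = ?a \<bullet> x + b"
      using P1_slope[OF S Xc_P1[OF corner_bump_in_Xc S] T] by blast
    have "corner_bump S p = 1" "corner_bump S q = 0"
      using corner_bump_at[OF S fine_mesh_node[OF T]] pT q \<open>q \<notin> corners M\<close> p by auto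
    then have "1 = ?a \<bullet> (p - q)" using b[OF \<open>p \<in> T\<close>] b[OF \<open>q \<in> T\<close>] by (simp add: inner_diff_right)
    also have "\<dots> \<le> norm ?a * norm (p - q)" by (rule norm_cauchy_schwarz)
    also have "\<dots> \<le> norm ?a * d"
    proof (rule mult_left_mono)
      have "bounded T" using compact_simplex[OF fine_mesh_simplex[OF S T]] compact_imp_bounded by blast
      then have "dist p q \<le> diameter T" using \<open>p \<in> T\<close> \<open>q \<in> T\<close> diameter_bounded_bound by blast
      then show "norm (p - q) \<le> d" using diam[OF S T] by (simp add: dist_norm)
    qed simp
    finally have "1 / d \<le> norm ?a" using \<open>0 < d\<close> by (simp add: divide_le_eq)
    then have "(1 / d)\<^sup>2 \<le> (norm ?a)\<^sup>2" using \<open>0 < d\<close> by (intro power_mono) auto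
    then have "1 / d\<^sup>2 \<le> ?a \<bullet> ?a" by (simp add: power2_norm_eq_inner power_divide)
    then have "\<mu> * (1 / d\<^sup>2) \<le> ?e S T" using vol[OF S T] \<open>0 \<le> \<mu>\<close> by (intro mult_mono) auto
    also have "\<dots> \<le> (\<Sum>T\<in>fine_mesh M S. ?e S T)"
      using finite_fine_mesh[OF S] T by (intro member_le_sum) auto
    finally show ?thesis by simp
  qed
  then have "(\<Sum>S\<in>\<S>. \<mu> / d\<^sup>2) \<le> (\<Sum>S\<in>\<S>. \<Sum>T\<in>fine_mesh M S. ?e S T)" by (rule sum_mono)
  also have "\<dots> \<le> (\<Sum>S\<in>subdomains M. \<Sum>T\<in>fine_mesh M S. ?e S T)"
    using finite_subdomains \<S>(1) by (intro sum_mono2) (auto intro: sum_nonneg)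
  also have "\<dots> = a_form M corner_bump corner_bump"
    by (intro a_form_eq_sum[symmetric] Xc_P1[OF corner_bump_in_Xc])
  finally show ?thesis by simp
qed

end

section \<open>The cells of the Kuhn arrangement\<close>

text \<open>The coordinate functionals, with an additional zero functional \<open>None\<close>. It lets the
  functionals \<open>x\<^sub>i\<close> and \<open>x\<^sub>i - x\<^sub>j\<close> that define the arrangement be treated alike, as the differences \<open>dir i j\<close>.\<close>

definition coord :: "'n::finite option \<Rightarrow> real^'n" where
  "coord i = (case i of None \<Rightarrow> 0 | Some k \<Rightarrow> axis k 1)"

definition dir :: "'n::finite option \<Rightarrow> 'n option \<Rightarrow> real^'n" where
  "dir i j = coord i - coord j"

text \<open>The intersection of all closed halfspaces of the arrangement (\<open>dir i j\<close>-coordinate at least \<open>k/N\<close>) that contain \<open>g\<close>.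
  Because \<open>dir j i = - dir i j\<close>, this covers the opposite halfspaces as well. For generic \<open>g\<close> it
  is the Kuhn simplex around \<open>g\<close>, for other points a face of such a simplex.\<close>

definition cell :: "nat \<Rightarrow> real^'n::finite \<Rightarrow> (real^'n) set" where
  "cell N g = {x. \<forall>i j. \<forall>k::int. k \<le> N * (g \<bullet> dir i j) \<longrightarrow> k \<le> N * (x \<bullet> dir i j)}"

definition generic :: "nat \<Rightarrow> real^'n::finite \<Rightarrow> bool" where
  "generic N g \<longleftrightarrow> (\<forall>i j. i \<noteq> j \<longrightarrow> N * (g \<bullet> dir i j) \<notin> \<int>)"

definition lattice :: "nat \<Rightarrow> (real^'n::finite) set" where
  "lattice N = {p. \<forall>k. N * p $ k \<in> \<int>}"

lemma inner_coord [simp]: "x \<bullet> coord None = 0" "x \<bullet> coord (Some k) = x $ k"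
  by (simp_all add: coord_def inner_axis)

lemma inner_dir: "x \<bullet> dir i j = x \<bullet> coord i - x \<bullet> coord j"
  by (simp add: dir_def inner_diff_right)

lemma norm_dir_le: "norm (dir i j) \<le> 2"
proof -
  have "norm (coord i) \<le> 1" for i :: "'a option"
    by (cases i) (simp_all add: coord_def norm_axis_1)
  then show ?thesis unfolding dir_def using norm_triangle_ineq4[of "coord i" "coord j"] by (smt (verit))
qed

lemma lattice_inner_coord: "p \<in> lattice N \<Longrightarrow> N * (p \<bullet> coord i) \<in> \<int>"
  by (cases i) (simp_all add: lattice_def)

lemma lattice_inner_dir: "p \<in> lattice N \<Longrightarrow> N * (p \<bullet> dir i j) \<in> \<int>"
  by (simp add: inner_dir right_diff_distrib lattice_inner_coord)

subsection \<open>Elementary properties of the cells\<close>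

lemma cell_lower: "x \<in> cell N g \<Longrightarrow> of_int k \<le> N * (g \<bullet> dir i j) \<Longrightarrow> of_int k \<le> N * (x \<bullet> dir i j)"
  by (simp add: cell_def)

lemma cell_upper:
  assumes "x \<in> cell N g" "N * (g \<bullet> dir i j) \<le> of_int k"
  shows "N * (x \<bullet> dir i j) \<le> of_int k"
proof -
  have "of_int (- k) \<le> N * (g \<bullet> dir j i)" using assms(2) by (simp add: inner_dir algebra_simps)
  from cell_lower[OF assms(1) this] show ?thesis by (simp add: inner_dir algebra_simps)
qed

lemma generator_in_cell: "g \<in> cell N g"
  by (simp add: cell_def)

lemma cell_eq_floor: "cell N g = {x. \<forall>i j. of_int \<lfloor>N * (g \<bullet> dir i j)\<rfloor> \<le> N * (x \<bullet> dir i j)}"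
  unfolding cell_def
proof (intro Collect_cong all_cong1 iffI allI impI)
  fix x i j and k :: int
  assume "of_int \<lfloor>N * (g \<bullet> dir i j)\<rfloor> \<le> N * (x \<bullet> dir i j)" "of_int k \<le> N * (g \<bullet> dir i j)"
  then show "of_int k \<le> N * (x \<bullet> dir i j)" by (meson le_floor_iff of_int_le_iff order_trans)
qed auto

lemma cell_eq_Inter: "cell N g = (\<Inter>(i, j)\<in>UNIV. {x. (real N *\<^sub>R dir i j) \<bullet> x \<ge> of_int \<lfloor>N * (g \<bullet> dir i j)\<rfloor>})"
  unfolding cell_eq_floor by (auto simp: inner_commute)

lemma closed_cell: "closed (cell N g)"
  unfolding cell_eq_Inter by (auto simp del: inner_scaleR_left intro!: closed_INT closed_halfspace_ge)

lemma convex_cell: "convex (cell N g)"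
  unfolding cell_eq_Inter by (auto simp del: inner_scaleR_left intro!: convex_INT convex_halfspace_ge)

lemma cell_width:
  assumes "x \<in> cell N g" "y \<in> cell N g"
  shows "\<bar>N * ((x - y) \<bullet> dir i j)\<bar> \<le> 1"
proof -
  let ?y = "N * (g \<bullet> dir i j)"
  have "of_int \<lfloor>?y\<rfloor> \<le> N * (z \<bullet> dir i j) \<and> N * (z \<bullet> dir i j) \<le> of_int \<lceil>?y\<rceil>" if "z \<in> cell N g" for z
    using cell_lower[OF that, of "\<lfloor>?y\<rfloor>"] cell_upper[OF that, of _ _ "\<lceil>?y\<rceil>"] by auto
  then have "of_int \<lfloor>?y\<rfloor> \<le> N * (x \<bullet> dir i j)" "N * (x \<bullet> dir i j) \<le> of_int \<lceil>?y\<rceil>"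
    "of_int \<lfloor>?y\<rfloor> \<le> N * (y \<bullet> dir i j)" "N * (y \<bullet> dir i j) \<le> of_int \<lceil>?y\<rceil>"
    using assms by auto
  moreover have "real_of_int \<lceil>?y\<rceil> \<le> of_int \<lfloor>?y\<rfloor> + 1"
    using ceiling_diff_floor_le_1[of ?y] by linarith
  ultimately show ?thesis by (simp add: inner_diff_left right_diff_distrib abs_le_iff)
qed

lemma cell_component_dist:
  assumes "x \<in> cell N g" "y \<in> cell N g" "0 < N"
  shows "\<bar>x $ k - y $ k\<bar> \<le> 1 / N"
proof -
  have "\<bar>N * (x $ k - y $ k)\<bar> \<le> 1"
    using cell_width[OF assms(1,2), of "Some k" None] by (simp add: inner_dir)
  then have "N * \<bar>x $ k - y $ k\<bar> \<le> 1" by (simp add: abs_mult)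
  then show ?thesis using \<open>0 < N\<close> by (simp add: field_simps)
qed

lemma cell_dist:
  assumes "x \<in> cell N g" "y \<in> cell N g" "0 < N"
  shows "norm (x - y :: real^'n::finite) \<le> CARD('n) / N"
proof -
  have "norm (x - y) \<le> (\<Sum>k\<in>UNIV. \<bar>(x - y) $ k\<bar>)" by (rule norm_le_l1_cart)
  also have "\<dots> \<le> (\<Sum>k\<in>(UNIV::'n set). 1 / N)"
    using cell_component_dist[OF assms] by (intro sum_mono) simp
  finally show ?thesis by simp
qed

lemma bounded_cell: "0 < N \<Longrightarrow> bounded (cell N g)"
  using cell_dist[OF generator_in_cell] by (metis bounded_iff bounded_any_center dist_norm)

lemma cell_refine: "cell (2 * N) g \<subseteq> cell N g"
proof
  fix x assume x: "x \<in> cell (2 * N) g"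
  show "x \<in> cell N g"
    unfolding cell_def
  proof (intro CollectI allI impI)
    fix i j and k :: int
    assume "of_int k \<le> N * (g \<bullet> dir i j)"
    then have "of_int (2 * k) \<le> real (2 * N) * (g \<bullet> dir i j)" by simp
    from cell_lower[OF x this] show "of_int k \<le> N * (x \<bullet> dir i j)" by simp
  qed
qed

text \<open>In a cell of a generic point, integer parts can change only on the hyperplanes of the arrangement.\<close>

lemma cell_eqI:
  assumes g: "generic N g" and g': "generic N g'" "g' \<in> cell N g"
  shows "cell N g' = cell N g"
proof -
  have "\<lfloor>N * (g' \<bullet> dir i j)\<rfloor> = \<lfloor>N * (g \<bullet> dir i j)\<rfloor>" for i j
  proof (cases "i = j")
    case False
    let ?y = "N * (g \<bullet> dir i j)" and ?y' = "N * (g' \<bullet> dir i j)"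
    have "of_int \<lfloor>?y\<rfloor> \<le> ?y'" using g'(2) by (simp add: cell_eq_floor)
    moreover have "?y' \<le> of_int (\<lfloor>?y\<rfloor> + 1)" by (rule cell_upper[OF g'(2)]) linarith
    moreover have "?y' \<noteq> of_int (\<lfloor>?y\<rfloor> + 1)"
      using g'(1) False unfolding generic_def by (metis Ints_of_int)
    ultimately show ?thesis by (intro floor_unique) auto
  qed (simp add: dir_def)
  then show ?thesis by (simp add: cell_eq_floor)
qed

text \<open>A hyperplane of the arrangement that bounds the second cell either has the first cell on its good side, or the first cell
  lies on its bad side and the intersection is cut out by a supporting hyperplane.\<close>

lemma cell_Int_face: "(cell N g \<inter> cell N g') face_of cell N g"
proof -
  define F where "F = (\<lambda>(i, j). cell N g \<inter> {x. of_int \<lfloor>N * (g' \<bullet> dir i j)\<rfloor> \<le> N * (x \<bullet> dir i j)})"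
  have "F (i, j) face_of cell N g" for i j
  proof (cases "of_int \<lfloor>N * (g' \<bullet> dir i j)\<rfloor> \<le> N * (g \<bullet> dir i j)")
    case True
    then have "F (i, j) = cell N g" using cell_lower by (auto simp: F_def)
    then show ?thesis by (simp add: face_of_refl convex_cell)
  next
    case False
    have le: "(N *\<^sub>R dir i j) \<bullet> x \<le> of_int \<lfloor>N * (g' \<bullet> dir i j)\<rfloor>" if "x \<in> cell N g" for x
      using cell_upper[OF that, of i j "\<lfloor>N * (g' \<bullet> dir i j)\<rfloor>"] False by (simp add: inner_commute)
    then have "F (i, j) = cell N g \<inter> {x. (N *\<^sub>R dir i j) \<bullet> x = of_int \<lfloor>N * (g' \<bullet> dir i j)\<rfloor>}"
      unfolding F_def by (force simp: inner_commute)
    then show ?thesis using face_of_Int_supporting_hyperplane_le[OF convex_cell le] by simp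
  qed
  then have "(\<Inter>(range F)) face_of cell N g" by (intro face_of_Inter) auto
  moreover have "\<Inter>(range F) = cell N g \<inter> cell N g'"
    by (auto simp: F_def cell_eq_floor[of N g'])
  ultimately show ?thesis by simp
qed

text \<open>A cell is determined by the integer parts of the functionals at \<open>g\<close>.\<close>

lemma finite_cells: "finite {cell N g |g. g \<in> box 0 1}"
proof -
  define C where "C \<phi> = {x. \<forall>i j. of_int (\<phi> (i, j)) \<le> N * (x \<bullet> dir i j)}" for \<phi> :: "'a option \<times> 'a option \<Rightarrow> int"
  have "\<exists>\<phi> \<in> PiE UNIV (\<lambda>_. {- int N - 1..int N}). cell N g = C \<phi>" if g: "g \<in> box 0 1" for g :: "real^'a"
  proof
    show "cell N g = C (\<lambda>(i, j). \<lfloor>N * (g \<bullet> dir i j)\<rfloor>)" by (simp add: cell_eq_floor C_def)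
    have "\<lfloor>N * (g \<bullet> dir i j)\<rfloor> \<in> {- int N - 1..int N}" for i j
    proof -
      have "0 \<le> g \<bullet> coord i \<and> g \<bullet> coord i \<le> 1" for i
        using g by (cases i) (auto simp: mem_box_cart less_imp_le)
      then have "\<bar>g \<bullet> dir i j\<bar> \<le> 1" unfolding inner_dir by (smt (verit))
      then have "\<bar>N * (g \<bullet> dir i j)\<bar> \<le> N" by (simp add: abs_mult mult_left_le)
      then have "- real N \<le> N * (g \<bullet> dir i j)" "N * (g \<bullet> dir i j) \<le> real N" by linarith+
      then show ?thesis by (simp add: le_floor_iff floor_le_iff)
    qed
    then show "(\<lambda>(i, j). \<lfloor>N * (g \<bullet> dir i j)\<rfloor>) \<in> PiE UNIV (\<lambda>_. {- int N - 1..int N})" by auto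
  qed
  then have "{cell N g |g. g \<in> box 0 1} \<subseteq> C ` PiE UNIV (\<lambda>_. {- int N - 1..int N})" by blast
  then show ?thesis by (rule finite_subset) (intro finite_imageI finite_PiE; simp)
qed

subsection \<open>Generic points\<close>

lemma generic_coarse: "generic (2 * N) g \<Longrightarrow> generic N g"
  unfolding generic_def by (metis Ints_mult Ints_numeral mult.assoc of_nat_mult of_nat_numeral)

text \<open>The coordinates are distinct positive multiples of \<open>1/(N (n + 1))\<close> with numerators up to \<open>n\<close>,
  so neither they nor their differences are multiples of \<open>1/N\<close>.\<close>

lemma generic_exists:
  assumes "0 < N"
  shows "\<exists>g. generic N g \<and> g \<in> box (0::real^'n::finite) 1"
proof -
  obtain r :: "'n \<Rightarrow> nat" where r: "bij_betw r UNIV {..<CARD('n)}"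
    using ex_bij_betw_finite_nat[of "UNIV :: 'n set"] by (auto simp: atLeast0LessThan)
  define m where "m = CARD('n) + 1"
  define g :: "real^'n" where "g = (\<chi> k. real (r k + 1) / (N * m))"
  define h where "h i = (case i of None \<Rightarrow> 0 | Some k \<Rightarrow> r k + 1)" for i
  have rk: "r k + 1 < m" for k using bij_betwE[OF r] by (auto simp: m_def)
  have h: "N * (g \<bullet> coord i) = real (h i) / m" for i
    using assms by (cases i) (auto simp: g_def h_def)
  have "inj h" using bij_betw_imp_inj_on[OF r] by (auto simp: inj_def h_def split: option.splits)
  have hm: "h i < m" for i using rk by (cases i) (auto simp: h_def m_def)
  have "N * (g \<bullet> dir i j) \<notin> \<int>" if "i \<noteq> j" for i j
  proof
    assume "N * (g \<bullet> dir i j) \<in> \<int>"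
    then obtain k :: int where "N * (g \<bullet> dir i j) = of_int k" by (auto elim: Ints_cases)
    moreover have "N * (g \<bullet> dir i j) = (real (h i) - real (h j)) / m"
      unfolding inner_dir right_diff_distrib h by (simp add: diff_divide_distrib)
    moreover have "real m \<noteq> 0" by (simp add: m_def)
    ultimately have "real (h i) - real (h j) = real_of_int k * real m" by (metis nonzero_divide_eq_eq)
    then have "real_of_int (int (h i) - int (h j)) = real_of_int (k * int m)" by simp
    then have k: "int (h i) - int (h j) = k * int m" by (simp only: of_int_eq_iff)
    have "\<bar>int (h i) - int (h j)\<bar> < int m" using hm[of i] hm[of j] by linarith
    then have "\<bar>k\<bar> * int m < 1 * int m" unfolding k by (simp add: abs_mult)
    then have "\<not> 1 \<le> \<bar>k\<bar>" using mult_right_mono[of 1 "\<bar>k\<bar>" "int m"] by linarith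
    then have "k = 0" by linarith
    then have "h i = h j" using k by simp
    then show False using \<open>inj h\<close> that by (auto dest: injD)
  qed
  moreover have "g \<in> box 0 1"
  proof -
    have "real (r k + 1) < real (N * m)" for k
      using rk[of k] assms by (metis mult.left_neutral mult_le_mono1 of_nat_less_iff order_less_le_trans One_nat_def Suc_leI)
    then have "real (r k + 1) / (N * m) < 1" for k by (simp add: divide_less_eq)
    moreover have "0 < real (r k + 1) / (N * m)" for k
      by (intro divide_pos_pos) (use assms in \<open>simp_all add: m_def add_pos_nonneg\<close>)
    ultimately show ?thesis by (auto simp: mem_box_cart g_def)
  qed
  ultimately show ?thesis unfolding generic_def by blast
qed

text \<open>A point that starts at \<open>a\<close> and moves towards a noninteger \<open>b\<close> first avoids the integers and does not
  cross any integer upwards beyond \<open>a\<close>.\<close>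

lemma segment_avoids_integers:
  fixes a b :: real
  assumes "b \<notin> \<int>"
  shows "\<forall>\<^sub>F t in at_right 0. a + t * (b - a) \<notin> \<int> \<and> (\<forall>k::int. k \<le> a + t * (b - a) \<longrightarrow> k \<le> a)"
proof -
  have lim: "((\<lambda>t. a + t * (b - a)) \<longlongrightarrow> a) (at_right 0)"
    by (auto intro!: tendsto_eq_intros)
  show ?thesis
  proof (cases "a \<in> \<int>")
    case True
    then obtain m where m: "a = of_int m" by (auto elim: Ints_cases)
    have "\<forall>\<^sub>F t in at_right 0. a + t * (b - a) < a + 1" "\<forall>\<^sub>F t in at_right 0. a - 1 < a + t * (b - a)"
      by (rule order_tendstoD[OF lim]; simp)+
    moreover have "\<forall>\<^sub>F t::real in at_right 0. 0 < t" by (simp add: eventually_at_right_less)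
    ultimately show ?thesis
    proof eventually_elim
      case (elim t)
      let ?y = "a + t * (b - a)"
      have "?y \<noteq> a" using elim(3) assms True by auto
      have "k \<le> m" if "of_int k \<le> ?y" for k :: int
        using that elim(1) unfolding m by linarith
      moreover have "m \<le> k" if "of_int k = ?y" for k :: int
        using that elim(2) unfolding m by linarith
      ultimately show ?case using \<open>?y \<noteq> a\<close> m
        by (metis Ints_cases of_int_le_iff order_antisym order_refl)
    qed
  next
    case False
    have fl: "of_int \<lfloor>a\<rfloor> < a"
      using False by (metis Ints_of_int floor_less_iff of_int_floor_le order_less_le)
    have "\<forall>\<^sub>F t in at_right 0. a + t * (b - a) < of_int (\<lfloor>a\<rfloor> + 1)"
      by (rule order_tendstoD[OF lim]) linarith
    moreover have "\<forall>\<^sub>F t in at_right 0. of_int \<lfloor>a\<rfloor> < a + t * (b - a)"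
      by (rule order_tendstoD[OF lim]) (rule fl)
    ultimately show ?thesis
    proof eventually_elim
      case (elim t)
      let ?y = "a + t * (b - a)"
      have "k \<le> \<lfloor>a\<rfloor>" if "of_int k \<le> ?y" for k :: int
        using that elim(1) by linarith
      moreover have "\<lfloor>a\<rfloor> < k" if "of_int k = ?y" for k :: int
        using that elim(2) by linarith
      ultimately show ?case
        by (metis Ints_cases le_floor_iff linorder_not_less order_refl)
    qed
  qed
qed

text \<open>A point \<open>x\<close> on some hyperplanes of the arrangement belongs to several cells. Moving it slightly towards a generic point
  selects one of them, without crossing a hyperplane that does not contain \<open>x\<close>.\<close>

lemma generic_point_near:
  assumes g: "generic N g"
  obtains t where "0 < t" "t \<le> 1" "generic N (x + t *\<^sub>R (g - x))" "x \<in> cell N (x + t *\<^sub>R (g - x))"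
proof -
  let ?y = "\<lambda>t i j. N * (x \<bullet> dir i j) + t * (N * (g \<bullet> dir i j) - N * (x \<bullet> dir i j))"
  have y: "N * ((x + t *\<^sub>R (g - x)) \<bullet> dir i j) = ?y t i j" for t i j
    by (simp add: inner_add_left inner_diff_left algebra_simps)
  have "\<forall>\<^sub>F t in at_right 0. i \<noteq> j \<longrightarrow> ?y t i j \<notin> \<int> \<and>
      (\<forall>k::int. k \<le> ?y t i j \<longrightarrow> k \<le> N * (x \<bullet> dir i j))" for i j
    using g segment_avoids_integers by (cases "i = j") (auto simp: generic_def)
  then have "\<forall>\<^sub>F t in at_right 0. \<forall>i j. i \<noteq> j \<longrightarrow> ?y t i j \<notin> \<int> \<and>
      (\<forall>k::int. k \<le> ?y t i j \<longrightarrow> k \<le> N * (x \<bullet> dir i j))"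
    by (intro eventually_all_finite)
  moreover have "\<forall>\<^sub>F t::real in at_right 0. 0 < t \<and> t \<le> 1"
    unfolding eventually_at_right_field by (rule exI[of _ 1]) auto
  ultimately have "\<forall>\<^sub>F t in at_right 0. (\<forall>i j. i \<noteq> j \<longrightarrow> ?y t i j \<notin> \<int> \<and>
      (\<forall>k::int. k \<le> ?y t i j \<longrightarrow> k \<le> N * (x \<bullet> dir i j))) \<and> 0 < t \<and> t \<le> 1"
    by (rule eventually_conj)
  then obtain t where t: "0 < t" "t \<le> 1"
    and yt: "\<And>i j. i \<noteq> j \<Longrightarrow> ?y t i j \<notin> \<int> \<and> (\<forall>k::int. k \<le> ?y t i j \<longrightarrow> k \<le> N * (x \<bullet> dir i j))"
    using eventually_happens'[OF trivial_limit_at_right_real] by blast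
  have "generic N (x + t *\<^sub>R (g - x))" unfolding generic_def y using yt by blast
  moreover have "x \<in> cell N (x + t *\<^sub>R (g - x))"
    unfolding cell_def y
  proof (intro CollectI allI impI)
    fix i j and k :: int
    assume "of_int k \<le> ?y t i j"
    then show "of_int k \<le> N * (x \<bullet> dir i j)"
      using yt[of i j] by (cases "i = j") (auto simp: dir_def)
  qed
  ultimately show ?thesis using that t by blast
qed

subsection \<open>The cells of generic points are simplices\<close>

lemma ranking_exists:
  fixes \<kappa> :: "'b::finite \<Rightarrow> real"
  assumes "inj \<kappa>"
  obtains r where "bij_betw r UNIV {..<CARD('b)}" "\<And>i j. r i < r j \<longleftrightarrow> \<kappa> i < \<kappa> j"
proof -
  define r where "r i = card {j. \<kappa> j < \<kappa> i}" for i
  have mono: "r i < r j" if "\<kappa> i < \<kappa> j" for i j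
    unfolding r_def using that by (intro psubset_card_mono) auto
  have iff: "r i < r j \<longleftrightarrow> \<kappa> i < \<kappa> j" for i j
    using mono[of i j] mono[of j i] assms
    by (cases "\<kappa> i" "\<kappa> j" rule: linorder_cases) (auto dest: injD)
  have "inj r"
    using iff assms by (metis injD injI linorder_less_linear less_irrefl)
  moreover have "r i < CARD('b)" for i
    unfolding r_def by (rule psubset_card_mono) auto
  then have "range r \<subseteq> {..<CARD('b)}" by auto
  ultimately have "bij_betw r UNIV {..<CARD('b)}"
    by (metis bij_betw_def card_image card_lessThan card_subset_eq finite_lessThan)
  then show ?thesis using that iff by blast
qed

text \<open>Around a generic point \<open>g\<close>, let \<open>shift\<close> be the integer parts of the coordinates of \<open>N g\<close>, and let \<open>place\<close> sort the
  fractional parts, the zero functional having the least place \<open>0\<close>. The cell is then the set of all \<open>x\<close> for which the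
  numbers \<open>N x\<^sub>i - shift i\<close> lie in the unit interval and are ordered in the same way (\<open>mem_cell_iff\<close>). The vertex number \<open>a\<close> arises by
  rounding the coordinates with places up to \<open>a\<close> down and the others up.\<close>

locale generic_cell =
  fixes N :: nat and g :: "real^'n::finite"
  assumes N_pos: "0 < N" and generic: "generic N g"
begin

definition shift :: "'n option \<Rightarrow> int" where
  "shift i = \<lfloor>N * (g \<bullet> coord i)\<rfloor>"

definition place :: "'n option \<Rightarrow> nat" where
  "place = (SOME r. bij_betw r UNIV {..CARD('n)} \<and> (\<forall>i j. r i < r j \<longleftrightarrow> frac (N * (g \<bullet> coord i)) < frac (N * (g \<bullet> coord j))))"

lemma place: "bij_betw place UNIV {..CARD('n)}"
    "place i < place j \<longleftrightarrow> frac (N * (g \<bullet> coord i)) < frac (N * (g \<bullet> coord j))"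
proof -
  have "inj (\<lambda>i. frac (N * (g \<bullet> coord i)))"
  proof (rule injI, rule ccontr)
    fix i j assume "frac (N * (g \<bullet> coord i)) = frac (N * (g \<bullet> coord j))" "i \<noteq> j"
    then have "N * (g \<bullet> dir i j) = of_int (shift i - shift j)"
      by (simp add: inner_dir right_diff_distrib frac_def shift_def)
    then show False using generic \<open>i \<noteq> j\<close> unfolding generic_def by (metis Ints_of_int)
  qed
  then obtain r :: "'n option \<Rightarrow> nat" where "bij_betw r UNIV {..<CARD('n option)}"
    "\<And>i j. r i < r j \<longleftrightarrow> frac (N * (g \<bullet> coord i)) < frac (N * (g \<bullet> coord j))"
    by (rule ranking_exists) (rule that)
  moreover have "{..<CARD('n option)} = {..CARD('n)}" by (auto simp: card_UNIV_option)
  ultimately have "\<exists>r. bij_betw r UNIV {..CARD('n)} \<and>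
     (\<forall>i j. r i < r j \<longleftrightarrow> frac (N * (g \<bullet> coord i)) < frac (N * (g \<bullet> coord j)))" by auto
  from someI_ex[OF this] show "bij_betw place UNIV {..CARD('n)}"
    "place i < place j \<longleftrightarrow> frac (N * (g \<bullet> coord i)) < frac (N * (g \<bullet> coord j))"
    unfolding place_def[symmetric] by auto
qed

lemma place_None: "place None = 0"
proof -
  obtain i where i: "place i = 0" using place(1) by (metis atMost_iff bij_betw_iff_bijections zero_le)
  have "\<not> place i < place None" using place(2)[of i None] by (simp add: frac_ge_0 not_less)
  then show ?thesis using i by simp
qed

lemma place_le: "place i \<le> CARD('n)"
  using place(1) by (auto simp: bij_betw_def)

lemma place_eq_iff: "place i = place j \<longleftrightarrow> i = j"
  using place(1) by (auto simp: bij_betw_def dest: injD)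

lemma mem_cell_iff:
  "x \<in> cell N g \<longleftrightarrow> (\<forall>i j. place j < place i \<longrightarrow>
      shift i - shift j \<le> N * (x \<bullet> dir i j) \<and> N * (x \<bullet> dir i j) \<le> shift i - shift j + 1)"
proof -
  have fl: "\<lfloor>N * (g \<bullet> dir i j)\<rfloor> = shift i - shift j" "\<lfloor>N * (g \<bullet> dir j i)\<rfloor> = shift j - shift i - 1"
    if "place j < place i" for i j
  proof -
    let ?y = "\<lambda>i. N * (g \<bullet> coord i)"
    have "frac (?y j) < frac (?y i)" "0 \<le> frac (?y j)" "frac (?y i) < 1"
      using that place(2) frac_ge_0 frac_lt_1 by auto
    then have "of_int \<lfloor>?y i\<rfloor> - of_int \<lfloor>?y j\<rfloor> < ?y i - ?y j"
      "?y i - ?y j < of_int \<lfloor>?y i\<rfloor> - of_int \<lfloor>?y j\<rfloor> + 1" unfolding frac_def by linarith+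
    then show "\<lfloor>N * (g \<bullet> dir i j)\<rfloor> = shift i - shift j" "\<lfloor>N * (g \<bullet> dir j i)\<rfloor> = shift j - shift i - 1"
      unfolding shift_def inner_dir right_diff_distrib
      by (intro floor_unique; simp)+
  qed
  have swap: "N * (x \<bullet> dir j i) = - (N * (x \<bullet> dir i j))" for i j
    by (simp add: inner_dir algebra_simps)
  show ?thesis
  proof
    assume x: "x \<in> cell N g"
    show "\<forall>i j. place j < place i \<longrightarrow> shift i - shift j \<le> N * (x \<bullet> dir i j) \<and> N * (x \<bullet> dir i j) \<le> shift i - shift j + 1"
    proof (intro allI impI)
      fix i j assume r: "place j < place i"
      have "of_int \<lfloor>N * (g \<bullet> dir i j)\<rfloor> \<le> N * (x \<bullet> dir i j)" "of_int \<lfloor>N * (g \<bullet> dir j i)\<rfloor> \<le> N * (x \<bullet> dir j i)"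
        using x by (simp_all add: cell_eq_floor)
      then show "shift i - shift j \<le> N * (x \<bullet> dir i j) \<and> N * (x \<bullet> dir i j) \<le> shift i - shift j + 1"
        unfolding fl[OF r] swap[of j i] by simp
    qed
  next
    assume R: "\<forall>i j. place j < place i \<longrightarrow> shift i - shift j \<le> N * (x \<bullet> dir i j) \<and> N * (x \<bullet> dir i j) \<le> shift i - shift j + 1"
    have "of_int \<lfloor>N * (g \<bullet> dir i j)\<rfloor> \<le> N * (x \<bullet> dir i j)" for i j
    proof -
      consider "place j < place i" | "place i < place j" | "i = j"
        using place_eq_iff linorder_less_linear by blast
      then show ?thesis
      proof cases
        case 1
        then show ?thesis using R fl(1)[OF 1] by simp
      next
        case 2
        have "N * (x \<bullet> dir j i) \<le> shift j - shift i + 1" using R 2 by blast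
        then show ?thesis unfolding fl(2)[OF 2] swap[of j i] by simp
      qed (simp add: dir_def)
    qed
    then show "x \<in> cell N g" by (simp add: cell_eq_floor)
  qed
qed

definition vertex :: "nat \<Rightarrow> real^'n" where
  "vertex a = (\<chi> k. (shift (Some k) + (if a < place (Some k) then 1 else 0)) / N)"

lemma shift_None: "shift None = 0"
  by (simp add: shift_def)

lemma vertex_coord: "N * (vertex a \<bullet> coord i) = shift i + (if a < place i then 1 else 0)"
  using N_pos by (cases i) (simp_all add: vertex_def shift_None place_None)

lemma vertex_lattice: "vertex a \<in> lattice N"
  using N_pos by (auto simp: lattice_def vertex_def)

lemma vertex_in_cell: "vertex a \<in> cell N g"
  unfolding mem_cell_iff by (auto simp: inner_dir right_diff_distrib vertex_coord)

text \<open>Let \<open>0 = Y\<^sub>0 \<le> \<dots> \<le> Y\<^sub>n\<close> be the sorted numbers \<open>N x\<^sub>i - shift i\<close> and let \<open>Y\<close> continue with the value \<open>1\<close>. The increments of \<open>Y\<close> are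
  the barycentric coordinates of \<open>x\<close>: the sum of those before the place of \<open>i\<close> telescopes to the \<open>i\<close>-th number.\<close>

lemma cell_eq_hull: "cell N g = convex hull (vertex ` {..CARD('n)})"
proof
  show "convex hull (vertex ` {..CARD('n)}) \<subseteq> cell N g"
    using vertex_in_cell by (intro hull_minimal convex_cell) auto
  show "cell N g \<subseteq> convex hull (vertex ` {..CARD('n)})"
  proof
    fix x assume x: "x \<in> cell N g"
    define y where "y i = N * (x \<bullet> coord i) - shift i" for i
    have y: "0 \<le> y i - y j \<and> y i - y j \<le> 1" if "place j < place i" for i j
    proof -
      have "shift i - shift j \<le> N * (x \<bullet> dir i j) \<and> N * (x \<bullet> dir i j) \<le> shift i - shift j + 1"
        using x that unfolding mem_cell_iff by blast
      then show ?thesis by (simp add: y_def inner_dir right_diff_distrib)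
    qed
    have y0: "y None = 0" by (simp add: y_def shift_None)
    define e where "e = inv_into UNIV place"
    have re: "place (e a) = a" if "a \<le> CARD('n)" for a
      using place(1) that unfolding e_def by (simp add: bij_betw_def f_inv_into_f)
    have er: "e (place i) = i" for i
      using place(1) unfolding e_def by (simp add: bij_betw_def inv_into_f_f)
    define Y where "Y a = (if a \<le> CARD('n) then y (e a) else 1)" for a
    have Y0: "Y 0 = 0" using er[of None] by (simp add: Y_def place_None y0)
    define w where "w a = Y (Suc a) - Y a" for a
    have "0 \<le> w a" if a: "a \<le> CARD('n)" for a
    proof (cases "a = CARD('n)")
      case True
      have "place None < place (e (CARD('n)))" by (simp add: re place_None)
      then show ?thesis using y[of None "e (CARD('n))"] y0 True by (simp add: w_def Y_def)
    next
      case False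
      then have "place (e a) < place (e (Suc a))" using a re by simp
      then show ?thesis using y False a by (simp add: w_def Y_def)
    qed
    moreover have sum1: "(\<Sum>a\<le>CARD('n). w a) = 1"
      unfolding w_def lessThan_Suc_atMost[symmetric] by (subst sum_lessThan_telescope) (simp add: Y0, simp add: Y_def)
    ultimately have "(\<Sum>a\<le>CARD('n). w a *\<^sub>R vertex a) \<in> convex hull (vertex ` {..CARD('n)})"
      by (intro convex_sum convex_convex_hull) (auto intro: hull_inc)
    moreover have "(\<Sum>a\<le>CARD('n). w a *\<^sub>R vertex a) = x"
    proof (rule vec_eq_iff[THEN iffD2], rule allI)
      fix k :: 'n
      let ?i = "Some k"
      have "(\<Sum>a\<le>CARD('n). w a *\<^sub>R vertex a) $ k = (\<Sum>a\<le>CARD('n). w a * vertex a $ k)" by simp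
      also have "\<dots> = (\<Sum>a\<le>CARD('n). (w a * shift ?i + (if a < place ?i then w a else 0)) / N)"
        by (intro sum.cong refl) (simp add: vertex_def algebra_simps)
      also have "\<dots> = ((\<Sum>a\<le>CARD('n). w a) * shift ?i + (\<Sum>a\<le>CARD('n). if a < place ?i then w a else 0)) / N"
        by (simp add: sum_divide_distrib[symmetric] sum.distrib sum_distrib_right)
      also have "(\<Sum>a\<le>CARD('n). if a < place ?i then w a else 0) = (\<Sum>a<place ?i. w a)"
        using place_le[of ?i] by (intro sum.mono_neutral_cong_right) auto
      also have "\<dots> = Y (place ?i)" unfolding w_def by (simp add: sum_lessThan_telescope Y0)
      also have "\<dots> = y ?i" by (simp add: Y_def place_le er)
      finally show "(\<Sum>a\<le>CARD('n). w a *\<^sub>R vertex a) $ k = x $ k"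
        using N_pos by (simp add: sum1 y_def)
    qed
    ultimately show "x \<in> convex hull (vertex ` {..CARD('n)})" by simp
  qed
qed

text \<open>The centre is the barycentre, where the sorted numbers are equidistant with step \<open>1/(n + 1)\<close>.\<close>

lemma cell_contains_ball: "\<exists>c. cball c (1 / (2 * real N * (real CARD('n) + 1))) \<subseteq> cell N g"
proof
  define c :: "real^'n" where "c = (\<chi> k. (shift (Some k) + place (Some k) / (real CARD('n) + 1)) / N)"
  have c: "N * (c \<bullet> coord i) = shift i + place i / (real CARD('n) + 1)" for i
    using N_pos by (cases i) (simp_all add: c_def shift_None place_None)
  show "cball c (1 / (2 * real N * (real CARD('n) + 1))) \<subseteq> cell N g"
  proof
    fix x assume "x \<in> cball c (1 / (2 * real N * (real CARD('n) + 1)))"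
    then have "norm (x - c) \<le> 1 / (2 * real N * (real CARD('n) + 1))" by (simp add: dist_norm norm_minus_commute)
    have small: "\<bar>N * ((x - c) \<bullet> dir i j)\<bar> \<le> 1 / (real CARD('n) + 1)" for i j
    proof -
      have "\<bar>(x - c) \<bullet> dir i j\<bar> \<le> norm (x - c) * norm (dir i j)" by (rule Cauchy_Schwarz_ineq2)
      also have "\<dots> \<le> 1 / (2 * real N * (real CARD('n) + 1)) * 2"
        using \<open>norm (x - c) \<le> _\<close> norm_dir_le by (intro mult_mono) auto
      finally have "N * \<bar>(x - c) \<bullet> dir i j\<bar> \<le> N * (1 / (2 * real N * (real CARD('n) + 1)) * 2)"
        by (intro mult_left_mono) auto
      also have "\<dots> = 1 / (real CARD('n) + 1)" 
      proof -
        have "N * (1 / (2 * real N * m) * 2) = 1 / m" if "m \<noteq> 0" for m :: real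
          using N_pos that by (simp add: field_simps)
        moreover have "real CARD('n) + 1 \<noteq> 0" by linarith
        ultimately show ?thesis by metis
      qed
      finally show ?thesis by (simp add: abs_mult)
    qed
    show "x \<in> cell N g"
      unfolding mem_cell_iff
    proof (intro allI impI)
      fix i j assume r: "place j < place i"
      let ?q = "(real (place i) - real (place j)) / (real CARD('n) + 1)"
      have eq: "N * (x \<bullet> dir i j) = shift i - shift j + ?q + N * ((x - c) \<bullet> dir i j)"
        using c[of i] c[of j] by (simp add: inner_dir inner_diff_left algebra_simps diff_divide_distrib)
      have "1 / (real CARD('n) + 1) \<le> ?q" using r by (intro divide_right_mono) auto
      moreover have "?q \<le> real CARD('n) / (real CARD('n) + 1)"
        using place_le[of i] by (intro divide_right_mono) auto
      moreover have "real CARD('n) / (real CARD('n) + 1) + 1 / (real CARD('n) + 1) = 1"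
        by (simp add: add_divide_distrib[symmetric])
      ultimately show "shift i - shift j \<le> N * (x \<bullet> dir i j) \<and> N * (x \<bullet> dir i j) \<le> shift i - shift j + 1"
        using small[of i j] unfolding eq abs_le_iff by linarith
    qed
  qed
qed

text \<open>The cell is the hull of at most \<open>n + 1\<close> points and has inner points, so these points are affinely independent.\<close>

lemma cell_simplex: "int CARD('n) simplex cell N g"
proof -
  let ?V = "vertex ` {..CARD('n)}"
  obtain c where "cball c (1 / (2 * real N * (real CARD('n) + 1))) \<subseteq> cell N g" using cell_contains_ball by blast
  then have "interior (cball c (1 / (2 * real N * (real CARD('n) + 1)))) \<subseteq> interior (cell N g)" by (rule interior_mono)
  then have "ball c (1 / (2 * real N * (real CARD('n) + 1))) \<subseteq> interior (cell N g)" by simp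
  moreover have "0 < 1 / (2 * real N * (real CARD('n) + 1))" using N_pos by (simp add: add_pos_pos)
  ultimately have "interior (cell N g) \<noteq> {}" by (metis centre_in_ball empty_iff subsetD)
  then have "aff_dim (cell N g) = int CARD('n)" using aff_dim_nonempty_interior by fastforce
  then have dim: "aff_dim ?V = int CARD('n)" unfolding cell_eq_hull by (simp add: aff_dim_convex_hull)
  have "card ?V \<le> CARD('n) + 1" using card_image_le[of "{..CARD('n)}" vertex] by simp
  moreover have "aff_dim ?V \<le> int (card ?V) - 1" using aff_dim_le_card[of ?V] by simp
  ultimately have card: "int (card ?V) = int CARD('n) + 1" using dim by linarith
  then have "\<not> affine_dependent ?V" using dim by (simp add: affine_independent_iff_card)
  then show ?thesis unfolding simplex_def using card cell_eq_hull by blast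
qed

lemma extreme_point_lattice: "p extreme_point_of cell N g \<Longrightarrow> p \<in> lattice N"
  unfolding cell_eq_hull using extreme_point_of_convex_hull vertex_lattice by blast

end

subsection \<open>Hat functions\<close>

text \<open>The nodal function of the lattice point \<open>p\<close> in closed form. The spread of the coordinates of
  \<open>N (x - p)\<close>, including the zero coordinate, is a polyhedral gauge whose unit ball is the union of the cells around \<open>p\<close>.\<close>

definition hat :: "nat \<Rightarrow> real^'n::finite \<Rightarrow> real^'n \<Rightarrow> real" where
  "hat N p x = max 0 (1 - (Max (range (\<lambda>i. N * ((x - p) \<bullet> coord i))) - Min (range (\<lambda>i. N * ((x - p) \<bullet> coord i)))))"

text \<open>On a cell, the indices at which the largest and the smallest coordinate are attained can be chosen independently of \<open>x\<close>, and so can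
  the branch of the outer maximum: all these comparisons are between \<open>N (x\<^sub>i - x\<^sub>j)\<close> and an integer.\<close>

lemma hat_affine_on_cell:
  assumes p: "p \<in> lattice N"
  shows "\<exists>a b. \<forall>x\<in>cell N g. hat N p x = a \<bullet> x + b"
proof -
  let ?u = "\<lambda>x i. N * ((x - p) \<bullet> coord i)"
  have u_dir: "?u x i - ?u x j = N * (x \<bullet> dir i j) - N * (p \<bullet> dir i j)" for x i j
    by (simp add: inner_dir inner_diff_left algebra_simps)
  have sign: "?u x j + of_int c \<le> ?u x i" if x: "x \<in> cell N g" and "?u g j + of_int c \<le> ?u g i" for x i j and c :: int
  proof -
    obtain k where k: "N * (p \<bullet> dir i j) = of_int k" using lattice_inner_dir[OF p] by (metis Ints_cases)
    have "of_int (c + k) \<le> N * (g \<bullet> dir i j)" using that(2) u_dir[of g i j] k by simp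
    from cell_lower[OF x this] show ?thesis using u_dir[of x i j] k by simp
  qed
  obtain i where i: "?u g i = Max (range (?u g))"
    using Max_in[of "range (?u g)"] by fastforce
  obtain j where j: "?u g j = Min (range (?u g))"
    using Min_in[of "range (?u g)"] by fastforce
  have Max: "Max (range (?u x)) = ?u x i" if "x \<in> cell N g" for x
  proof (rule Max_eqI)
    fix y assume "y \<in> range (?u x)"
    then obtain l where l: "y = ?u x l" by blast
    have "?u g l + of_int 0 \<le> ?u g i"
      using Max_ge[OF _ rangeI[of "?u g" l]] unfolding i by simp
    from sign[OF that this] show "y \<le> ?u x i" unfolding l by simp
  qed auto
  have Min: "Min (range (?u x)) = ?u x j" if "x \<in> cell N g" for x
  proof (rule Min_eqI)
    fix y assume "y \<in> range (?u x)"
    then obtain l where l: "y = ?u x l" by blast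
    have "?u g j + of_int 0 \<le> ?u g l"
      using Min_le[OF _ rangeI[of "?u g" l]] unfolding j by simp
    from sign[OF that this] show "?u x j \<le> y" unfolding l by simp
  qed auto
  have hat: "hat N p x = max 0 (1 - (?u x i - ?u x j))" if "x \<in> cell N g" for x
    unfolding hat_def Max[OF that] Min[OF that] ..
  show ?thesis
  proof (cases "?u g j + 1 \<le> ?u g i")
    case True
    then have "?u x j + 1 \<le> ?u x i" if "x \<in> cell N g" for x using sign[OF that, of j 1 i] by simp
    then have "\<forall>x\<in>cell N g. hat N p x = 0 \<bullet> x + 0" using hat by force
    then show ?thesis by blast
  next
    case False
    then have le: "?u x i - 1 \<le> ?u x j" if "x \<in> cell N g" for x using sign[OF that, of i "-1" j] by simp
    have "hat N p x = (- (real N *\<^sub>R dir i j)) \<bullet> x + (1 + N * (p \<bullet> dir i j))" if "x \<in> cell N g" for x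
      using hat[OF that] le[OF that] u_dir[of x i j] by (simp add: inner_commute)
    then show ?thesis by blast
  qed
qed

text \<open>The spread is a nonnegative integer at lattice points, and it is zero at \<open>p\<close> only.\<close>

lemma hat_lattice:
  assumes "0 < N" "p \<in> lattice N" "q \<in> lattice N"
  shows "hat N p q = (if q = p then 1 else 0)"
proof (cases "q = p")
  case False
  let ?u = "\<lambda>i. N * ((q - p) \<bullet> coord i)"
  have "(q - p) \<in> lattice N" using assms by (simp add: lattice_def right_diff_distrib)
  then have int: "?u i \<in> \<int>" for i by (rule lattice_inner_coord)
  obtain k where "?u (Some k) \<noteq> 0" using False \<open>0 < N\<close> by (auto simp: vec_eq_iff)
  then have "1 \<le> \<bar>?u (Some k)\<bar>" using int Ints_nonzero_abs_ge1 by blast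
  moreover have "\<bar>?u (Some k)\<bar> \<le> Max (range ?u) - Min (range ?u)"
  proof -
    have "?u i \<le> Max (range ?u)" "Min (range ?u) \<le> ?u i" for i
      using Max_ge[OF _ rangeI[of ?u i]] Min_le[OF _ rangeI[of ?u i]] by simp_all
    from this[of "Some k"] this[of None] show ?thesis by simp
  qed
  ultimately show ?thesis using False by (simp add: hat_def)
qed (simp add: hat_def)

section \<open>The Kuhn mesh of the unit cube\<close>

text \<open>Cells of level \<open>N\<close>, named by points that are generic at the level \<open>L\<close>, where \<open>L\<close> is \<open>N\<close> or \<open>2 N\<close>. With \<open>L = 2 N\<close> the same points
  name the coarse cells and the fine cells inside them.\<close>

definition kuhn_mesh :: "nat \<Rightarrow> nat \<Rightarrow> (real^'n::finite) set set" where
  "kuhn_mesh L N = {cell N g |g. generic L g \<and> g \<in> box 0 1}"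

lemma unit_box_nonempty: "box (0::real^'n::finite) 1 \<noteq> {}"
proof -
  have "(\<chi> i. 1/2) \<in> box (0::real^'n) 1" by (simp add: mem_box_cart)
  then show ?thesis by blast
qed

lemma closure_unit_box: "closure (box 0 1) = cbox (0::real^'n::finite) 1"
  using unit_box_nonempty by (rule closure_box)

lemma polyhedral_unit_box: "polyhedral_domain (box (0::real^'n::finite) 1)"
  unfolding polyhedral_domain_def closure_unit_box
proof (intro conjI exI[of _ "{cbox 0 1}"])
  show "connected (box (0::real^'n) 1)" by (intro convex_connected convex_box)
qed (use unit_box_nonempty polytope_interval in \<open>auto simp: open_box\<close>)

lemma cell_subset_unit_cube:
  assumes "0 < N" "g \<in> box 0 1"
  shows "cell N g \<subseteq> cbox 0 (1 :: real^'n::finite)"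
proof
  fix x assume x: "x \<in> cell N g"
  show "x \<in> cbox 0 1"
    unfolding mem_box_cart
  proof
    fix k
    have "0 < g $ k" "g $ k < 1" using assms(2) by (auto simp: mem_box_cart)
    then have "of_int 0 \<le> N * (g \<bullet> dir (Some k) None)" "N * (g \<bullet> dir (Some k) None) \<le> of_int (int N)"
      by (simp_all add: inner_dir mult_left_le)
    from cell_lower[OF x this(1)] cell_upper[OF x this(2)]
    show "0 $ k \<le> x $ k \<and> x $ k \<le> 1 $ k"
      using \<open>0 < N\<close> by (simp add: inner_dir zero_le_mult_iff)
  qed
qed

text \<open>A direction of local translation invariance at \<open>p\<close> would put \<open>p\<close> in the middle of a segment in \<open>T\<close>.\<close>

lemma extreme_imp_polyhedral_vertex:
  fixes p :: "'a::euclidean_space"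
  assumes "p extreme_point_of T"
  shows "polyhedral_vertex T p"
  unfolding polyhedral_vertex_def
proof (intro conjI notI)
  show "p \<in> T" using assms by (simp add: extreme_point_of_def)
  assume "\<exists>e r. e \<noteq> 0 \<and> 0 < r \<and> (\<forall>y\<in>ball p r. \<forall>t. y + t *\<^sub>R e \<in> ball p r \<longrightarrow> (y \<in> T) = (y + t *\<^sub>R e \<in> T))"
  then obtain e r where e: "e \<noteq> 0" "0 < r"
    and inv: "\<And>y t. y \<in> ball p r \<Longrightarrow> y + t *\<^sub>R e \<in> ball p r \<Longrightarrow> (y \<in> T) = (y + t *\<^sub>R e \<in> T)" by blast
  define t where "t = r / (2 * norm e)"
  have "0 < t" "\<bar>t\<bar> * norm e < r" using e by (auto simp: t_def)
  then have "p + t *\<^sub>R e \<in> T" "p + (- t) *\<^sub>R e \<in> T"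
    using inv[of p t] inv[of p "- t"] \<open>p \<in> T\<close> e(2) by (auto simp: dist_norm)
  moreover have "p \<in> open_segment (p + t *\<^sub>R e) (p + (- t) *\<^sub>R e)"
  proof -
    have "(p + t *\<^sub>R e) + (p + (- t) *\<^sub>R e) = 2 *\<^sub>R p" by (simp add: scaleR_2)
    then have mid: "midpoint (p + t *\<^sub>R e) (p + (- t) *\<^sub>R e) = p" by (simp add: midpoint_def)
    have "(p + t *\<^sub>R e) - (p + (- t) *\<^sub>R e) = (t - (- t)) *\<^sub>R e"
      by (simp only: scaleR_left_diff_distrib add_diff_cancel_left)
    moreover have "(t - (- t)) *\<^sub>R e \<noteq> 0" using \<open>0 < t\<close> e(1) by simp
    ultimately have "p + t *\<^sub>R e \<noteq> p + (- t) *\<^sub>R e" by (metis right_minus_eq)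
    then show ?thesis using mid by (metis midpoint_in_open_segment)
  qed
  ultimately show False using assms unfolding extreme_point_of_def by blast
qed

text \<open>The facts below are shared by the coarse mesh and the fine mesh. The parameter \<open>ty\<close> carries the dimension.\<close>

locale mesh_levels =
  fixes L N :: nat and ty :: "'n::finite itself"
  assumes N_pos: "0 < N" and levels: "L = N \<or> L = 2 * N"
begin

abbreviation mesh :: "(real^'n) set set" where "mesh \<equiv> kuhn_mesh L N"

lemma generic_level: "generic L g \<Longrightarrow> generic N g"
  using levels generic_coarse by blast

lemma cell_level: "cell L g \<subseteq> cell N g"
  using levels cell_refine by blast

lemma L_pos: "0 < L"
  using levels N_pos by auto

lemma mesh_cases:
  assumes "T \<in> mesh"
  obtains g where "T = cell N g" "generic L g" "g \<in> box 0 1" "generic_cell N g"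
proof -
  obtain g where "T = cell N g" "generic L g" "g \<in> box 0 1"
    using assms by (auto simp: kuhn_mesh_def)
  moreover from this have "generic_cell N g" using N_pos generic_level by (simp add: generic_cell_def)
  ultimately show ?thesis by (rule that)
qed

lemma finite_mesh: "finite mesh"
  by (rule finite_subset[OF _ finite_cells[of N]]) (auto simp: kuhn_mesh_def)

lemma mesh_simplex: "T \<in> mesh \<Longrightarrow> int DIM(real^'n) simplex T"
  using generic_cell.cell_simplex by (fastforce elim: mesh_cases)

lemma mesh_convex: "T \<in> mesh \<Longrightarrow> convex T"
  by (auto elim!: mesh_cases intro: convex_cell)

lemma mesh_closed: "T \<in> mesh \<Longrightarrow> closed T"
  by (auto elim!: mesh_cases intro: closed_cell)

lemma mesh_bounded: "T \<in> mesh \<Longrightarrow> bounded T"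
  using N_pos by (auto elim!: mesh_cases intro: bounded_cell)

lemma mesh_triangulation: "triangulation mesh"
  unfolding triangulation_def
proof (intro conjI ballI allI impI finite_mesh)
  show "\<exists>n. n simplex T" if "T \<in> mesh" for T using mesh_simplex[OF that] by blast
  show "(T \<inter> T') face_of T" if "T \<in> mesh \<and> T' \<in> mesh" for T T'
    using that cell_Int_face by (auto elim!: mesh_cases)
qed

lemma mesh_subset_cube: "T \<in> mesh \<Longrightarrow> T \<subseteq> cbox 0 1"
  using cell_subset_unit_cube[OF N_pos] by (auto elim!: mesh_cases)

lemma mesh_point_near:
  assumes "x \<in> cbox 0 1" "generic L g" "g \<in> box 0 (1::real^'n)"
  obtains t where "0 < t" "t \<le> 1" "generic L (x + t *\<^sub>R (g - x))" "x + t *\<^sub>R (g - x) \<in> box 0 (1::real^'n)"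
    "x \<in> cell L (x + t *\<^sub>R (g - x))"
proof -
  obtain t where t: "0 < t" "t \<le> 1" "generic L (x + t *\<^sub>R (g - x))" "x \<in> cell L (x + t *\<^sub>R (g - x))"
    using generic_point_near[OF assms(2)] by blast
  have "x + t *\<^sub>R (g - x) \<in> box 0 1"
    unfolding mem_box_cart
  proof
    fix k
    have x: "0 \<le> x $ k" "x $ k \<le> 1" and g: "0 < g $ k" "g $ k < 1"
      using assms by (auto simp: mem_box_cart)
    have eq: "(x + t *\<^sub>R (g - x)) $ k = (1 - t) * x $ k + t * g $ k" by (simp add: algebra_simps)
    have "0 \<le> (1 - t) * x $ k" "0 < t * g $ k" "t * g $ k < t * 1"
      using x g t by auto
    moreover have "(1 - t) * x $ k \<le> (1 - t) * 1" using x t by (intro mult_left_mono) auto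
    ultimately show "0 $ k < (x + t *\<^sub>R (g - x)) $ k \<and> (x + t *\<^sub>R (g - x)) $ k < 1 $ k"
      unfolding eq by auto
  qed
  then show ?thesis using that t by blast
qed

lemma Union_mesh: "\<Union>mesh = cbox 0 1"
proof
  show "\<Union>mesh \<subseteq> cbox 0 1" using mesh_subset_cube by blast
  show "cbox 0 1 \<subseteq> \<Union>mesh"
  proof
    fix x :: "real^'n" assume x: "x \<in> cbox 0 1"
    obtain g0 :: "real^'n" where g0: "generic L g0" "g0 \<in> box 0 1" using generic_exists[OF L_pos] by blast
    obtain t where "generic L (x + t *\<^sub>R (g0 - x))" "x + t *\<^sub>R (g0 - x) \<in> box 0 1"
      "x \<in> cell L (x + t *\<^sub>R (g0 - x))"
      using mesh_point_near[OF x g0] by metis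
    then show "x \<in> \<Union>mesh" using cell_level unfolding kuhn_mesh_def by blast
  qed
qed

lemma conforming_mesh_unit_cube: "conforming_mesh (box 0 1) mesh"
  unfolding conforming_mesh_def closure_unit_box using mesh_triangulation mesh_simplex Union_mesh by blast

definition inradius :: real where
  "inradius = 1 / (2 * real N * (real CARD('n) + 1))"

lemma inradius_pos: "0 < inradius"
  using N_pos by (simp add: inradius_def add_nonneg_pos)

lemma mesh_ball:
  assumes "T \<in> mesh"
  obtains c where "cball c inradius \<subseteq> T"
  using assms generic_cell.cell_contains_ball unfolding inradius_def by (metis mesh_cases)

lemma mesh_dist:
  assumes "T \<in> mesh" "x \<in> T" "y \<in> T"
  shows "dist x y \<le> CARD('n) / N"
  using assms cell_dist[OF _ _ N_pos] by (auto elim!: mesh_cases simp: dist_norm)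

lemma mesh_component_dist:
  assumes "T \<in> mesh" "x \<in> T" "y \<in> T"
  shows "\<bar>x $ k - y $ k\<bar> \<le> 1 / N"
  using assms cell_component_dist[OF _ _ N_pos] by (auto elim!: mesh_cases)

lemma mesh_interior: "T \<in> mesh \<Longrightarrow> interior T \<noteq> {}"
  using interior_full_simplex mesh_simplex by blast

lemma mesh_closure_interior: "T \<in> mesh \<Longrightarrow> closure (interior T) = T"
  using convex_closure_interior[OF mesh_convex mesh_interior] mesh_closed by simp

lemma mesh_diameter_le: "T \<in> mesh \<Longrightarrow> diameter T \<le> CARD('n) / N"
  using mesh_dist by (intro diameter_le) (auto simp: dist_norm)

lemma mesh_diameter_ge: "T \<in> mesh \<Longrightarrow> 2 * inradius \<le> diameter T"
proof -
  assume T: "T \<in> mesh"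
  then obtain c where "cball c inradius \<subseteq> T" by (rule mesh_ball)
  then have "diameter (cball c inradius) \<le> diameter T" using mesh_bounded[OF T] by (rule diameter_subset)
  then show ?thesis using inradius_pos by simp
qed

lemma mesh_disjoint_interiors:
  assumes "T \<in> mesh" "T' \<in> mesh" "T \<noteq> T'"
  shows "interior T \<inter> interior T' = {}"
proof -
  have "negligible (T \<inter> T')"
    by (rule negligible_Int_full_simplices[OF mesh_triangulation assms mesh_simplex[OF assms(1)] mesh_simplex[OF assms(2)]])
  then have "negligible (interior (T \<inter> T'))" by (rule negligible_subset) (rule interior_subset)
  then have "interior (T \<inter> T') = {}" using open_not_negligible[OF open_interior] by blast
  then show ?thesis by (simp add: interior_Int)
qed

lemma mesh_extreme_lattice: "T \<in> mesh \<Longrightarrow> p extreme_point_of T \<Longrightarrow> p \<in> lattice N"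
  using generic_cell.extreme_point_lattice by (fastforce elim: mesh_cases)

lemma interior_cell_strict:
  fixes x :: "real^'n"
  assumes "x \<in> interior (cell N g)" "i \<noteq> j"
  shows "of_int \<lfloor>N * (g \<bullet> dir i j)\<rfloor> < N * (x \<bullet> dir i j)"
proof -
  have "dir i j \<noteq> (0::real^'n)"
  proof
    assume "dir i j = (0::real^'n)"
    then have "v \<bullet> coord i = v \<bullet> coord j" for v :: "real^'n" by (metis eq_iff_diff_eq_0 inner_dir inner_zero_right)
    from this[of "\<chi> k. if i = Some k then 1 else 2"] show False
      using \<open>i \<noteq> j\<close> by (cases i; cases j) (auto split: if_splits)
  qed
  then have "real N *\<^sub>R dir i j \<noteq> 0" using N_pos by simp
  have "cell N g \<subseteq> {x. (real N *\<^sub>R dir i j) \<bullet> x \<ge> of_int \<lfloor>N * (g \<bullet> dir i j)\<rfloor>}"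
    by (auto simp: cell_eq_floor inner_commute)
  then have "interior (cell N g) \<subseteq> {x. (real N *\<^sub>R dir i j) \<bullet> x > of_int \<lfloor>N * (g \<bullet> dir i j)\<rfloor>}"
    using interior_mono interior_halfspace_ge[OF \<open>real N *\<^sub>R dir i j \<noteq> 0\<close>] by metis
  then show ?thesis using assms(1) by (auto simp: inner_commute)
qed

text \<open>If \<open>p\<close> is inside a segment of the cell, then all constraints active at \<open>p\<close> are constant along the segment, and the
  inactive ones stay inactive near \<open>p\<close>. So the cell is locally invariant in the direction of the segment.\<close>

lemma polyhedral_vertex_imp_extreme:
  fixes p :: "real^'n"
  assumes "polyhedral_vertex (cell N g) p"
  shows "p extreme_point_of cell N g"
proof (rule ccontr)
  assume "\<not> ?thesis"
  then obtain a b where ab: "a \<in> cell N g" "b \<in> cell N g" "p \<in> open_segment a b"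
    using assms unfolding extreme_point_of_def polyhedral_vertex_def by blast
  then obtain s where s: "0 < s" "s < 1" "p = (1 - s) *\<^sub>R a + s *\<^sub>R b" and "a \<noteq> b"
    by (auto simp: in_segment)
  let ?f = "\<lambda>i j x. N * (x \<bullet> dir i j)" and ?c = "\<lambda>i j. real_of_int \<lfloor>N * (g \<bullet> dir i j)\<rfloor>"
  have p: "?c i j \<le> ?f i j p" for i j
    using assms by (simp add: polyhedral_vertex_def cell_eq_floor)
  have const: "(b - a) \<bullet> dir i j = 0" if "?f i j p = ?c i j" for i j
  proof -
    have ge: "?c i j \<le> ?f i j a" "?c i j \<le> ?f i j b" using ab(1,2) by (simp_all add: cell_eq_floor)
    have "(1 - s) * (?f i j a - ?c i j) + s * (?f i j b - ?c i j) = 0"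
      using that s(3) by (simp add: inner_add_left algebra_simps)
    moreover have "0 \<le> (1 - s) * (?f i j a - ?c i j)" "0 \<le> s * (?f i j b - ?c i j)"
      using s ge by auto
    ultimately have "(1 - s) * (?f i j a - ?c i j) = 0" "s * (?f i j b - ?c i j) = 0" by linarith+
    then have "?f i j a = ?f i j b" using s by simp
    then show ?thesis using N_pos by (simp add: inner_diff_left)
  qed
  define U where "U = (\<Inter>(i, j)\<in>{(i, j). ?c i j < ?f i j p}. {x. ?c i j < ?f i j x})"
  have "open U"
    unfolding U_def by (intro open_INT) (auto intro!: open_Collect_less continuous_intros)
  moreover have "p \<in> U" by (auto simp: U_def)
  ultimately obtain r where r: "0 < r" "ball p r \<subseteq> U" using open_contains_ball by blast
  have "y \<in> cell N g \<longleftrightarrow> y + t *\<^sub>R (b - a) \<in> cell N g" if "y \<in> ball p r" "y + t *\<^sub>R (b - a) \<in> ball p r" for y t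
  proof -
    have "?c i j \<le> ?f i j y \<longleftrightarrow> ?c i j \<le> ?f i j (y + t *\<^sub>R (b - a))" for i j
    proof (cases "?f i j p = ?c i j")
      case True
      then show ?thesis using const by (simp add: inner_add_left)
    next
      case False
      then have "(i, j) \<in> {(i, j). ?c i j < ?f i j p}" using p[of i j] by simp
      moreover have "y \<in> U" "y + t *\<^sub>R (b - a) \<in> U" using that r(2) by auto
      ultimately have "?c i j < ?f i j y" "?c i j < ?f i j (y + t *\<^sub>R (b - a))" unfolding U_def by blast+
      then show ?thesis by simp
    qed
    then show ?thesis unfolding cell_eq_floor by blast
  qed
  moreover have "b - a \<noteq> 0" using \<open>a \<noteq> b\<close> by simp
  ultimately show False using assms r(1) unfolding polyhedral_vertex_def by blast
qed

lemma mesh_polyhedral_vertex: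
  assumes "T \<in> mesh"
  shows "polyhedral_vertex T p \<longleftrightarrow> p extreme_point_of T"
proof -
  obtain g where "T = cell N g" using assms by (rule mesh_cases)
  then show ?thesis
    using extreme_imp_polyhedral_vertex[of p T] polyhedral_vertex_imp_extreme[of g p] by blast
qed

end

section \<open>The Kuhn partition of the unit cube\<close>

definition kuhn_partition :: "nat \<Rightarrow> (real^'n::finite) partition" where
  "kuhn_partition m = \<lparr>subdomains = interior ` kuhn_mesh (2 * m) m, coarse_mesh = kuhn_mesh (2 * m) m,
     fine_mesh = (\<lambda>S. {T \<in> kuhn_mesh (2 * m) (2 * m). T \<subseteq> closure S}),
     sizeH = CARD('n) / m, sizeh = CARD('n) / (2 * m)\<rparr>"

lemma kuhn_partition_simps [simp]:
  "subdomains (kuhn_partition m) = interior ` kuhn_mesh (2 * m) m"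
  "coarse_mesh (kuhn_partition m) = kuhn_mesh (2 * m) m"
  "fine_mesh (kuhn_partition m) S = {T \<in> kuhn_mesh (2 * m) (2 * m). T \<subseteq> closure S}"
  "sizeH (kuhn_partition m :: (real^'n::finite) partition) = CARD('n) / m"
  "sizeh (kuhn_partition m :: (real^'n::finite) partition) = CARD('n) / (2 * m)"
  by (simp_all add: kuhn_partition_def)

lemma triangulation_subset: "triangulation \<T> \<Longrightarrow> \<T>' \<subseteq> \<T> \<Longrightarrow> triangulation \<T>'"
  unfolding triangulation_def by (blast intro: finite_subset)

locale kuhn_refinement =
  fixes m :: nat and ty :: "'n::finite itself"
  assumes m_pos: "0 < m"
begin

sublocale C: mesh_levels "2 * m" m "TYPE('n)"
  using m_pos by unfold_locales auto

sublocale F: mesh_levels "2 * m" "2 * m" "TYPE('n)"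
  using m_pos by unfold_locales auto

abbreviation K :: "(real^'n) partition" where "K \<equiv> kuhn_partition m"

text \<open>Move a point \<open>x\<close> of the coarse cell slightly towards its generic point \<open>g\<close>. The new point is generic for the fine
  level and still in the coarse cell, so its fine cell contains \<open>x\<close> and lies in the coarse cell.\<close>

lemma fine_cells_cover:
  assumes "T \<in> C.mesh"
  shows "\<Union>{T' \<in> F.mesh. T' \<subseteq> T} = T"
proof
  show "T \<subseteq> \<Union>{T' \<in> F.mesh. T' \<subseteq> T}"
  proof
    fix x assume x: "x \<in> T"
    obtain g where g: "T = cell m g" "generic (2 * m) g" "g \<in> box 0 1" "generic_cell m g"
      using assms by (rule C.mesh_cases)
    have "x \<in> cbox 0 1" using C.mesh_subset_cube[OF assms] x by blast
    then obtain t where t: "0 < t" "t \<le> 1" "generic (2 * m) (x + t *\<^sub>R (g - x))"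
      "x + t *\<^sub>R (g - x) \<in> box 0 1" "x \<in> cell (2 * m) (x + t *\<^sub>R (g - x))"
      by (rule C.mesh_point_near[OF _ g(2,3)])
    have "(1 - t) *\<^sub>R x + t *\<^sub>R g \<in> T"
      using C.mesh_convex[OF assms] x generator_in_cell[of g m] g(1) t by (simp add: convex_alt)
    then have "x + t *\<^sub>R (g - x) \<in> cell m g" unfolding g(1) by (simp add: algebra_simps)
    then have "cell m (x + t *\<^sub>R (g - x)) = cell m g"
      by (intro cell_eqI C.generic_level g(2) t(3))
    then have "cell (2 * m) (x + t *\<^sub>R (g - x)) \<subseteq> T" unfolding g(1) using cell_refine by blast
    moreover have "cell (2 * m) (x + t *\<^sub>R (g - x)) \<in> F.mesh" using t(3,4) by (auto simp: kuhn_mesh_def)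
    ultimately show "x \<in> \<Union>{T' \<in> F.mesh. T' \<subseteq> T}" using t(5) by blast
  qed
qed blast

lemma subdomain_cases:
  assumes "S \<in> subdomains K"
  obtains T where "T \<in> C.mesh" "S = interior T" "closure S = T"
  using assms C.mesh_closure_interior by auto

lemma fine_mesh_Union: "(\<Union>S\<in>subdomains K. fine_mesh K S) \<subseteq> F.mesh"
  by auto

lemma conforming_fine_mesh:
  assumes S: "S \<in> subdomains K"
  shows "conforming_mesh S (fine_mesh K S)"
proof -
  obtain T where T: "T \<in> C.mesh" "closure S = T" using S by (rule subdomain_cases)
  have "triangulation {T' \<in> F.mesh. T' \<subseteq> T}" using F.mesh_triangulation by (rule triangulation_subset) blast
  moreover have "\<forall>T'\<in>{T' \<in> F.mesh. T' \<subseteq> T}. int DIM(real^'n) simplex T'" using F.mesh_simplex by blast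
  ultimately show ?thesis unfolding conforming_mesh_def kuhn_partition_simps T(2) using fine_cells_cover[OF T(1)] by blast
qed

lemma corners_eq: "corners K = mesh_nodes C.mesh"
  unfolding corners_def mesh_nodes_def kuhn_partition_simps
  using C.mesh_closure_interior C.mesh_polyhedral_vertex by auto

lemma Lipschitz_subdomain:
  fixes \<sigma> :: real
  assumes "S \<in> subdomains K" "\<sigma> = 12 * CARD('n) * (CARD('n) + 1)"
  shows "lipschitz_domain \<sigma> (sizeH K / \<sigma>) S"
proof -
  obtain T where T: "T \<in> C.mesh" "S = interior T" "closure S = T" using assms(1) by (rule subdomain_cases)
  obtain c where c: "cball c C.inradius \<subseteq> T" using C.mesh_ball[OF T(1)] .
  have "interior (cball c C.inradius) \<subseteq> interior T" using c by (rule interior_mono)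
  then have ball: "ball c C.inradius \<subseteq> S" by (simp add: T(2))
  have "c \<in> T" using c C.inradius_pos by auto
  define n where "n = real CARD('n)"
  have n: "0 < n" "0 < real m" using m_pos by (simp_all add: n_def)
  have \<sigma>: "\<sigma> = 12 * n * (n + 1)" using assms(2) by (simp add: n_def algebra_simps)
  have r: "sizeH K / \<sigma> = 1 / (12 * m * (n + 1))" using n by (simp add: \<sigma> n_def[symmetric])
  have D: "n / m / \<sigma> = 1 / (12 * m * (n + 1))" using n by (simp add: \<sigma>)
  have \<rho>: "C.inradius = 6 * (1 / (12 * m * (n + 1)))" using n by (simp add: C.inradius_def n_def[symmetric])
  have pos: "0 < 1 / (12 * m * (n + 1))" using n by simp
  show ?thesis
  proof (rule lipschitz_domain_if_convex[where c = c and \<rho> = C.inradius and D = "n / m"])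
    show "open S" "convex S" "bounded S"
      using T C.mesh_convex C.mesh_bounded bounded_interior by (auto intro: convex_interior)
    show "ball c C.inradius \<subseteq> S" by (rule ball)
    show "dist x c \<le> n / m" if "x \<in> closure S" for x
      using C.mesh_dist[OF T(1)] that T(3) \<open>c \<in> T\<close> by (simp add: n_def)
    show "0 < sizeH K / \<sigma>" "3 * (sizeH K / \<sigma>) \<le> C.inradius" "2 * (sizeH K / \<sigma>) + n / m / \<sigma> < C.inradius"
      using pos unfolding r D \<rho> by linarith+
    show "0 < \<sigma>" using n by (simp add: \<sigma>)
  qed
qed

lemma mesh_regularity:
  fixes \<sigma> :: real
  assumes "mesh_levels L N" "\<sigma> = 12 * CARD('n) * (CARD('n) + 1)" "T \<in> (kuhn_mesh L N :: (real^'n) set set)"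
  shows "\<exists>x \<rho>. 0 < \<rho> \<and> cball x \<rho> \<subseteq> T \<and> diameter T \<le> \<sigma> * \<rho>"
    and "diameter T \<le> CARD('n) / N" "CARD('n) / N \<le> \<sigma> * diameter T"
proof -
  interpret mesh_levels L N "TYPE('n)" by fact
  define n where "n = real CARD('n)"
  have n: "0 < n" "0 < real N" using N_pos by (simp_all add: n_def)
  have "12 * n * (n + 1) * inradius = 6 * (n / N)"
  proof -
    have "12 * n * M * (1 / (2 * real N * M)) = 6 * (n / N)" if "0 < M" for M :: real
      using n that by (simp add: field_simps)
    from this[of "n + 1"] show ?thesis using n(1) unfolding inradius_def n_def[symmetric] by linarith
  qed
  moreover have "\<sigma> = 12 * n * (n + 1)" using assms(2) by (simp add: n_def algebra_simps)
  ultimately have \<sigma>: "\<sigma> * inradius = 6 * (n / N)" "0 < \<sigma>" using n by auto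
  have "0 < n / N" using n by simp
  then have "n / N \<le> \<sigma> * inradius" unfolding \<sigma> by linarith
  have d: "diameter T \<le> n / N" using mesh_diameter_le[OF assms(3)] by (simp add: n_def)
  then show "diameter T \<le> CARD('n) / N" by (simp add: n_def)
  have "n / N \<le> \<sigma> * (2 * inradius)" using \<sigma>(1) \<open>0 < n / N\<close> by linarith
  also have "\<dots> \<le> \<sigma> * diameter T" using mesh_diameter_ge[OF assms(3)] \<sigma>(2) by (intro mult_left_mono) auto
  finally show "CARD('n) / N \<le> \<sigma> * diameter T" by (simp add: n_def)
  obtain c where "cball c inradius \<subseteq> T" using mesh_ball[OF assms(3)] .
  then show "\<exists>x \<rho>. 0 < \<rho> \<and> cball x \<rho> \<subseteq> T \<and> diameter T \<le> \<sigma> * \<rho>"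
    using d \<open>n / N \<le> \<sigma> * inradius\<close> inradius_pos by (meson order_trans)
qed

lemma finite_subdomains: "finite (subdomains K)"
  using C.finite_mesh by simp

lemma disjoint_subdomains: "disjoint (subdomains K)"
  unfolding pairwise_def disjnt_def using C.mesh_disjoint_interiors by fastforce

lemma kuhn_partition_admissible:
  "admissible_partition (12 * CARD('n) * (CARD('n) + 1)) 1 (box 0 1) K"
proof -
  define \<sigma> :: real where "\<sigma> = 12 * CARD('n) * (CARD('n) + 1)"
  have \<sigma>1: "1 \<le> \<sigma>"
  proof -
    have "0 < 12 * CARD('n) * (CARD('n) + 1)" by simp
    then show ?thesis unfolding \<sigma>_def by linarith
  qed
  note reg_C = mesh_regularity[OF C.mesh_levels_axioms \<sigma>_def] and reg_F = mesh_regularity[OF F.mesh_levels_axioms \<sigma>_def]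
  have "lipschitz_domain \<sigma> (sizeH K / \<sigma>) S \<and> sizeH K \<le> \<sigma> * diameter S \<and> diameter S \<le> \<sigma> * sizeH K \<and>
        (\<exists>\<K>\<subseteq>coarse_mesh K. card \<K> \<le> 1 \<and> closure S = \<Union>\<K>)" if S: "S \<in> subdomains K" for S
  proof -
    obtain T where T: "T \<in> C.mesh" "S = interior T" "closure S = T" using S by (rule subdomain_cases)
    have "diameter S = diameter T"
      using diameter_closure[of S] T C.mesh_bounded[OF T(1)] bounded_interior by metis
    moreover have "diameter T \<le> \<sigma> * sizeH K"
      using reg_C(2)[OF T(1)] \<sigma>1 mult_right_mono[of 1 \<sigma> "sizeH K"] by simp
    moreover have "closure S = \<Union>{T}" "{T} \<subseteq> coarse_mesh K" "card {T} \<le> 1" using T by auto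
    ultimately show ?thesis using Lipschitz_subdomain[OF S \<sigma>_def] reg_C(3)[OF T(1)] by (metis kuhn_partition_simps(4))
  qed
  moreover have "(\<Union>S\<in>subdomains K. closure S) = closure (box 0 1)"
    using C.mesh_closure_interior C.Union_mesh unfolding closure_unit_box by simp
  moreover have "triangulation (\<Union>S\<in>subdomains K. fine_mesh K S)"
    using F.mesh_triangulation fine_mesh_Union by (rule triangulation_subset)
  moreover have "shape_regular \<sigma> (coarse_mesh K)" "quasi_uniform \<sigma> (sizeH K) (coarse_mesh K)"
    using reg_C unfolding shape_regular_def quasi_uniform_def by simp_all
  moreover have "shape_regular \<sigma> (fine_mesh K S)" "quasi_uniform \<sigma> (sizeh K) (fine_mesh K S)" for S
    using reg_F unfolding shape_regular_def quasi_uniform_def by simp_all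
  moreover have "0 < sizeH K" "0 < sizeh K" using m_pos by simp_all
  ultimately show ?thesis
    unfolding admissible_partition_def \<sigma>_def[symmetric]
    using C.conforming_mesh_unit_cube corners_eq finite_subdomains disjoint_subdomains conforming_fine_mesh
    by (metis kuhn_partition_simps(2))
qed

lemma fine_node_lattice: "p \<in> mesh_nodes (fine_mesh K S) \<Longrightarrow> p \<in> lattice (2 * m)"
  using F.mesh_extreme_lattice by (auto simp: mesh_nodes_def)

lemma hat_in_P1:
  assumes S: "S \<in> subdomains K" and p: "p \<in> lattice (2 * m)"
  shows "(\<lambda>x. if x \<in> closure S then hat (2 * m) p x else 0) \<in> P1_space K S"
proof -
  let ?f = "\<lambda>x. if x \<in> closure S then hat (2 * m) p x else 0"
  have aff: "\<exists>a b. \<forall>x\<in>T. ?f x = a \<bullet> x + b" if T: "T \<in> fine_mesh K S" for T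
  proof -
    have "T \<in> F.mesh" "T \<subseteq> closure S" using T by auto
    then obtain g where "T = cell (2 * m) g" by (auto simp: kuhn_mesh_def)
    then show ?thesis using hat_affine_on_cell[OF p, of g] \<open>T \<subseteq> closure S\<close> by (metis subsetD)
  qed
  have "continuous_on (\<Union>T\<in>fine_mesh K S. T) ?f"
  proof (rule continuous_on_closed_Union)
    show "finite (fine_mesh K S)" using F.finite_mesh by simp
    fix T assume T: "T \<in> fine_mesh K S"
    then show "closed T" using F.mesh_closed by simp
    obtain a b where "\<And>x. x \<in> T \<Longrightarrow> ?f x = a \<bullet> x + b" using aff[OF T] by blast
    then show "continuous_on T ?f"
      by (subst continuous_on_cong[OF refl]) (auto intro!: continuous_intros)
  qed
  moreover have "(\<Union>T\<in>fine_mesh K S. T) = closure S"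
    using conforming_fine_mesh[OF S] by (simp add: conforming_mesh_def)
  ultimately have "continuous_on (closure S) ?f" by simp
  then show ?thesis unfolding P1_space_def using aff by auto
qed

text \<open>Inside a coarse cell each of \<open>m p\<^sub>i\<close>, \<open>m p\<^sub>j\<close> and \<open>m (p\<^sub>i - p\<^sub>j)\<close> lies strictly between consecutive integers. If twice these numbers are
  integers, all three are odd, but the third is the difference of the other two.\<close>

lemma half_lattice_not_interior:
  assumes dim: "2 \<le> CARD('n)" and S: "S \<in> subdomains K" and p: "p \<in> lattice (2 * m)"
  shows "p \<notin> S"
proof
  assume "p \<in> S"
  obtain T where T: "T \<in> C.mesh" "S = interior T" using S by (rule subdomain_cases)
  obtain g where g: "T = cell m g" using C.mesh_cases[OF T(1)] by blast
  have odd: "odd k" if k: "2 * (real m * (p \<bullet> dir i j)) = of_int k" and "i \<noteq> j" for i j k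
  proof -
    have "p \<in> interior (cell m g)" using \<open>p \<in> S\<close> T(2) g by simp
    note strict = C.interior_cell_strict[OF this]
    have swap: "m * (v \<bullet> dir j i) = - (m * (v \<bullet> dir i j))" for v :: "real^'n"
      by (simp add: inner_dir algebra_simps)
    have "of_int \<lfloor>m * (g \<bullet> dir i j)\<rfloor> < m * (p \<bullet> dir i j)"
      using strict \<open>i \<noteq> j\<close> by blast
    moreover have "of_int \<lfloor>- (m * (g \<bullet> dir i j))\<rfloor> < - (m * (p \<bullet> dir i j))"
      using strict[of j i] \<open>i \<noteq> j\<close> unfolding swap by blast
    moreover have "- of_int \<lfloor>- (m * (g \<bullet> dir i j))\<rfloor> \<le> of_int \<lfloor>m * (g \<bullet> dir i j)\<rfloor> + (1::real)"
      using ceiling_diff_floor_le_1[of "m * (g \<bullet> dir i j)"] unfolding ceiling_def by linarith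
    ultimately have "of_int (2 * \<lfloor>m * (g \<bullet> dir i j)\<rfloor>) < real_of_int k"
      "real_of_int k < of_int (2 * \<lfloor>m * (g \<bullet> dir i j)\<rfloor> + 2)"
      unfolding k[symmetric] by linarith+
    then have "k = 2 * \<lfloor>m * (g \<bullet> dir i j)\<rfloor> + 1" by linarith
    then show ?thesis by simp
  qed
  obtain a b :: 'n where "a \<noteq> b"
    using dim by (metis card_2_iff' ex_card subset_UNIV)
  obtain u v where u: "2 * (real m * (p \<bullet> coord (Some a))) = of_int u" and v: "2 * (real m * (p \<bullet> coord (Some b))) = of_int v"
    using lattice_inner_coord[OF p, of "Some a"] lattice_inner_coord[OF p, of "Some b"]
    by (auto elim!: Ints_cases simp: mult.assoc)
  have "odd u" using odd[of "Some a" None u] u by (simp add: inner_dir)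
  moreover have "odd v" using odd[of "Some b" None v] v by (simp add: inner_dir)
  moreover have "2 * (real m * (p \<bullet> dir (Some a) (Some b))) = of_int (u - v)"
    using u v by (simp add: inner_dir algebra_simps)
  then have "odd (u - v)" using odd[of "Some a" "Some b" "u - v"] \<open>a \<noteq> b\<close> by simp
  ultimately show False by simp
qed

text \<open>The other coarse cells form a closed set. Were \<open>q\<close> outside it, a neighbourhood of \<open>q\<close> would be contained in the closure of \<open>S\<close>, and
  \<open>q\<close> would be an inner point.\<close>

lemma boundary_point_on_interface:
  assumes S: "S \<in> subdomains K" and q: "q \<in> closure S" "q \<notin> S" "q \<in> box 0 1"
  shows "q \<in> interface K"
proof -
  obtain T where T: "T \<in> C.mesh" "S = interior T" "closure S = T" using S by (rule subdomain_cases)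
  define U where "U = \<Union>(C.mesh - {T})"
  have "closed U" unfolding U_def using C.finite_mesh C.mesh_closed by (intro closed_Union) auto
  have "q \<in> U"
  proof (rule ccontr)
    assume "q \<notin> U"
    have "open (box 0 1 - U)" using \<open>closed U\<close> by (intro open_Diff open_box)
    moreover have "box 0 1 - U \<subseteq> T"
      using C.Union_mesh box_subset_cbox unfolding U_def by blast
    ultimately have "box 0 1 - U \<subseteq> S" unfolding T(2) by (intro interior_maximal)
    then show False using q \<open>q \<notin> U\<close> by blast
  qed
  then obtain T' where T': "T' \<in> C.mesh" "T' \<noteq> T" "q \<in> T'" unfolding U_def by blast
  define S' where "S' = interior T'"
  have disj: "S \<inter> S' = {}" using C.mesh_disjoint_interiors[OF T(1) T'(1)] T'(2) T(2) by (simp add: S'_def)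
  then have "q \<notin> S'"
    using q(1) open_Int_closure_eq_empty[of S' S] unfolding S'_def by blast
  moreover have "q \<in> closure S'" using T'(3) C.mesh_closure_interior[OF T'(1)] by (simp add: S'_def)
  ultimately have "q \<in> frontier S'" by (simp add: frontier_def S'_def)
  moreover have "q \<in> frontier S" using q by (simp add: frontier_def T(2))
  moreover have "S' \<in> subdomains K - {S}"
    using disj T'(1) C.mesh_interior[OF T(1)] T(2) unfolding S'_def by auto
  ultimately show ?thesis unfolding interface_def using S by blast
qed

text \<open>A vertex of a neighbouring coarse cell is a vertex of the common face, hence of the closure of \<open>S\<close>, hence of every
  fine cell in it that contains the point.\<close>

lemma corner_is_fine_node:
  assumes S: "S \<in> subdomains K" and p: "p \<in> corners K" "p \<in> closure S"
  shows "p \<in> mesh_nodes (fine_mesh K S)"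
proof -
  obtain T where T: "T \<in> C.mesh" "closure S = T" using S by (rule subdomain_cases)
  obtain T' where T': "T' \<in> C.mesh" "p extreme_point_of T'"
    using p(1) by (auto simp: corners_eq mesh_nodes_def)
  have faces: "(T \<inter> T') face_of T" "(T' \<inter> T) face_of T'"
    using C.mesh_triangulation T(1) T'(1) unfolding triangulation_def by blast+
  have "p \<in> T \<inter> T'" using p T T'(2) by (auto simp: extreme_point_of_def)
  then have "p extreme_point_of (T' \<inter> T)" using extreme_point_of_face[OF faces(2)] T'(2) by blast
  then have ext: "p extreme_point_of T" using extreme_point_of_face[OF faces(1)] by (simp add: Int_commute)
  obtain T'' where T'': "T'' \<in> F.mesh" "T'' \<subseteq> T" "p \<in> T''"
    using fine_cells_cover[OF T(1)] \<open>p \<in> T \<inter> T'\<close> by blast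
  have "p extreme_point_of T''" using ext T'' unfolding extreme_point_of_def by blast
  then show ?thesis using T'' T(2) by (auto simp: mesh_nodes_def)
qed

lemma corner_lattice: "p \<in> corners K \<Longrightarrow> p \<in> lattice m"
  using C.mesh_extreme_lattice by (auto simp: corners_eq mesh_nodes_def)

text \<open>The separation properties hold since points of one fine cell differ by at most \<open>1/(2m)\<close> in each coordinate, whereas
  two corners, or a corner inside the cube and a boundary point, differ by at least \<open>1/m\<close> in some coordinate.\<close>

lemma two_level:
  assumes dim: "2 \<le> CARD('n)"
  shows "two_level_partition K (box 0 1)"
proof
  fix S assume S: "S \<in> subdomains K"
  show "conforming_mesh S (fine_mesh K S)" using conforming_fine_mesh[OF S] .
  obtain T where T: "T \<in> C.mesh" "S = interior T" "closure S = T" using S by (rule subdomain_cases)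
  show "open S" by (simp add: T(2))
  show "convex S" unfolding T(2) using C.mesh_convex[OF T(1)] by (rule convex_interior)
  show "S \<subseteq> box 0 1" unfolding T(2) using interior_mono[OF C.mesh_subset_cube[OF T(1)]] by (simp add: interior_cbox)
  show "mesh_nodes (fine_mesh K S) \<inter> S = {}"
    using half_lattice_not_interior[OF dim S] fine_node_lattice by blast
  show "mesh_nodes (fine_mesh K S) \<inter> box 0 1 \<subseteq> interface K"
  proof
    fix q assume q: "q \<in> mesh_nodes (fine_mesh K S) \<inter> box 0 1"
    then obtain T' where "T' \<in> fine_mesh K S" "q extreme_point_of T'" by (auto simp: mesh_nodes_def)
    then have "q \<in> closure S" by (auto simp: extreme_point_of_def)
    moreover have "q \<notin> S" using half_lattice_not_interior[OF dim S] fine_node_lattice q by blast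
    ultimately show "q \<in> interface K" using boundary_point_on_interface[OF S] q by blast
  qed
  show "corners K \<inter> closure S \<subseteq> mesh_nodes (fine_mesh K S)" using corner_is_fine_node[OF S] by blast
  show "\<exists>f\<in>P1_space K S. \<forall>q\<in>mesh_nodes (fine_mesh K S). f q = (if q = p then 1 else 0)"
    if p: "p \<in> mesh_nodes (fine_mesh K S)" for p
  proof (intro bexI ballI)
    let ?f = "\<lambda>x. if x \<in> closure S then hat (2 * m) p x else 0"
    show "?f \<in> P1_space K S" using hat_in_P1[OF S fine_node_lattice[OF p]] .
    fix q assume q: "q \<in> mesh_nodes (fine_mesh K S)"
    then obtain T' where "T' \<in> fine_mesh K S" "q extreme_point_of T'" by (auto simp: mesh_nodes_def)
    then have "q \<in> closure S" by (auto simp: extreme_point_of_def)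
    then show "?f q = (if q = p then 1 else 0)"
      using hat_lattice[OF _ fine_node_lattice[OF p] fine_node_lattice[OF q]] m_pos by simp
  qed
next
  fix S T p q
  assume T: "T \<in> fine_mesh K S" and pq: "p extreme_point_of T" "q extreme_point_of T" and p: "p \<in> corners K"
  have T_mesh: "T \<in> F.mesh" using T by simp
  have "p \<in> T" "q \<in> T" using pq by (auto simp: extreme_point_of_def)
  then have close: "\<bar>p $ k - q $ k\<bar> \<le> 1 / (2 * m)" for k
    using F.mesh_component_dist[OF T_mesh, of p q k] by simp
  have half: "1 / (2 * real m) < 1 / m" using m_pos by (simp add: field_simps)
  have p_int: "m * p $ k \<in> \<int>" for k using corner_lattice[OF p] by (simp add: lattice_def)
  show "q \<notin> frontier (box 0 1)" if "p \<in> box 0 1"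
  proof -
    have "0 < q $ k \<and> q $ k < 1" for k
    proof -
      obtain z :: int where z: "m * p $ k = of_int z" using p_int by (auto elim: Ints_cases)
      have "0 < p $ k" "p $ k < 1" using that by (auto simp: mem_box_cart)
      then have "0 < m * p $ k" "m * p $ k < m" using m_pos by simp_all
      then have "1 \<le> z" "z \<le> int m - 1" unfolding z by linarith+
      then have "1 \<le> m * p $ k" "m * p $ k \<le> real m - 1" unfolding z by linarith+
      then have "1 / m \<le> p $ k" "p $ k \<le> 1 - 1 / m" using m_pos by (simp_all add: field_simps)
      then show ?thesis using close[of k] half by (simp add: abs_le_iff)
    qed
    then have "q \<in> box 0 1" by (simp add: mem_box_cart)
    then show ?thesis by (simp add: frontier_def interior_open[OF open_box])
  qed
  show "p = q" if q: "q \<in> corners K"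
  proof (rule vec_eq_iff[THEN iffD2], rule allI)
    fix k
    have "m * p $ k - m * q $ k \<in> \<int>" using p_int corner_lattice[OF q] by (simp add: lattice_def)
    then obtain z :: int where z: "m * p $ k - m * q $ k = of_int z" by (auto elim: Ints_cases)
    have "m * \<bar>p $ k - q $ k\<bar> < m * (1 / m)"
      using close[of k] half m_pos by (intro mult_strict_left_mono) auto
    then have "\<bar>m * p $ k - m * q $ k\<bar> < 1" using m_pos by (simp add: abs_mult flip: right_diff_distrib)
    then have "z = 0" unfolding z by linarith
    then show "p $ k = q $ k" using z m_pos by simp
  qed
qed (use finite_subdomains in \<open>auto simp: open_box convex_box\<close>)

end

section \<open>Energies of the bump functions and the limit of vanishing mesh size\<close>

lemma measure_cube:
  assumes "s \<le> t"
  shows "measure lebesgue (cbox (\<chi> i. s) (\<chi> i. t) :: (real^'n::finite) set) = (t - s) ^ CARD('n)"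
    and "measure lebesgue (box (\<chi> i. s) (\<chi> i. t) :: (real^'n::finite) set) = (t - s) ^ CARD('n)"
proof -
  let ?a = "(\<chi> i. s) :: real^'n" and ?b = "(\<chi> i. t) :: real^'n"
  have ne: "cbox ?a ?b \<noteq> {}" using assms by (auto simp: interval_ne_empty_cart)
  have "measure lborel (cbox ?a ?b) = (t - s) ^ CARD('n)"
    using content_cbox_cart[OF ne] by simp
  then show cbox: "measure lebesgue (cbox ?a ?b) = (t - s) ^ CARD('n)" by simp
  have "measure lebesgue (box ?a ?b) = measure lebesgue (cbox ?a ?b)"
    by (simp add: measure_lborel_box_eq measure_lborel_cbox_eq)
  with cbox show "measure lebesgue (box ?a ?b) = (t - s) ^ CARD('n)" by simp
qed

lemma unit_cube_eq: "cbox 0 (1::real^'n::finite) = cbox (\<chi> i. 0) (\<chi> i. 1)"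
  by (rule set_eqI) (simp add: mem_box_cart)

locale kuhn_refinement_dim = kuhn_refinement m ty for m and ty :: "'n::finite itself" +
  assumes dim_ge_2: "2 \<le> CARD('n)"
begin

sublocale two_level_partition K "box 0 1"
  using two_level[OF dim_ge_2] .

lemma boundary_strip:
  assumes T: "T \<in> F.mesh" and q: "q \<in> T" "q \<in> frontier (box 0 1)"
  shows "T \<inter> box (\<chi> i. 1 / (2 * m)) (\<chi> i. 1 - 1 / (2 * m)) = {}"
proof -
  have "q \<notin> box 0 1" using q(2) by (simp add: frontier_def interior_open[OF open_box])
  then obtain k where k: "q $ k \<le> 0 \<or> 1 \<le> q $ k" by (auto simp: mem_box_cart not_less)
  have "x \<notin> box (\<chi> i. 1 / (2 * m)) (\<chi> i. 1 - 1 / (2 * m))" if "x \<in> T" for x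
    using F.mesh_component_dist[OF T that q(1), of k] k by (auto simp: mem_box_cart abs_le_iff intro!: exI[of _ k])
  then show ?thesis by blast
qed

text \<open>The elements that touch the boundary lie in a layer of width \<open>1/(2m)\<close>, and their slopes are at most the reciprocal of the inradius.\<close>

lemma bump_energy_bound:
  "a_form K bump bump \<le> (4 * real m * (real CARD('n) + 1))\<^sup>2 * (1 - (1 - 1 / m) ^ CARD('n))"
proof -
  define A where "A S = {T\<in>fine_mesh K S. \<exists>q. q extreme_point_of T \<and> q \<in> frontier (box 0 1)}" for S
  let ?inner = "box (\<chi> i. 1 / (2 * m)) (\<chi> i. 1 - 1 / (2 * m)) :: (real^'n) set"
  have A_mesh: "A S \<subseteq> F.mesh" for S by (auto simp: A_def)
  have finA: "finite (A S)" for S using A_mesh F.finite_mesh finite_subset by blast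
  have disj: "A S \<inter> A S' = {}" if S: "S \<in> subdomains K" "S' \<in> subdomains K" "S \<noteq> S'" for S S'
  proof (rule ccontr)
    assume "A S \<inter> A S' \<noteq> {}"
    then obtain T where T: "T \<in> A S" "T \<in> A S'" by blast
    obtain T1 where T1: "S = interior T1" "closure S = T1" using S(1) by (rule subdomain_cases)
    obtain T2 where T2: "S' = interior T2" "closure S' = T2" using S(2) by (rule subdomain_cases)
    have "T \<subseteq> T1" "T \<subseteq> T2" using T T1 T2 by (auto simp: A_def)
    then have "interior T \<subseteq> S \<inter> S'" unfolding T1(1) T2(1) using interior_mono by blast
    moreover have "S \<inter> S' = {}" using disjoint_subdomains S by (auto simp: pairwise_def disjnt_def)
    ultimately show False using F.mesh_interior A_mesh T(1) by blast
  qed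
  have lmeas: "T \<in> lmeasurable" if "T \<in> F.mesh" for T
    using lmeasurable_full_simplex(1)[OF F.mesh_simplex[OF that]] .
  let ?U = "\<Union>S\<in>subdomains K. A S"
  have U_mesh: "?U \<subseteq> F.mesh" using A_mesh by blast
  have "(\<Sum>S\<in>subdomains K. \<Sum>T\<in>A S. measure lebesgue T) = (\<Sum>T\<in>?U. measure lebesgue T)"
    by (rule sum.UNION_disjoint[symmetric]) (use finite_subdomains finA disj in auto)
  also have "\<dots> = measure lebesgue (\<Union>?U)"
  proof (rule measure_negligible_finite_Union[symmetric])
    show "finite ?U" using finite_subset[OF U_mesh F.finite_mesh] .
    show "T \<in> lmeasurable" if "T \<in> ?U" for T using U_mesh that lmeas by blast
    show "pairwise (\<lambda>T T'. negligible (T \<inter> T')) ?U"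
      unfolding pairwise_def
    proof (intro ballI impI)
      fix T T' assume "T \<in> ?U" "T' \<in> ?U" "T \<noteq> T'"
      then have "T \<in> F.mesh" "T' \<in> F.mesh" using U_mesh by blast+
      then show "negligible (T \<inter> T')"
        using negligible_Int_full_simplices[OF F.mesh_triangulation _ _ \<open>T \<noteq> T'\<close>] F.mesh_simplex by simp
    qed
  qed
  also have "\<dots> \<le> measure lebesgue (cbox 0 1 - ?inner)"
  proof (rule measure_mono_fmeasurable)
    show "\<Union>?U \<subseteq> cbox 0 1 - ?inner"
    proof
      fix x assume "x \<in> \<Union>?U"
      then obtain S T where T: "T \<in> A S" "x \<in> T" by blast
      then obtain q where q: "q extreme_point_of T" "q \<in> frontier (box 0 1)" by (auto simp: A_def)
      have "T \<in> F.mesh" using T(1) A_mesh by blast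
      moreover have "q \<in> T" using q(1) by (simp add: extreme_point_of_def)
      ultimately show "x \<in> cbox 0 1 - ?inner"
        using boundary_strip q(2) T(2) F.mesh_subset_cube by blast
    qed
    show "\<Union>?U \<in> sets lebesgue"
      using U_mesh lmeas finite_subset[OF U_mesh F.finite_mesh] by (intro sets.finite_Union) blast+
    show "cbox 0 1 - ?inner \<in> lmeasurable" by (intro fmeasurable.Diff lmeasurable_cbox lmeasurable_box)
  qed
  also have "\<dots> = 1 - (1 - 1 / m) ^ CARD('n)"
  proof -
    have le: "1 / real (2 * m) \<le> 1 - 1 / real (2 * m)" using m_pos by (simp add: field_simps)
    have "?inner \<subseteq> cbox 0 1"
    proof
      fix x assume "x \<in> ?inner"
      then have x: "1 / (2 * m) < x $ k" "x $ k < 1 - 1 / (2 * m)" for k by (auto simp: mem_box_cart)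
      have "0 \<le> 1 / (2 * real m)" by simp
      then have "0 \<le> x $ k \<and> x $ k \<le> 1" for k using x[of k] by linarith
      then show "x \<in> cbox 0 1" by (simp add: mem_box_cart)
    qed
    then have "measure lebesgue (cbox 0 1 - ?inner) = measure lebesgue (cbox 0 (1::real^'n)) - measure lebesgue ?inner"
      by (intro measurable_measure_Diff lmeasurable_cbox) auto
    also have "\<dots> = 1 - (1 - 1 / (2 * m) - 1 / (2 * m)) ^ CARD('n)"
      unfolding unit_cube_eq measure_cube(2)[OF le] measure_cube(1)[OF zero_le_one] by simp
    also have "1 - 1 / (2 * m) - 1 / (2 * m) = 1 - 1 / m" using m_pos by (simp add: field_simps)
    finally show ?thesis .
  qed
  finally have strip: "(\<Sum>S\<in>subdomains K. \<Sum>T\<in>A S. measure lebesgue T) \<le> 1 - (1 - 1 / m) ^ CARD('n)" .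
  have "\<exists>c. cball c F.inradius \<subseteq> T" if "S \<in> subdomains K" "T \<in> fine_mesh K S" for S T
  proof -
    have "T \<in> F.mesh" using that by simp
    then obtain c where "cball c F.inradius \<subseteq> T" by (rule F.mesh_ball)
    then show ?thesis by blast
  qed
  from bump_energy_le[OF F.inradius_pos this]
  have "a_form K bump bump \<le> 1 / F.inradius\<^sup>2 * (\<Sum>S\<in>subdomains K. \<Sum>T\<in>A S. measure lebesgue T)"
    unfolding A_def .
  also have "\<dots> \<le> 1 / F.inradius\<^sup>2 * (1 - (1 - 1 / m) ^ CARD('n))"
    using strip by (intro mult_left_mono) auto
  also have "1 / F.inradius\<^sup>2 = (4 * real m * (real CARD('n) + 1))\<^sup>2"
    by (simp add: F.inradius_def power_divide)
  finally show ?thesis .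
qed

text \<open>Every subdomain that meets the concentric cube at distance \<open>2/m\<close> from the boundary has an inner corner. Comparing the volume of this cube with
  the volumes of balls around the subdomains gives the number of such subdomains up to a constant.
  The factor \<open>1/(4 n (n + 1))\<close> is the ratio of the inradius of a fine cell to the bound \<open>n/m\<close> for the diameter of a coarse one.\<close>

lemma corner_bump_energy_bound:
  assumes "4 \<le> m"
  shows "(1 / (4 * real CARD('n) * (real CARD('n) + 1))) ^ CARD('n) * (2 * real m / real CARD('n))\<^sup>2 * (1 - 4 / m) ^ CARD('n)
    \<le> a_form K corner_bump corner_bump"
proof -
  define n where "n = real CARD('n)"
  have n: "0 < n" "0 < real m" using m_pos by (simp_all add: n_def)
  define V where "V = unit_ball_vol (real DIM(real^'n))"
  have V: "0 < V" by (simp add: V_def)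
  have ball_vol: "measure lebesgue (cball (x::real^'n) r) = V * r ^ CARD('n)" if "0 \<le> r" for x r
    using content_cball[OF that, of x] by (simp add: V_def)
  define \<S> where "\<S> = {S \<in> subdomains K. corners K \<inter> closure S \<inter> box 0 1 \<noteq> {}}"
  let ?inner = "cbox (\<chi> i. 2 / m) (\<chi> i. 1 - 2 / m) :: (real^'n) set"
  have fin: "finite \<S>" using finite_subdomains by (simp add: \<S>_def)
  have meas: "closure S \<in> lmeasurable \<and> measure lebesgue (closure S) \<le> V * (n / m) ^ CARD('n)" if "S \<in> \<S>" for S
  proof -
    obtain T where T: "T \<in> C.mesh" "closure S = T" using \<open>S \<in> \<S>\<close> subdomain_cases unfolding \<S>_def by blast
    have "T \<in> lmeasurable" using lmeasurable_full_simplex(1)[OF C.mesh_simplex[OF T(1)]] .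
    obtain x where "x \<in> T" using C.mesh_interior[OF T(1)] interior_subset by blast
    then have "T \<subseteq> cball x (n / m)" using C.mesh_dist[OF T(1)] by (auto simp: n_def)
    then have "measure lebesgue T \<le> measure lebesgue (cball x (n / m))"
      using \<open>T \<in> lmeasurable\<close> by (intro measure_mono_fmeasurable lmeasurable_cball) auto
    then show ?thesis using ball_vol[of "n / m" x] n T(2) \<open>T \<in> lmeasurable\<close> by simp
  qed
  have cover: "?inner \<subseteq> (\<Union>S\<in>\<S>. closure S)"
  proof
    fix x assume x: "x \<in> ?inner"
    then have bounds: "2 / m \<le> x $ k" "x $ k \<le> 1 - 2 / m" for k by (auto simp: mem_box_cart)
    have pos: "0 < 1 / real m" "2 / real m = 1 / m + 1 / m" using n by simp_all
    then have "0 \<le> x $ k \<and> x $ k \<le> 1" for k using bounds[of k] by linarith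
    then have "x \<in> cbox 0 1" by (simp add: mem_box_cart)
    then obtain T where T: "T \<in> C.mesh" "x \<in> T" using C.Union_mesh by blast
    obtain p where p: "p extreme_point_of T"
      using convex_contains_simplex[OF C.mesh_simplex[OF T(1)], of "{}"] T(2) by auto
    have "p \<in> T" using p by (simp add: extreme_point_of_def)
    have "0 < p $ k \<and> p $ k < 1" for k
      using C.mesh_component_dist[OF T(1) \<open>p \<in> T\<close> T(2), of k] bounds[of k] pos unfolding abs_le_iff by linarith
    then have "p \<in> box 0 1" by (simp add: mem_box_cart)
    moreover have "p \<in> corners K" using p T(1) by (auto simp: corners_eq mesh_nodes_def)
    ultimately have "interior T \<in> \<S>" using T(1) \<open>p \<in> T\<close> C.mesh_closure_interior[OF T(1)] unfolding \<S>_def by auto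
    then show "x \<in> (\<Union>S\<in>\<S>. closure S)" using T(2) C.mesh_closure_interior[OF T(1)] by blast
  qed
  have le: "2 / real m \<le> 1 - 2 / m" using assms n by (simp add: field_simps)
  have "(1 - 4 / m) ^ CARD('n) = (1 - 2 / m - 2 / m) ^ CARD('n)" by simp
  also have "\<dots> = measure lebesgue ?inner" by (rule measure_cube(1)[OF le, symmetric])
  also have "\<dots> \<le> measure lebesgue (\<Union>S\<in>\<S>. closure S)"
    using meas fin by (intro measure_mono_fmeasurable[OF cover] fmeasurable.finite_UN) auto
  also have "\<dots> \<le> (\<Sum>S\<in>\<S>. measure lebesgue (closure S))"
    using meas fin by (intro measure_UNION_le) auto
  also have "\<dots> \<le> (\<Sum>S\<in>\<S>. V * (n / m) ^ CARD('n))" using meas by (intro sum_mono) auto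
  finally have count: "(1 - 4 / m) ^ CARD('n) \<le> real (card \<S>) * (V * (n / m) ^ CARD('n))" by simp
  define \<kappa> where "\<kappa> = 1 / (4 * n * (n + 1))"
  define d where "d = n / (2 * m)"
  have \<kappa>: "F.inradius = \<kappa> * (n / m)" "0 < \<kappa>"
    using n by (simp_all add: \<kappa>_def F.inradius_def n_def[symmetric])
  have vol: "V * F.inradius ^ CARD('n) \<le> measure lebesgue T" if "T \<in> F.mesh" for T
  proof -
    obtain c where "cball c F.inradius \<subseteq> T" using F.mesh_ball[OF \<open>T \<in> F.mesh\<close>] .
    then have "measure lebesgue (cball c F.inradius) \<le> measure lebesgue T"
      using lmeasurable_full_simplex(1)[OF F.mesh_simplex[OF that]] by (intro measure_mono_fmeasurable) auto
    then show ?thesis using ball_vol F.inradius_pos by simp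
  qed
  have energy: "real (card \<S>) * (V * F.inradius ^ CARD('n) / d\<^sup>2) \<le> a_form K corner_bump corner_bump"
  proof (rule corner_bump_energy_ge)
    show "0 < d" "0 \<le> V * F.inradius ^ CARD('n)" using n V F.inradius_pos by (simp_all add: d_def)
    show "diameter T \<le> d" if "T \<in> fine_mesh K S" for S T
      using F.mesh_diameter_le[of T] that by (simp add: d_def n_def)
    show "V * F.inradius ^ CARD('n) \<le> measure lebesgue T" if "T \<in> fine_mesh K S" for S T
      using vol that by simp
  qed (auto simp: \<S>_def)
  have "\<kappa> ^ CARD('n) * (2 * real m / n)\<^sup>2 * (1 - 4 / m) ^ CARD('n)
      \<le> \<kappa> ^ CARD('n) * (2 * real m / n)\<^sup>2 * (real (card \<S>) * (V * (n / m) ^ CARD('n)))"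
    using count \<kappa>(2) by (intro mult_left_mono) auto
  also have "\<dots> = real (card \<S>) * (V * F.inradius ^ CARD('n) / d\<^sup>2)"
    unfolding \<kappa>(1) power_mult_distrib d_def using n by (simp add: field_simps)
  finally show ?thesis using energy by (simp add: \<kappa>_def n_def)
qed

end

theorem proposition1:
  assumes "CARD('n::finite) = 2 \<or> CARD('n) = 3"
  shows "\<not> (\<forall>\<Omega> :: (real ^ 'n) set. polyhedral_domain \<Omega> \<longrightarrow>
           (\<forall>\<F>. admissible_family \<Omega> \<F> \<longrightarrow>
             (\<exists>\<gamma>::real. 0 < \<gamma> \<and> \<gamma> < 1 \<and>
               (\<forall>M\<in>\<F>. \<forall>w\<in>XDelta \<Omega> M.
                 let v = Hc \<Omega> M w;
                     v\<^sub>I\<^sub>\<Delta> = (\<lambda>S x. I_part M v S x + Delta_part \<Omega> M v S x);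
                     v\<^sub>c = c_part \<Omega> M v
                 in \<bar>a_form M v\<^sub>I\<^sub>\<Delta> v\<^sub>c\<bar>
                      \<le> \<gamma> * sqrt (a_form M v\<^sub>I\<^sub>\<Delta> v\<^sub>I\<^sub>\<Delta>) * sqrt (a_form M v\<^sub>c v\<^sub>c)))))"
proof
  assume bound: "\<forall>\<Omega> :: (real ^ 'n) set. polyhedral_domain \<Omega> \<longrightarrow>
           (\<forall>\<F>. admissible_family \<Omega> \<F> \<longrightarrow>
             (\<exists>\<gamma>::real. 0 < \<gamma> \<and> \<gamma> < 1 \<and>
               (\<forall>M\<in>\<F>. \<forall>w\<in>XDelta \<Omega> M.
                 let v = Hc \<Omega> M w;
                     v\<^sub>I\<^sub>\<Delta> = (\<lambda>S x. I_part M v S x + Delta_part \<Omega> M v S x);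
                     v\<^sub>c = c_part \<Omega> M v
                 in \<bar>a_form M v\<^sub>I\<^sub>\<Delta> v\<^sub>c\<bar>
                      \<le> \<gamma> * sqrt (a_form M v\<^sub>I\<^sub>\<Delta> v\<^sub>I\<^sub>\<Delta>) * sqrt (a_form M v\<^sub>c v\<^sub>c))))"
  let ?\<F> = "kuhn_partition ` {4..} :: (real^'n) partition set"
  define n where "n = real CARD('n)"
  have n: "0 < n" by (simp add: n_def)
  have "admissible_family (box 0 1) ?\<F>"
    unfolding admissible_family_def
  proof (intro exI conjI ballI)
    show "0 < real (12 * CARD('n) * (CARD('n) + 1))" by (simp only: of_nat_0_less_iff) simp
    fix M assume "M \<in> ?\<F>"
    then obtain m where m: "4 \<le> m" "M = kuhn_partition m" by auto
    interpret kuhn_refinement m "TYPE('n)" using m(1) by unfold_locales auto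
    show "admissible_partition (12 * CARD('n) * (CARD('n) + 1)) 1 (box 0 1) M"
      unfolding m(2) by (rule kuhn_partition_admissible)
  qed
  with bound polyhedral_unit_box obtain \<gamma> :: real where \<gamma>: "0 < \<gamma>" "\<gamma> < 1"
    and ineq: "\<forall>M\<in>?\<F>. \<forall>w\<in>XDelta (box 0 1) M.
                 let v = Hc (box 0 1) M w;
                     v\<^sub>I\<^sub>\<Delta> = (\<lambda>S x. I_part M v S x + Delta_part (box 0 1) M v S x);
                     v\<^sub>c = c_part (box 0 1) M v
                 in \<bar>a_form M v\<^sub>I\<^sub>\<Delta> v\<^sub>c\<bar>
                      \<le> \<gamma> * sqrt (a_form M v\<^sub>I\<^sub>\<Delta> v\<^sub>I\<^sub>\<Delta>) * sqrt (a_form M v\<^sub>c v\<^sub>c)" by blast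
  have \<gamma>2: "\<gamma>\<^sup>2 < 1" using \<gamma> by (simp add: power_less_one_iff)
  define \<alpha> where "\<alpha> = (1 - \<gamma>\<^sup>2) * ((1 / (4 * n * (n + 1))) ^ CARD('n) * (2 / n)\<^sup>2)"
  define \<beta> where "\<beta> = \<gamma>\<^sup>2 * (4 * (n + 1))\<^sup>2"
  have "0 < \<alpha>" using \<gamma>2 n by (simp add: \<alpha>_def)
  \<comment> \<open>Both energy bounds carry a factor \<open>m\<^sup>2\<close>, which cancels; the right-hand side still tends to zero.\<close>
  have step: "\<alpha> * (1 - 4 / real m) ^ CARD('n) \<le> \<beta> * (1 - (1 - 1 / real m) ^ CARD('n))" if m: "4 \<le> m" for m
  proof -
    interpret kuhn_refinement_dim m "TYPE('n)" using m assms by unfold_locales auto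
    have "(1 - \<gamma>\<^sup>2) * a_form K corner_bump corner_bump \<le> \<gamma>\<^sup>2 * a_form K bump bump"
      using ineq m by (intro strengthened_Cauchy_Schwarz_imp_energy_bound[OF \<gamma>(1)]) blast
    moreover have "(1 - \<gamma>\<^sup>2) * ((1 / (4 * real CARD('n) * (real CARD('n) + 1))) ^ CARD('n) * (2 * real m / real CARD('n))\<^sup>2 * (1 - 4 / m) ^ CARD('n))
        \<le> (1 - \<gamma>\<^sup>2) * a_form K corner_bump corner_bump"
      using corner_bump_energy_bound[OF m] \<gamma>2 by (intro mult_left_mono) auto
    moreover have "\<gamma>\<^sup>2 * a_form K bump bump \<le> \<gamma>\<^sup>2 * ((4 * real m * (real CARD('n) + 1))\<^sup>2 * (1 - (1 - 1 / m) ^ CARD('n)))"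
      using bump_energy_bound by (intro mult_left_mono) auto
    ultimately have "(1 - \<gamma>\<^sup>2) * ((1 / (4 * n * (n + 1))) ^ CARD('n) * (2 * real m / n)\<^sup>2 * (1 - 4 / m) ^ CARD('n))
        \<le> \<gamma>\<^sup>2 * ((4 * real m * (n + 1))\<^sup>2 * (1 - (1 - 1 / m) ^ CARD('n)))"
      unfolding n_def by linarith
    moreover have "(2 * real m / n)\<^sup>2 = (2 / n)\<^sup>2 * (real m)\<^sup>2" "(4 * real m * (n + 1))\<^sup>2 = (4 * (n + 1))\<^sup>2 * (real m)\<^sup>2"
      by (simp_all add: power2_eq_square algebra_simps)
    ultimately have "(\<alpha> * (1 - 4 / m) ^ CARD('n)) * (real m)\<^sup>2 \<le> (\<beta> * (1 - (1 - 1 / m) ^ CARD('n))) * (real m)\<^sup>2"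
      unfolding \<alpha>_def \<beta>_def by (simp only: mult_ac)
    then show ?thesis using m by (simp add: mult_le_cancel_right)
  qed
  have inv: "(\<lambda>m. c / real m) \<longlonglongrightarrow> 0" for c :: real
    by (rule lim_const_over_n)
  have "(\<lambda>m. \<alpha> * (1 - 4 / real m) ^ CARD('n)) \<longlonglongrightarrow> \<alpha> * (1 - 0) ^ CARD('n)"
    by (intro tendsto_intros inv)
  moreover have "(\<lambda>m. \<beta> * (1 - (1 - 1 / real m) ^ CARD('n))) \<longlonglongrightarrow> \<beta> * (1 - (1 - 0) ^ CARD('n))"
    by (intro tendsto_intros inv)
  ultimately have "\<alpha> * (1 - 0) ^ CARD('n) \<le> \<beta> * (1 - (1 - 0) ^ CARD('n))"
    by (rule LIMSEQ_le) (use step in blast)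
  then show False using \<open>0 < \<alpha>\<close> by simp
qed

end
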